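(* For all positive integers $k$ and $r$ with $rk\ge3$, \[ \mathsf{tr}(k,r)=\sum_{j=0}^k\sum_{\ell=0}^{rk-(r+1)j-2}(-1)^j\,2^\ell\binom kj\binom{k-2+\ell}{\ell}\binom{(r-1)k-\ell-3}{rk-(r+1)j-\ell-2} =\sum_{j=0}^k\sum_{\ell=0}^{rk-(r+1)j-1}(-1)^{j+1}\,2^{\ell-1}\binom kj\binom{k-3+\ell}{\ell}\binom{(r-1)k-\ell-2}{rk-(r+1)j-\ell-1}. \]
   Context: For integers $k\ge 3$, $r\ge 1$, let $\mathrm{SC}(k,r)$ be a convex $k$-gon in the plane each of whose sides is subdivided by $r-1$ additional points lying on that side ($kr$ points in total). A triangulation of a finite planar point set $S$ is a dissection of the convex hull of $S$ into triangles by pairwise non-crossing straight segments between points of $S$, maximal in the sense that no point of $S$ lies in the interior of a side of a triangle. For $k\ge3$, $\mathsf{tr}(k,r)$ is the number of triangulations of $\mathrm{SC}(k,r)$. For $k\in\{1,2\}$, $\mathsf{tr}(k,r)$ is defined as $-\frac{1}{4\pi i}\int_{\mathcal C}\frac{((1-t)^{r+1}-t^{r+1})^k\,dt}{t^{rk}(1-t)^{rk}(1-2t)^{k-2}}$ with $\mathcal C$ a small positively oriented contour around $0$. Binomial coefficients $\binom{n}{m}$ with integer $n$ (possibly negative) are $n(n-1)\cdots(n-m+1)/m!$ for $m\ge0$ and $0$ for $m<0$. *)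

theory Defs
  imports "HOL-Complex_Analysis.Complex_Analysis"
begin

text \<open>
  The plane is \<^typ>\<open>complex\<close>. Twice the signed area of the triangle \<open>a b c\<close>; it is positive iff
  \<open>c\<close> lies strictly to the left of the directed line from \<open>a\<close> to \<open>b\<close>.
\<close>

definition orient :: "complex \<Rightarrow> complex \<Rightarrow> complex \<Rightarrow> real" where
  "orient a b c = Im (cnj (b - a) * (c - a))"

text \<open>
  \<open>v 0, \<dots>, v (k - 1)\<close> are the vertices of a (strictly) convex \<open>k\<close>-gon in counterclockwise order:
  every side has all the remaining vertices strictly on its left. For \<open>k \<ge> 3\<close> this forces the
  vertices to be distinct.
\<close>

definition convex_polygon :: "nat \<Rightarrow> (nat \<Rightarrow> complex) \<Rightarrow> bool" where
  "convex_polygon k v \<longleftrightarrow> 3 \<le> k \<and>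
     (\<forall>i<k. \<forall>j<k. j \<noteq> i \<and> j \<noteq> Suc i mod k \<longrightarrow> orient (v i) (v (Suc i mod k)) (v j) > 0)"

text \<open>
  \<open>S\<close> is a realisation of \<open>SC(k,r)\<close>. The polygon and the position of the \<open>r - 1\<close> additional points
  in the relative interior of each side are arbitrary.
\<close>

definition subdivided_convex_polygon :: "nat \<Rightarrow> nat \<Rightarrow> complex set \<Rightarrow> bool" where
  "subdivided_convex_polygon k r S \<longleftrightarrow> finite S \<and> (\<exists>v. convex_polygon k v \<and>
     v ` {..<k} \<subseteq> S \<and> S \<subseteq> (\<Union>i<k. closed_segment (v i) (v (Suc i mod k))) \<and>
     (\<forall>i<k. card (S \<inter> open_segment (v i) (v (Suc i mod k))) = r - 1))"

text \<open>
  A triangulation is represented by its set of (closed) triangles; the dissecting segments are the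
  sides of these triangles, and they do not cross since the triangles have disjoint interiors.
\<close>

definition triangulations :: "complex set \<Rightarrow> complex set set set" where
  "triangulations S = {T.
     (\<forall>t\<in>T. \<exists>a\<in>S. \<exists>b\<in>S. \<exists>c\<in>S. \<not> collinear {a, b, c} \<and> t = convex hull {a, b, c} \<and>
        S \<inter> (open_segment a b \<union> open_segment b c \<union> open_segment c a) = {}) \<and>
     pairwise (\<lambda>t u. interior t \<inter> interior u = {}) T \<and>
     \<Union>T = convex hull S}"

text \<open>
  For \<open>k \<ge> 3\<close> the argument \<open>S\<close> is meant to be a realisation of \<open>SC(k,r)\<close>; for \<open>k < 3\<close> it is not
  used. The only possible singularities of the integrand are \<open>0\<close>, \<open>1/2\<close> and \<open>1\<close>, so the circle of
  radius \<open>1/4\<close> is a small contour around \<open>0\<close>.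
\<close>

definition tr :: "nat \<Rightarrow> nat \<Rightarrow> complex set \<Rightarrow> complex" where
  "tr k r S = (if 3 \<le> k then of_nat (card (triangulations S))
     else - 1 / (4 * of_real pi * \<i>) *
       contour_integral (circlepath 0 (1/4))
         (\<lambda>t. ((1 - t) ^ (r + 1) - t ^ (r + 1)) ^ k /
              (t ^ (r * k) * (1 - t) ^ (r * k) * (1 - 2 * t) powi (int k - 2))))"

definition ibinom :: "int \<Rightarrow> int \<Rightarrow> complex" where
  "ibinom n m = (if m < 0 then 0 else of_int n gchoose nat m)"

end

theory Submission
  imports Defs
begin

text \<open>
  Removing the triangle at a fixed boundary edge splits a triangulated polygon into the two polygons
  spanned by consecutive runs of its points. Let \<open>G\<close> be the strictly upper triangular matrix whose
  entry at \<open>(a, b)\<close> counts the triangulations of the polygon spanned by the points \<open>a, \<dots>, b\<close>. Since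
  collinear runs contribute nothing, \<open>G = W + G\<^sup>2\<close>, where \<open>W\<close> is \<open>1\<close> at \<open>(a, a + 1)\<close> and \<open>-1\<close> at
  \<open>(a, a + 2)\<close> if \<open>a + 1\<close> is not a vertex. Let \<open>q\<close> be row \<open>0\<close> of \<open>(1 - W / (t (1 - t)))\<^sup>-\<^sup>1\<close>; its
  entry at \<open>n = r k\<close>, times \<open>(1 - 2t)\<^sup>2\<close>, is the integrand of the contour integral. From
  \<open>t (1 - t) - W = (t - G) (1 - t - G)\<close>, partial fractions give \<open>(1 - 2t) q = y - z\<close>, where \<open>z\<close> is a
  power series in \<open>t\<close> and the coefficients of \<open>y\<close> are polynomials in \<open>G\<close>. The residue of \<open>(1 - 2t) q\<close>
  at \<open>n\<close> is \<open>0\<close>, which makes the two double sums equal, and the residue of \<open>(1 - 2t)\<^sup>2 q\<close> is \<open>-2\<close>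
  times the number of triangulations.
\<close>

section \<open>Counting triangulations of chains\<close>

text \<open>The obstacle is that the polygon is closed while \<open>G\<close> is indexed along a
  line: with \<open>n = r * k\<close>, the numbers \<open>0\<close> and \<open>n\<close> name the
  same vertex, and that \<open>n, 1, ..., r\<close> are collinear is invisible to
  \<open>same_side\<close>. Hence the number wanted is not an entry of \<open>G\<close>. Placing the
  first triangle on the edge from \<open>n\<close> to \<open>1\<close> allows only apexes
  \<open>m > r\<close>, and the recursion for \<open>G(1, n)\<close> exceeds this by the term
  \<open>G(2, n)\<close> unless \<open>r = 1\<close>. The corrected value is entry
  \<open>(0, n)\<close> of \<open>W G\<close>. This explains the residue: up to the factor
  \<open>1 - t\<close>, \<open>y\<close> is the geometric series in \<open>G / t\<close>, so its
  coefficients at \<open>t^-1\<close> and \<open>t^-2\<close> are \<open>G - G^2 = W\<close> and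
  \<open>(G - G^2) G = W G\<close>, and the factor \<open>1 - 2t\<close> adds \<open>-2\<close>
  times the second to the first. For \<open>k < 3\<close> no geometry is left: the integral is
  \<open>-1/2\<close> times the same residue. On the geometric side the difficulty is flat angles,
  since inner points of a side lie on lines through other points of the set; supporting lines of the
  chain and the emptiness of triangle sides deal with them.\<close>

text \<open>
  The points are numbered along the boundary, the multiples of \<open>r\<close> being the vertices of the polygon;
  \<open>same_side r a b\<close> is meant for \<open>a \<le> b\<close>.
\<close>

definition same_side :: "nat \<Rightarrow> nat \<Rightarrow> nat \<Rightarrow> bool" where
  "same_side r a b \<longleftrightarrow> b \<le> (a div r + 1) * r"

text \<open>For \<open>1 \<le> r\<close> neighbours also satisfy \<open>same_side\<close>, so the
  test \<open>b = Suc a\<close> has to come first: the degenerate polygon on two points counts 1,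
  which makes the products right when the apex is next to an end of the base.\<close>

function chain_count :: "nat \<Rightarrow> nat \<Rightarrow> nat \<Rightarrow> nat" where
  "chain_count r a b = (if b = Suc a then 1 else if b \<le> a \<or> same_side r a b then 0
     else (\<Sum>m\<in>{a<..<b}. chain_count r a m * chain_count r m b))"
  by pat_completeness auto
termination
  by (relation "Wellfounded.measure (\<lambda>(r, a, b). b - a)") auto

declare chain_count.simps [simp del]

text \<open>The entry -1 cancels the only wrong term of the square: for collinear \<open>a\<close>,
  \<open>a + 1\<close>, \<open>a + 2\<close> the product of the two unit steps is 1 although the
  three points span no triangle.\<close>

definition tile :: "nat \<Rightarrow> nat \<Rightarrow> nat \<Rightarrow> int" where
  "tile r a b = (if b = Suc a then 1 else if b = a + 2 \<and> \<not> r dvd Suc a then -1 else 0)"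

lemma chain_count_le [simp]: "b \<le> a \<Longrightarrow> chain_count r a b = 0"
  by (subst chain_count.simps) auto

lemma chain_count_Suc [simp]: "chain_count r a (Suc a) = 1"
  by (subst chain_count.simps) auto

lemma chain_count_same_side: "same_side r a b \<Longrightarrow> b \<noteq> Suc a \<Longrightarrow> chain_count r a b = 0"
  by (subst chain_count.simps) auto

lemma same_side_subset:
  assumes "same_side r a b" "a \<le> a'" "b' \<le> b"
  shows "same_side r a' b'"
proof -
  have "a div r \<le> a' div r" using assms(2) by (rule div_le_mono)
  then have "(a div r + 1) * r \<le> (a' div r + 1) * r" by (intro mult_le_mono1) simp
  then show ?thesis using assms unfolding same_side_def by linarith
qed

lemma same_side_Suc_Suc:
  assumes "1 \<le> r"
  shows "same_side r a (a + 2) \<longleftrightarrow> \<not> r dvd Suc a"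
proof -
  have "a + 2 \<le> (a div r + 1) * r \<longleftrightarrow> a mod r + 2 \<le> r"
    using div_mult_mod_eq[of a r] unfolding add_mult_distrib by linarith
  also have "\<dots> \<longleftrightarrow> \<not> r dvd Suc a"
    using assms mod_less_divisor[of r a]
    by (simp add: dvd_eq_mod_eq_0 mod_Suc del: mod_less_divisor)
  finally show ?thesis by (simp add: same_side_def)
qed

lemma chain_count_square:
  assumes "1 \<le> r"
  shows "int (chain_count r a b) = tile r a b + (\<Sum>m\<in>{a<..<b}. int (chain_count r a m) * int (chain_count r m b))"
proof -
  consider "b \<le> Suc a" | "b = a + 2" | "a + 3 \<le> b" "same_side r a b" | "a + 3 \<le> b" "\<not> same_side r a b"
    by linarith
  then show ?thesis
  proof cases
    case 1
    then show ?thesis by (cases "b = Suc a") (auto simp: tile_def)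
  next
    case 2
    have "{a<..<b} = {Suc a}" using 2 by auto
    then show ?thesis using 2 same_side_Suc_Suc[OF assms, of a]
      by (subst chain_count.simps) (auto simp: tile_def)
  next
    case 3
    \<comment> \<open>At least one of the two pieces has length two or more, and it lies on the same
      side.\<close>
    have "int (chain_count r a m) * int (chain_count r m b) = 0" if m: "m \<in> {a<..<b}" for m
    proof (cases "m = Suc a")
      case True
      then have "chain_count r m b = 0"
        using 3 m by (intro chain_count_same_side same_side_subset[OF 3(2)]) auto
      then show ?thesis by simp
    next
      case False
      then have "chain_count r a m = 0"
        using 3 m by (intro chain_count_same_side same_side_subset[OF 3(2)]) auto
      then show ?thesis by simp
    qed
    then have "(\<Sum>m\<in>{a<..<b}. int (chain_count r a m) * int (chain_count r m b)) = 0"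
      by (intro sum.neutral) blast
    then show ?thesis using 3 by (simp add: tile_def chain_count_same_side)
  next
    case 4
    then show ?thesis by (subst chain_count.simps) (simp add: tile_def)
  qed
qed

lemma tile_eq:
  assumes "1 \<le> r"
  shows "tile r a b = int (chain_count r a b) - (\<Sum>m<b. int (chain_count r a m) * int (chain_count r m b))"
proof -
  have "(\<Sum>m<b. int (chain_count r a m) * int (chain_count r m b)) =
      (\<Sum>m\<in>{a<..<b}. int (chain_count r a m) * int (chain_count r m b))"
    by (intro sum.mono_neutral_right) auto
  then show ?thesis using chain_count_square[OF assms, of a b] by simp
qed

section \<open>Row 0 of the inverse matrix and its Laurent coefficients\<close>

context
  fixes r :: nat and q :: "nat \<Rightarrow> complex fls"
  assumes r: "1 \<le> r"
    and q: "\<And>b. fls_X * (1 - fls_X) * q b =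
      (if b = 0 then fls_X * (1 - fls_X) else 0) + (\<Sum>m<b. q m * of_int (tile r m b))"
begin

text \<open>This is the row \<open>q (1 - u - G)\<close>. The overview's \<open>y\<close> and
  \<open>z\<close> are \<open>factor fls_X\<close> and \<open>factor (1 - fls_X)\<close>; one
  parameter serves both because \<open>factor_eq\<close> asks only for the value of
  \<open>u (1 - u)\<close>.\<close>

definition factor :: "complex fls \<Rightarrow> nat \<Rightarrow> complex fls" where
  "factor u b = (1 - u) * q b - (\<Sum>m<b. q m * of_nat (chain_count r m b))"

text \<open>
  With row vectors and matrices indexed by the points this is the factorisation
  \<open>(u - G) (1 - u - G) = u (1 - u) - (G - G\<^sup>2)\<close>.
\<close>

lemma factor_eq:
  assumes u: "u * (1 - u) = fls_X * (1 - fls_X)"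
  shows "u * factor u b = (if b = 0 then fls_X * (1 - fls_X) else 0)
    + (\<Sum>m<b. factor u m * of_nat (chain_count r m b))"
proof -
  let ?G = "\<lambda>a b. of_nat (chain_count r a b) :: complex fls"
  have "(\<Sum>m<b. factor u m * ?G m b) = (1 - u) * (\<Sum>m<b. q m * ?G m b)
      - (\<Sum>m<b. \<Sum>l<m. q l * ?G l m * ?G m b)"
  proof -
    have "factor u m * ?G m b = (1 - u) * (q m * ?G m b) - (\<Sum>l<m. q l * ?G l m * ?G m b)" for m
      by (simp add: factor_def left_diff_distrib[of "(1 - u) * q m"] sum_distrib_right mult.assoc)
    then show ?thesis by (simp add: sum_subtractf sum_distrib_left)
  qed
  \<comment> \<open>The inner range may grow to \<open>l < b\<close> because \<open>G\<close> is
    strictly upper triangular; after swapping, the inner sum is an entry of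
    \<open>G^2 = G - W\<close>.\<close>
  also have "(\<Sum>m<b. \<Sum>l<m. q l * ?G l m * ?G m b) = (\<Sum>m<b. \<Sum>l<b. q l * ?G l m * ?G m b)"
    by (intro sum.cong sum.mono_neutral_left) auto
  also have "\<dots> = (\<Sum>l<b. q l * (\<Sum>m<b. ?G l m * ?G m b))"
    by (subst sum.swap) (simp add: sum_distrib_left mult.assoc)
  also have "\<dots> = (\<Sum>l<b. q l * (?G l b - of_int (tile r l b)))"
    by (simp add: tile_eq[OF r])
  also have "\<dots> = (\<Sum>l<b. q l * ?G l b) - (\<Sum>l<b. q l * of_int (tile r l b))"
    by (simp add: right_diff_distrib sum_subtractf)
  finally have *: "(\<Sum>m<b. factor u m * ?G m b) = (1 - u) * (\<Sum>m<b. q m * ?G m b)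
      - ((\<Sum>l<b. q l * ?G l b) - (\<Sum>l<b. q l * of_int (tile r l b)))" .
  have "u * factor u b = u * (1 - u) * q b - u * (\<Sum>m<b. q m * ?G m b)"
    by (simp add: factor_def algebra_simps)
  also have "u * (1 - u) * q b = (if b = 0 then fls_X * (1 - fls_X) else 0) + (\<Sum>m<b. q m * of_int (tile r m b))"
    unfolding u by (rule q)
  finally show ?thesis unfolding * by (simp add: algebra_simps)
qed

lemma factor_diff: "factor fls_X b - factor (1 - fls_X) b = (1 - 2 * fls_X) * q b"
  by (simp add: factor_def algebra_simps)

lemma fps_to_fls_sum: "fps_to_fls (\<Sum>x\<in>A. f x) = (\<Sum>x\<in>A. fps_to_fls (f x :: 'a :: comm_monoid_add fps))"
  by (intro fls_eqI) (simp add: fls_nth_sum fps_sum_nth)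

text \<open>For \<open>u = 1 - fls_X\<close> the factor \<open>u\<close> in \<open>factor_eq\<close>
  has constant term 1, so dividing by it stays within power series, and induction on
  \<open>b\<close> never creates a negative power.\<close>

lemma factor_regular: "\<exists>f. factor (1 - fls_X) b = fps_to_fls f"
proof (induction b rule: less_induct)
  case (less b)
  then obtain f where f: "\<And>m. m < b \<Longrightarrow> factor (1 - fls_X) m = fps_to_fls (f m)" by metis
  define g where "g = (if b = 0 then fps_X * (1 - fps_X) else 0) + (\<Sum>m<b. f m * of_nat (chain_count r m b))"
  have "(1 - fls_X) * factor (1 - fls_X) b = fps_to_fls g"
  proof -
    have "(1 - fls_X) * (1 - (1 - fls_X)) = fls_X * (1 - fls_X :: complex fls)"
      by (simp add: mult.commute)
    from factor_eq[OF this, of b]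
    have "(1 - fls_X) * factor (1 - fls_X) b = (if b = 0 then fls_X * (1 - fls_X) else 0)
        + (\<Sum>m<b. fps_to_fls (f m) * of_nat (chain_count r m b))"
      using f by simp
    also have "\<dots> = fps_to_fls g"
      by (simp add: g_def fps_to_fls_sum fls_times_fps_to_fls fps_to_fls_of_nat)
    finally show ?thesis .
  qed
  moreover have "fps_to_fls ((1 - fps_X) * inverse (1 - fps_X :: complex fps)) = 1"
    by (subst inverse_mult_eq_1') simp_all
  then have "(1 - fls_X) * fps_to_fls (inverse (1 - fps_X :: complex fps)) = 1"
    by (simp add: fls_times_fps_to_fls)
  ultimately have "fps_to_fls (inverse (1 - fps_X)) * fps_to_fls g =
      ((1 - fls_X) * fps_to_fls (inverse (1 - fps_X))) * factor (1 - fls_X) b"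
    by (metis mult.assoc mult.commute)
  then have "factor (1 - fls_X) b = fps_to_fls (inverse (1 - fps_X) * g)"
    using \<open>(1 - fls_X) * fps_to_fls (inverse (1 - fps_X)) = 1\<close>
    by (simp only: fls_times_fps_to_fls mult_1_left)
  then show ?case by blast
qed

text \<open>Division by \<open>fls_X\<close> lowers degrees by one, so each coefficient comes from
  the next higher one. The row is row 0 of \<open>1 - t\<close> times the sum of all
  \<open>G^i / t^i\<close>: it has \<open>-1\<close> at degree 1, \<open>1 - G\<close> at degree 0,
  then \<open>G - G^2 = W\<close> and \<open>W G\<close>.\<close>

lemma factor_nth:
  "fls_nth (factor fls_X b) i = (if b = 0 then (if i = 0 then 1 else if i = 1 then - 1 else 0) else 0)
     + (\<Sum>m<b. fls_nth (factor fls_X m) (i + 1) * of_nat (chain_count r m b))"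
proof -
  have "fls_nth (fls_X * factor fls_X b) (i + 1) = fls_nth ((if b = 0 then fls_X * (1 - fls_X) else 0)
    + (\<Sum>m<b. factor fls_X m * of_nat (chain_count r m b))) (i + 1)"
    by (subst factor_eq) simp_all
  then show ?thesis
    by (simp add: fls_X_times_conv_shift fls_nth_sum)
qed

lemma factor_nth_ge_2: "2 \<le> i \<Longrightarrow> fls_nth (factor fls_X b) i = 0"
proof (induction b arbitrary: i rule: less_induct)
  case (less b)
  then show ?case by (subst factor_nth) auto
qed

lemma factor_nth_1: "fls_nth (factor fls_X b) 1 = (if b = 0 then -1 else 0)"
  by (subst factor_nth) (simp add: factor_nth_ge_2)

lemma factor_nth_0: "fls_nth (factor fls_X b) 0 = (if b = 0 then 1 else 0) - of_nat (chain_count r 0 b)"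
proof -
  have "(\<Sum>m<b. (if m = 0 then - 1 else 0) * complex_of_nat (chain_count r m b)) =
    (\<Sum>m<b. (if m = 0 then - complex_of_nat (chain_count r m b) else 0))"
    by (intro sum.cong) auto
  then show ?thesis
    by (subst factor_nth) (auto simp: factor_nth_1)
qed

lemma factor_nth_minus_1: "fls_nth (factor fls_X b) (-1) = of_int (tile r 0 b)"
proof -
  have "fls_nth (factor fls_X b) (-1) = (\<Sum>m<b. ((if m = 0 then 1 else 0) - of_nat (chain_count r 0 m)) * complex_of_nat (chain_count r m b))"
    by (subst factor_nth) (simp add: factor_nth_0)
  also have "\<dots> = (\<Sum>m<b. (if m = 0 then complex_of_nat (chain_count r m b) else 0)) -
     (\<Sum>m<b. of_nat (chain_count r 0 m) * complex_of_nat (chain_count r m b))"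
    unfolding sum_subtractf[symmetric] by (intro sum.cong) auto
  also have "(\<Sum>m<b. (if m = 0 then complex_of_nat (chain_count r m b) else 0)) = of_nat (chain_count r 0 b)"
    by auto
  finally show ?thesis by (simp add: tile_eq[OF r])
qed

lemma factor_nth_minus_2:
  "fls_nth (factor fls_X b) (-2) = (\<Sum>m<b. of_int (tile r 0 m) * of_nat (chain_count r m b))"
  by (subst factor_nth) (simp add: factor_nth_minus_1)

lemma residue_times_linear:
  "fls_residue ((1 - 2 * fls_X) * q b) = of_int (tile r 0 b)"
proof -
  obtain f where f: "factor (1 - fls_X) b = fps_to_fls f" using factor_regular by blast
  show ?thesis
    unfolding factor_diff[symmetric] f
    by (simp add: factor_nth_minus_1)
qed

text \<open>Compared with \<open>residue_times_linear\<close>, the extra factor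
  \<open>1 - 2t\<close> brings in \<open>-2\<close> times the coefficient of \<open>y\<close> at
  degree -2, hence the entry of \<open>W G\<close>.\<close>

lemma residue_times_linear_square:
  "fls_residue ((1 - 2 * fls_X) ^ 2 * q b) = of_int (tile r 0 b) -
     2 * (\<Sum>m<b. of_int (tile r 0 m) * of_nat (chain_count r m b))"
proof -
  obtain f where f: "factor (1 - fls_X) b = fps_to_fls f" using factor_regular by blast
  have "(1 - 2 * fls_X) ^ 2 * q b = (1 - 2 * fls_X) * (factor fls_X b - fps_to_fls f)"
    unfolding f[symmetric] factor_diff by (simp add: power2_eq_square mult.assoc)
  also have "\<dots> = (factor fls_X b - fps_to_fls f) - fls_const 2 * (fls_X * (factor fls_X b - fps_to_fls f))"
    by (simp add: algebra_simps flip: fls_const_numeral)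
  finally show ?thesis
    by (simp add: factor_nth_minus_1 fls_X_times_conv_shift factor_nth_minus_2)
qed

end

section \<open>Residues and coefficients\<close>

text \<open>The characteristic roots of this recursion are \<open>1 / t\<close> and
  \<open>1 / (1 - t)\<close>. The solution \<open>P l\<close> is the weighted number of ways to fill
  a segment of length \<open>l\<close> with steps of length 1 and 2, of weights
  \<open>1 / (t (1 - t))\<close> and \<open>-1 / (t (1 - t))\<close>.\<close>

lemma two_step_polynomial:
  fixes t :: "complex fls" and P :: "nat \<Rightarrow> complex fls"
  assumes "t \<noteq> 0" "1 - t \<noteq> 0" "1 - 2 * t \<noteq> 0"
    and P: "\<And>l. P l = ((1 - t) ^ (l + 1) - t ^ (l + 1)) / ((1 - 2 * t) * (t * (1 - t)) ^ l)"
  shows "P 0 = 1" "t * (1 - t) * P 1 = 1" "t * (1 - t) * P (l + 2) = P (l + 1) - P l"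
proof -
  show "P 0 = 1" unfolding P using assms(3) by simp
  have "(1 - t) ^ 2 - t ^ 2 = 1 - 2 * t" by (simp add: power2_eq_square algebra_simps)
  then show "t * (1 - t) * P 1 = 1" unfolding P using assms(1-3) by (simp add: power2_eq_square)
  define s where "s = 1 - t"
  have s: "s \<noteq> 0" "t + s = 1" using assms by (auto simp: s_def)
  have num: "s ^ (l + 3) - t ^ (l + 3) = s ^ (l + 2) - t ^ (l + 2) - t * s * (s ^ (l + 1) - t ^ (l + 1))"
  proof -
    have "s ^ (l + 2) * (t + s) - t ^ (l + 2) * (t + s) - t * s * (s ^ (l + 1) - t ^ (l + 1))
        = s ^ (l + 3) - t ^ (l + 3)"
      by (simp add: algebra_simps power_add power2_eq_square power3_eq_cube)
    then show ?thesis using s(2) by simp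
  qed
  have "t * s * P (l + 2) = (s ^ (l + 3) - t ^ (l + 3)) / ((1 - 2 * t) * (t * s) ^ (l + 1))"
    unfolding P s_def[symmetric] using assms(1,3) s(1)
    by (simp add: field_simps eval_nat_numeral)
  also have "\<dots> = (s ^ (l + 2) - t ^ (l + 2)) / ((1 - 2 * t) * (t * s) ^ (l + 1))
     - t * s * (s ^ (l + 1) - t ^ (l + 1)) / ((1 - 2 * t) * (t * s) ^ (l + 1))"
    unfolding num by (simp add: diff_divide_distrib)
  also have "\<dots> = P (l + 1) - P l"
    unfolding P s_def[symmetric] using assms(1,3) s(1) by (simp add: eval_nat_numeral)
  finally show "t * (1 - t) * P (l + 2) = P (l + 1) - P l" by (simp add: s_def)
qed

lemma fls_linear_nonzero: "1 - fls_X \<noteq> (0 :: complex fls)" "1 - 2 * fls_X \<noteq> (0 :: complex fls)"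
proof -
  have "fls_nth (1 - fls_X :: complex fls) 0 \<noteq> fls_nth 0 0"
    "fls_nth (1 - 2 * fls_X :: complex fls) 0 \<noteq> fls_nth 0 0" by simp_all
  then show "1 - fls_X \<noteq> (0 :: complex fls)" "1 - 2 * fls_X \<noteq> (0 :: complex fls)" by metis+
qed

definition tiling_series :: "nat \<Rightarrow> complex fls" where
  "tiling_series l = ((1 - fls_X) ^ (l + 1) - fls_X ^ (l + 1)) / ((1 - 2 * fls_X) * (fls_X * (1 - fls_X)) ^ l)"

lemma tile_sum:
  "(\<Sum>m<Suc b. q m * of_int (tile r m (Suc b))) =
     q b - (if 1 \<le> b \<and> \<not> r dvd b then q (b - 1) else (0 :: complex fls))"
proof (cases b)
  case 0
  then show ?thesis by (simp add: tile_def)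
next
  case (Suc c)
  have "(\<Sum>m<c. q m * of_int (tile r m (Suc (Suc c)))) = 0"
    by (intro sum.neutral) (auto simp: tile_def)
  then show ?thesis unfolding Suc by (simp add: tile_def)
qed

text \<open>An entry of row 0 is a weighted sum over paths of steps 1 and 2 from \<open>0\<close> to
  \<open>b\<close>. A step of length 2 never jumps over a vertex, so every path stops at each
  multiple of \<open>r\<close> up to \<open>b\<close>; this splits the sum into
  \<open>b div r\<close> full sides and a rest of length \<open>b mod r\<close>.\<close>

lemma tiling_series_recursion:
  assumes r: "1 \<le> r"
  defines "q \<equiv> \<lambda>b. tiling_series r ^ (b div r) * tiling_series (b mod r)"
  shows "fls_X * (1 - fls_X) * q b =
      (if b = 0 then fls_X * (1 - fls_X) else 0) + (\<Sum>m<b. q m * of_int (tile r m b))"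
proof (cases b)
  case 0
  then show ?thesis
    using two_step_polynomial(1)[OF _ fls_linear_nonzero tiling_series_def] by (simp add: q_def)
next
  case (Suc c)
  note P = two_step_polynomial[OF _ fls_linear_nonzero tiling_series_def]
  define s l where "s = c div r" and "l = c mod r"
  \<comment> \<open>If \<open>Suc l = r\<close>, the quotient grows by one and the new rest
    contributes \<open>tiling_series 0 = 1\<close>, so the formula also holds on arrival at a
    vertex.\<close>
  have q1: "q (Suc c) = tiling_series r ^ s * tiling_series (Suc l)"
    using P(1) by (auto simp: q_def s_def l_def div_Suc mod_Suc)
  show ?thesis
  proof (cases l)
    case 0
    then have "r dvd c" by (auto simp: l_def)
    then show ?thesis unfolding Suc tile_sum q1
      using P(1,2) 0 by (simp add: q_def s_def l_def mult.assoc)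
  next
    case (Suc l')
    have "\<not> r dvd c" using Suc by (auto simp: l_def dvd_eq_mod_eq_0)
    then obtain c' where c': "c = Suc c'" by (cases c) auto
    have "c' mod r = l'" "c' div r = s"
      using Suc unfolding l_def s_def c' by (auto simp: mod_Suc div_Suc split: if_splits)
    then have "q c - q (c - 1) = tiling_series r ^ s * (tiling_series (l' + 1) - tiling_series l')"
      using Suc c' s_def l_def by (simp add: q_def right_diff_distrib)
    then show ?thesis unfolding \<open>b = Suc c\<close> tile_sum q1 P(3)[of l', OF fls_X_nonzero, symmetric]
      using Suc \<open>\<not> r dvd c\<close> c' by (simp add: mult_ac)
  qed
qed

text \<open>Expansion at 0 of the integrand in \<open>tr\<close>, used for all \<open>k\<close>,
  including those for which \<open>tr\<close> counts triangulations.\<close>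

definition counting_series :: "nat \<Rightarrow> nat \<Rightarrow> complex fls" where
  "counting_series k r = ((1 - fls_X) ^ (r + 1) - fls_X ^ (r + 1)) ^ k /
     (fls_X ^ (r * k) * (1 - fls_X) ^ (r * k) * (1 - 2 * fls_X) powi (int k - 2))"

lemma counting_series_eq:
  "counting_series k r = (1 - 2 * fls_X) ^ 2 * tiling_series r ^ k"
proof -
  define N D E where "N = (1 - fls_X) ^ (r + 1) - (fls_X :: complex fls) ^ (r + 1)"
    and "D = 1 - 2 * (fls_X :: complex fls)" and "E = (1 - fls_X :: complex fls)"
  have "D \<noteq> 0" "E \<noteq> 0" using fls_linear_nonzero by (auto simp only: D_def E_def)
  then have "N ^ k / (fls_X ^ (r * k) * E ^ (r * k) * D powi (int k - 2)) = D ^ 2 * (N / (D * (fls_X * E) ^ r)) ^ k"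
    by (simp add: power_int_diff power_divide power_mult_distrib power_mult) (simp add: mult_ac)
  then show ?thesis
    unfolding counting_series_def tiling_series_def N_def D_def E_def .
qed

lemma counting_series_residue:
  assumes "1 \<le> k" "1 \<le> r" "3 \<le> r * k"
  shows "fls_residue (counting_series k r / (1 - 2 * fls_X)) = 0"
    and "fls_residue (counting_series k r) =
      - 2 * (of_nat (chain_count r 1 (r * k)) - (if r = 1 then 0 else of_nat (chain_count r 2 (r * k))))"
proof -
  define q where "q = (\<lambda>b. tiling_series r ^ (b div r) * tiling_series (b mod r))"
  have q: "q (r * k) = tiling_series r ^ k"
    using assms two_step_polynomial(1)[OF _ fls_linear_nonzero tiling_series_def] by (simp add: q_def)
  have rec: "fls_X * (1 - fls_X) * q b =
      (if b = 0 then fls_X * (1 - fls_X) else 0) + (\<Sum>m<b. q m * of_int (tile r m b))" for b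
    unfolding q_def by (rule tiling_series_recursion[OF assms(2)])
  \<comment> \<open>Row 0 of \<open>W\<close> ends at column 2, and \<open>r * k\<close> is at least
    3.\<close>
  have [simp]: "tile r 0 (r * k) = 0" using assms by (auto simp: tile_def)
  show "fls_residue (counting_series k r / (1 - 2 * fls_X)) = 0"
    using residue_times_linear[OF assms(2) rec, of "r * k"] fls_linear_nonzero
    by (simp add: counting_series_eq q power2_eq_square)
  obtain n where n: "r * k = Suc (Suc (Suc n))"
    using assms(3) le_Suc_ex[of 3 "r * k"] by auto
  have "(\<Sum>m<n. of_int (tile r 0 (Suc (Suc (Suc m)))) * complex_of_nat (chain_count r (Suc (Suc (Suc m))) (r * k))) = 0"
    by (intro sum.neutral) (auto simp: tile_def)
  \<comment> \<open>Column 2 of row 0 holds -1 exactly when point 1 is not a vertex, that is, when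
    \<open>r \<noteq> 1\<close>.\<close>
  then have "(\<Sum>m<r * k. of_int (tile r 0 m) * complex_of_nat (chain_count r m (r * k))) =
      of_nat (chain_count r 1 (r * k)) - (if r = 1 then 0 else of_nat (chain_count r 2 (r * k)))"
    unfolding n by (simp add: sum.lessThan_Suc_shift tile_def numeral_2_eq_2 del: sum.lessThan_Suc)
  then show "fls_residue (counting_series k r) =
      - 2 * (of_nat (chain_count r 1 (r * k)) - (if r = 1 then 0 else of_nat (chain_count r 2 (r * k))))"
    using residue_times_linear_square[OF assms(2) rec, of "r * k"]
    by (simp add: counting_series_eq q)
qed

text \<open>The left side sums over the apexes of the triangle on the edge from point
  \<open>r * k\<close>, which is vertex 0, to point 1. The recursion for
  \<open>chain_count r 1 (r * k)\<close> also admits the apexes \<open>m \<le> r\<close> on the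
  first side; among these only \<open>m = 2\<close> contributes, the other pieces from 1 to
  \<open>m\<close> being collinear.\<close>

lemma chain_count_polygon:
  assumes "3 \<le> k" "1 \<le> r"
  shows "(\<Sum>m\<in>{r<..<r * k}. of_nat (chain_count r 1 m) * of_nat (chain_count r m (r * k))) =
    (of_nat (chain_count r 1 (r * k)) - (if r = 1 then 0 else of_nat (chain_count r 2 (r * k))) :: complex)"
proof -
  have k: "r * 3 \<le> r * k" using assms by simp
  have ns: "\<not> same_side r 1 (r * k)"
  proof -
    have "(1 div r + 1) * r \<le> 2 * r" by (intro mult_le_mono1) (auto simp: div_le_dividend)
    then show ?thesis using k assms(2) unfolding same_side_def by linarith
  qed
  have eq: "chain_count r 1 (r * k) = (\<Sum>m\<in>{1<..<r * k}. chain_count r 1 m * chain_count r m (r * k))"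
  proof -
    have "r * k \<noteq> Suc 1" "\<not> r * k \<le> 1" using k assms(2) by linarith+
    then show ?thesis using ns by (subst chain_count.simps) simp
  qed
  show ?thesis
  proof (cases "r = 1")
    case True
    then show ?thesis using eq by simp
  next
    case False
    have "r < r * k" "2 < r * k" using k assms(2) by linarith+
    moreover have "{1<..<n} = insert 2 {2<..r} \<union> {r<..<n}" if "r < n" "2 < n" for n
      using that False assms by auto
    ultimately have "{1<..<r * k} = insert 2 {2<..r} \<union> {r<..<r * k}" by blast
    moreover have "chain_count r 1 m * chain_count r m (r * k) = 0" if "m \<in> {2<..r}" for m
    proof -
      have "same_side r 1 m" using that False assms by (auto simp: same_side_def)
      then show ?thesis using that by (auto simp: chain_count_same_side)
    qed
    ultimately have "chain_count r 1 (r * k) = chain_count r 1 2 * chain_count r 2 (r * k)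
       + (\<Sum>m\<in>{r<..<r * k}. chain_count r 1 m * chain_count r m (r * k))"
      unfolding eq using False assms
      by (simp add: sum.union_disjoint) (subst sum.union_disjoint, auto)
    moreover have "chain_count r 1 2 = 1" using chain_count_Suc[of r 1] by (simp add: numeral_2_eq_2)
    ultimately show ?thesis using False by simp
  qed
qed


section \<open>The double sums as coefficients of power series\<close>

definition binomial_fps :: "complex \<Rightarrow> complex \<Rightarrow> complex fps" where
  "binomial_fps c a = fps_binomial c oo (fps_const a * fps_X)"

lemma binomial_fps_nth: "fps_nth (binomial_fps c a) n = a ^ n * (c gchoose n)"
  by (simp add: binomial_fps_def fps_compose_linear)

lemma binomial_fps_add: "binomial_fps (c + d) a = binomial_fps c a * binomial_fps d a"
  by (simp add: binomial_fps_def fps_binomial_add_mult fps_compose_mult_distrib)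

lemma binomial_fps_0 [simp]: "binomial_fps 0 a = 1"
  by (simp add: binomial_fps_def)

lemma binomial_fps_of_nat: "binomial_fps (of_nat n) a = (1 + fps_const a * fps_X) ^ n"
proof (induction n)
  case (Suc n)
  have "binomial_fps 1 a = 1 + fps_const a * fps_X"
    by (simp add: binomial_fps_def fps_binomial_1 fps_compose_add_distrib)
  then show ?case using Suc by (simp add: binomial_fps_add)
qed simp

lemma binomial_fps_power_int:
  "fps_to_fls (binomial_fps (of_int c) a) = (1 + fls_const a * fls_X) powi c"
proof -
  have nat: "fps_to_fls (binomial_fps (of_nat n) a) = (1 + fls_const a * fls_X) ^ n" for n
    by (simp add: binomial_fps_of_nat fps_to_fls_power fls_times_fps_to_fls)
  show ?thesis
  proof (cases c)
    case (nonneg n)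
    then show ?thesis by (simp add: nat)
  next
    case (neg n)
    define m where "m = Suc n"
    have "fps_to_fls (binomial_fps (- of_nat m) a) * fps_to_fls (binomial_fps (of_nat m) a) = 1"
      by (simp flip: fls_times_fps_to_fls binomial_fps_add)
    then have "fps_to_fls (binomial_fps (- of_nat m) a) = inverse ((1 + fls_const a * fls_X) ^ m)"
      unfolding nat by (simp add: field_simps inverse_eq_divide) (metis mult_zero_right zero_neq_one nonzero_eq_divide_eq)
    then show ?thesis using neg by (simp add: m_def power_int_minus del: power_Suc of_nat_Suc)
  qed
qed

text \<open>The integrand without its power of \<open>t\<close>, with a free exponent
  \<open>c\<close> for \<open>1 - 2t\<close> in the denominator: \<open>c = k - 2\<close> leads to
  the second double sum, \<open>c = k - 1\<close> to the first.\<close>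

definition numerator_fps :: "nat \<Rightarrow> nat \<Rightarrow> int \<Rightarrow> complex fps" where
  "numerator_fps k r c = ((1 - fps_X) ^ (r + 1) - fps_X ^ (r + 1)) ^ k *
     binomial_fps (- of_nat (r * k)) (-1) * binomial_fps (- of_int c) (-2)"

lemma fps_to_fls_numerator:
  "fps_to_fls (numerator_fps k r c) =
     ((1 - fls_X) ^ (r + 1) - fls_X ^ (r + 1)) ^ k / ((1 - fls_X) ^ (r * k) * (1 - 2 * fls_X) powi c)"
proof -
  have "fps_to_fls (binomial_fps (- of_nat (r * k)) (-1)) = 1 / (1 - fls_X) ^ (r * k)"
    using binomial_fps_power_int[of "- int (r * k)" "-1"]
    by (simp add: power_int_minus divide_inverse del: of_nat_mult)
  moreover have "fps_to_fls (binomial_fps (- of_int c) (-2)) = 1 / (1 - 2 * fls_X) powi c"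
    using binomial_fps_power_int[of "- c" "-2"]
    by (simp add: power_int_minus divide_inverse flip: fls_const_numeral)
  ultimately show ?thesis
    by (simp add: numerator_fps_def fls_times_fps_to_fls fps_to_fls_power del: of_nat_mult)
qed

lemma sum_int_atMost: "(\<Sum>j\<in>{0..int n}. f j) = (\<Sum>j\<le>n. f (int j))"
  by (rule sum.reindex_bij_witness[of _ int nat]) auto

text \<open>The index \<open>j\<close> comes from the binomial theorem for the numerator, and
  \<open>l\<close> is the degree taken from \<open>(1 - 2t)^(-c)\<close> in the Cauchy product; the
  remaining degree is taken from a power of \<open>1 - t\<close>.\<close>

lemma numerator_fps_nth:
  "fps_nth (numerator_fps k r c) M =
    (\<Sum>j\<in>{0..int k}. \<Sum>l\<in>{0..int M - (int r + 1) * j}.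
       (-1) powi j * 2 powi l * ibinom (int k) j * ibinom (c - 1 + l) l *
       ibinom (int M - int k - 1 - l) (int M - (int r + 1) * j - l))"
proof -
  define E where "E j = binomial_fps (of_nat k - of_nat ((r + 1) * j)) (-1) * binomial_fps (- of_int c) (-2)" for j
  have "((1 - fps_X) ^ (r + 1) - fps_X ^ (r + 1)) ^ k =
      (\<Sum>j\<le>k. of_nat (k choose j) * (- (fps_X ^ (r + 1))) ^ j * ((1 - fps_X) ^ (r + 1)) ^ (k - j) :: complex fps)"
    unfolding diff_conv_add_uminus[of "(1 - fps_X) ^ (r + 1)"] add.commute[of "(1 - fps_X) ^ (r + 1)"]
    by (rule binomial_ring)
  also have "\<dots> * binomial_fps (- of_nat (r * k)) (-1) =
     (\<Sum>j\<le>k. fps_const ((-1) ^ j * of_nat (k choose j)) * (fps_X ^ ((r + 1) * j) * binomial_fps (of_nat k - of_nat ((r + 1) * j)) (-1)))"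
    unfolding sum_distrib_right
  proof (intro sum.cong refl)
    fix j assume "j \<in> {..k}"
    then have j: "j \<le> k" by simp
    have "((1 - fps_X) ^ (r + 1)) ^ (k - j) * binomial_fps (- of_nat (r * k)) (-1) =
      binomial_fps (of_nat ((r + 1) * (k - j)) + (- of_nat (r * k))) (-1)"
      unfolding binomial_fps_add binomial_fps_of_nat power_mult by (simp flip: fps_const_neg del: power_Suc)
    \<comment> \<open>The exponents \<open>(r + 1) (k - j)\<close> and \<open>- r k\<close> of
      \<open>1 - t\<close> add up to \<open>k - (r + 1) j\<close>, which may be negative.\<close>
    also have "of_nat ((r + 1) * (k - j)) + (- of_nat (r * k)) = (of_nat k - of_nat ((r + 1) * j) :: complex)"
      using j by (simp only: of_nat_mult of_nat_diff[OF j]) (simp add: algebra_simps)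
    finally have 1: "((1 - fps_X) ^ (r + 1)) ^ (k - j) * binomial_fps (- of_nat (r * k)) (-1) =
      binomial_fps (of_nat k - of_nat ((r + 1) * j)) (-1)" .
    have 2: "(- (fps_X ^ (r + 1))) ^ j = (fps_const ((-1) ^ j) * fps_X ^ ((r + 1) * j) :: complex fps)"
      unfolding power_minus[of "fps_X ^ (r + 1)"] power_mult by (simp flip: fps_const_power fps_const_neg)
    show "of_nat (k choose j) * (- (fps_X ^ (r + 1))) ^ j * ((1 - fps_X) ^ (r + 1)) ^ (k - j) * binomial_fps (- of_nat (r * k)) (-1)
      = fps_const ((-1) ^ j * of_nat (k choose j)) * (fps_X ^ ((r + 1) * j) * binomial_fps (of_nat k - of_nat ((r + 1) * j)) (-1))"
      unfolding 1[symmetric] 2 fps_of_nat[symmetric] fps_const_mult[symmetric] by (simp only: mult_ac)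
  qed
  finally have "numerator_fps k r c = (\<Sum>j\<le>k. fps_const ((-1) ^ j * of_nat (k choose j)) * (fps_X ^ ((r + 1) * j) * E j))"
    unfolding numerator_fps_def E_def by (simp add: sum_distrib_right mult.assoc)
  then have "fps_nth (numerator_fps k r c) M =
      (\<Sum>j\<le>k. (-1) ^ j * of_nat (k choose j) * (if M < (r + 1) * j then 0 else fps_nth (E j) (M - (r + 1) * j)))"
    by (simp only: fps_sum_nth fps_mult_left_const_nth fps_X_power_mult_nth)
  also have "\<dots> = (\<Sum>j\<le>k. \<Sum>l\<in>{0..int M - (int r + 1) * int j}.
       (-1) powi int j * 2 powi l * ibinom (int k) (int j) * ibinom (c - 1 + l) l *
       ibinom (int M - int k - 1 - l) (int M - (int r + 1) * int j - l))"
  proof (intro sum.cong refl)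
    fix j
    show "(-1) ^ j * of_nat (k choose j) * (if M < (r + 1) * j then 0 else fps_nth (E j) (M - (r + 1) * j)) =
      (\<Sum>l\<in>{0..int M - (int r + 1) * int j}.
       (-1) powi int j * 2 powi l * ibinom (int k) (int j) * ibinom (c - 1 + l) l *
       ibinom (int M - int k - 1 - l) (int M - (int r + 1) * int j - l))"
    proof (cases "M < (r + 1) * j")
      case True
      \<comment> \<open>The inner sum runs over an empty interval here, matching the vanishing
        coefficient.\<close>
      then have "int M < (int r + 1) * int j" by (metis of_nat_1 of_nat_add of_nat_less_iff of_nat_mult)
      then show ?thesis using True by simp
    next
      case False
      define D where "D = M - (r + 1) * j"
      have D: "int M - (int r + 1) * int j = int D"
        using False by (simp add: D_def of_nat_diff algebra_simps)
      have 1: "fps_nth (E j) D = (\<Sum>l\<le>D. 2 ^ l * ((of_int c - 1 + of_nat l) gchoose l) *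
          ((of_nat M - of_nat k - 1 - of_nat l) gchoose (D - l)))"
        unfolding E_def mult.commute[of "binomial_fps (of_nat k - _) _"] fps_mult_nth atLeast0AtMost
      proof (intro sum.cong refl)
        fix l assume "l \<in> {..D}"
        then have l: "l \<le> D" by simp
        have "(-2) ^ l * (- of_int c gchoose l) = (2 ^ l * ((of_int c - 1 + of_nat l) gchoose l) :: complex)"
          unfolding gbinomial_minus[of "of_int c"] by (simp add: power_minus[of 2] algebra_simps)
        moreover have "of_nat D = (of_nat M - of_nat ((r + 1) * j) :: complex)"
          using False unfolding D_def by (simp add: of_nat_diff del: mult_Suc add_Suc_right)
        \<comment> \<open>Negating the upper index absorbs the sign, and
          \<open>D + (r + 1) j = M\<close> removes \<open>j\<close> from the upper argument.\<close>
        then have "(-1) ^ (D - l) * ((of_nat k - of_nat ((r + 1) * j)) gchoose (D - l)) =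
          ((of_nat M - of_nat k - 1 - of_nat l) gchoose (D - l) :: complex)"
          using l by (subst gbinomial_negated_upper) (simp add: of_nat_diff algebra_simps flip: power_add)
        ultimately show "fps_nth (binomial_fps (- of_int c) (-2)) l * fps_nth (binomial_fps (of_nat k - of_nat ((r + 1) * j)) (-1)) (D - l)
          = 2 ^ l * ((of_int c - 1 + of_nat l) gchoose l) *
          ((of_nat M - of_nat k - 1 - of_nat l) gchoose (D - l))"
          unfolding binomial_fps_nth by (simp only: mult.assoc)
      qed
      have 2: "(-1) powi int j * 2 powi int l * ibinom (int k) (int j) * ibinom (c - 1 + int l) (int l) *
         ibinom (int M - int k - 1 - int l) (int D - int l) = (-1) ^ j * of_nat (k choose j) *
           (2 ^ l * ((of_int c - 1 + of_nat l) gchoose l) * ((of_nat M - of_nat k - 1 - of_nat l) gchoose (D - l)))"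
        if "l \<le> D" for l
        using that by (simp add: ibinom_def binomial_gbinomial nat_diff_distrib mult_ac)
      have "(-1) ^ j * of_nat (k choose j) * (if M < (r + 1) * j then 0 else fps_nth (E j) (M - (r + 1) * j))
          = (-1) ^ j * of_nat (k choose j) * fps_nth (E j) D"
        using False by (simp only: D_def if_False)
      also have "\<dots> = (\<Sum>l\<le>D. (-1) powi int j * 2 powi int l * ibinom (int k) (int j) *
          ibinom (c - 1 + int l) (int l) * ibinom (int M - int k - 1 - int l) (int D - int l))"
        unfolding 1 sum_distrib_left by (intro sum.cong refl 2[symmetric]) simp
      finally show ?thesis unfolding D sum_int_atMost .
    qed
  qed
  finally show ?thesis by (simp add: sum_int_atMost)
qed

lemma fls_residue_numerator:
  assumes "1 \<le> n"
  shows "fls_residue (((1 - fls_X) ^ (r + 1) - fls_X ^ (r + 1)) ^ k / (fls_X ^ n * (1 - fls_X) ^ (r * k) * (1 - 2 * fls_X) powi c))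
    = fps_nth (numerator_fps k r c) (n - 1)"
proof -
  have "((1 - fls_X) ^ (r + 1) - fls_X ^ (r + 1)) ^ k / (fls_X ^ n * (1 - fls_X) ^ (r * k) * (1 - 2 * fls_X) powi c)
    = fls_X_inv ^ n * fps_to_fls (numerator_fps k r c)"
    by (simp add: fps_to_fls_numerator fls_inverse_X[symmetric] divide_inverse power_inverse mult_ac)
  also have "\<dots> = fls_shift (int n) (fps_to_fls (numerator_fps k r c))"
    by (simp add: fls_X_inv_power_times_conv_shift)
  finally show ?thesis using assms by (simp add: nat_diff_distrib)
qed

text \<open>With \<open>c = k - 2\<close> the coefficient formula applies directly; the factor
  \<open>-1/2\<close> is absorbed by the exponents \<open>j + 1\<close> and
  \<open>l - 1\<close>.\<close>

lemma second_sum_eq_residue: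
  assumes "1 \<le> k" "1 \<le> r" "3 \<le> r * k"
  shows "(\<Sum>j\<in>{0..int k}. \<Sum>l\<in>{0..int r * int k - (int r + 1) * j - 1}.
         (-1) powi (j + 1) * 2 powi (l - 1) * ibinom (int k) j * ibinom (int k - 3 + l) l *
         ibinom ((int r - 1) * int k - l - 2) (int r * int k - (int r + 1) * j - l - 1))
    = - (1 / 2) * fls_residue (counting_series k r)"
proof -
  define M where "M = r * k - 1"
  have M: "int M = int r * int k - 1" using assms by (simp add: M_def of_nat_diff)
  have res: "fls_residue (counting_series k r) = fps_nth (numerator_fps k r (int k - 2)) M"
    unfolding counting_series_def M_def using assms by (intro fls_residue_numerator) simp
  show ?thesis
    unfolding res numerator_fps_nth sum_distrib_left
    by (auto intro!: sum.cong simp: M power_int_add power_int_diff algebra_simps)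
qed

text \<open>This sum is the residue of \<open>t / (1 - 2t)\<close> times the series. Since
  \<open>t / (1 - 2t) = -1/2 + (1/2) / (1 - 2t)\<close>, and the series divided by
  \<open>1 - 2t\<close> has residue 0, only the factor \<open>-1/2\<close> remains.\<close>

lemma first_sum_eq_residue:
  assumes "1 \<le> k" "1 \<le> r" "3 \<le> r * k"
  shows "(\<Sum>j\<in>{0..int k}. \<Sum>l\<in>{0..int r * int k - (int r + 1) * j - 2}.
         (-1) powi j * 2 powi l * ibinom (int k) j * ibinom (int k - 2 + l) l *
         ibinom ((int r - 1) * int k - l - 3) (int r * int k - (int r + 1) * j - l - 2))
    = - (1 / 2) * fls_residue (counting_series k r)"
proof -
  define M where "M = r * k - 2"
  have M: "int M = int r * int k - 2" using assms by (simp add: M_def of_nat_diff)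
  define N where "N = (1 - fls_X :: complex fls) ^ (r + 1) - fls_X ^ (r + 1)"
  define D where "D = 1 - 2 * (fls_X :: complex fls)"
  have D: "D \<noteq> 0" using fls_linear_nonzero(2) unfolding D_def .
  have X: "fls_X ^ (r * k) = (fls_X ^ (r * k - 1) * fls_X :: complex fls)"
    using assms by (metis One_nat_def Suc_pred' mult_pos_pos not_less_eq_eq not_numeral_le_zero not_gr_zero power_Suc2)
  have "fls_residue (N ^ k / (fls_X ^ (r * k - 1) * (1 - fls_X) ^ (r * k) * D powi (int k - 1)))
     = fps_nth (numerator_fps k r (int k - 1)) (r * k - 1 - 1)"
    unfolding N_def D_def using assms by (intro fls_residue_numerator) simp
  also have "N ^ k / (fls_X ^ (r * k - 1) * (1 - fls_X) ^ (r * k) * D powi (int k - 1))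
     = fls_X * counting_series k r / D"
  proof -
    have "D powi (int k - 1) = D * D powi (int k - 2)"
      using D power_int_add[of D 1 "int k - 2"] by simp
    then show ?thesis
      unfolding counting_series_def N_def[symmetric] D_def[symmetric] X by simp
  qed
  also have "\<dots> = fls_const (- 1 / 2) * counting_series k r + fls_const (1 / 2) * (counting_series k r / D)"
  proof -
    have "fls_const (1 / 2) * (2 :: complex fls) = 1"
      by (simp flip: fls_const_numeral)
    then have "fls_X = fls_const (1 / 2) * (1 - D)"
      unfolding D_def by (simp add: mult.assoc[symmetric])
    then have "fls_X * counting_series k r / D = fls_const (1 / 2) * (1 - D) * counting_series k r / D"
      by simp
    also have "\<dots> = fls_const (1 / 2) * (counting_series k r / D) - fls_const (1 / 2) * counting_series k r"
      using D by (simp add: field_simps)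
    finally show ?thesis by simp
  qed
  also have "fls_residue \<dots> = - (1 / 2) * fls_residue (counting_series k r)"
    using counting_series_residue(1)[OF assms] unfolding D_def fls_residue_add fls_residue_fls_const_times by simp
  finally have "- (1 / 2) * fls_residue (counting_series k r) = fps_nth (numerator_fps k r (int k - 1)) M"
    by (simp add: M_def numeral_2_eq_2)
  then show ?thesis
    unfolding numerator_fps_nth
    by (auto intro!: sum.cong simp: M algebra_simps)
qed

section \<open>The contour integral for fewer than three vertices\<close>

lemma tr_eq_residue:
  assumes "k < 3"
  shows "tr k r S = - (1 / 2) * fls_residue (counting_series k r)"
proof -
  define f where "f = (\<lambda>t :: complex. ((1 - t) ^ (r + 1) - t ^ (r + 1)) ^ k /
              (t ^ (r * k) * (1 - t) ^ (r * k) * (1 - 2 * t) powi (int k - 2)))"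
  have "f has_laurent_expansion counting_series k r"
    unfolding f_def counting_series_def by (intro laurent_expansion_intros)
  then have res: "residue f 0 = fls_residue (counting_series k r)"
    by (rule has_laurent_expansion_residue_0)
  \<comment> \<open>The disc of radius 1/2 contains the contour and avoids the other possible
    singularities 1/2 and 1.\<close>
  have "f holomorphic_on (ball 0 (1/2) - {0})"
  proof -
    have nz: "1 - z \<noteq> 0" "1 - 2 * z \<noteq> 0" if "z \<in> ball 0 (1/2) - {0}" for z :: complex
    proof -
      have "norm z < 1 / 2" using that by simp
      moreover have "norm (1 :: complex) = 1" "norm (1 / 2 :: complex) = 1 / 2"
        by (simp_all add: norm_divide)
      ultimately have "z \<noteq> 1" "z \<noteq> 1 / 2" by fastforce+
      then show "1 - z \<noteq> 0" "1 - 2 * z \<noteq> 0" by (auto simp: field_simps)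
    qed
    show ?thesis
      unfolding f_def by (intro holomorphic_intros) (use nz in auto)
  qed
  then have "(f has_contour_integral 2 * pi * \<i> * residue f 0) (circlepath 0 (1/4))"
    by (rule base_residue[rotated 3]) auto
  then have "contour_integral (circlepath 0 (1/4)) f = 2 * pi * \<i> * fls_residue (counting_series k r)"
    unfolding res by (rule contour_integral_unique)
  then show ?thesis
    using assms unfolding tr_def f_def[symmetric] by simp
qed

section \<open>Orientation and triangles in the plane\<close>

lemma orient_def': "orient a b c = (Re b - Re a) * (Im c - Im a) - (Im b - Im a) * (Re c - Re a)"
  by (simp add: orient_def algebra_simps)

lemma orient_rotate: "orient b c a = orient a b c"
  and orient_swap: "orient b a c = - orient a b c"
  and orient_degenerate [simp]: "orient a a c = 0" "orient a b a = 0" "orient a b b = 0"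
  by (simp_all add: orient_def' algebra_simps)

text \<open>As a function of its last argument \<open>orient\<close> is affine with normal vector
  \<open>\<i> * (b - a)\<close>; this gives access to the library on half-spaces and
  hyperplanes.\<close>

lemma orient_inner: "orient a b x = (\<i> * (b - a)) \<bullet> x - (\<i> * (b - a)) \<bullet> a"
  by (simp add: orient_def' inner_complex_def algebra_simps)

lemma orient_affine:
  "orient a b ((1 - u) *\<^sub>R x + u *\<^sub>R y) = (1 - u) * orient a b x + u * orient a b y"
  by (simp add: orient_def' algebra_simps)

lemma orient_affine_3:
  "u + v + w = 1 \<Longrightarrow> orient a b (u *\<^sub>R x + v *\<^sub>R y + w *\<^sub>R z) =
    u * orient a b x + v * orient a b y + w * orient a b z"
  by (simp add: orient_inner inner_right_distrib algebra_simps) (simp flip: distrib_right)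

text \<open>If \<open>cnj w * z\<close> is real, multiplying it by \<open>w\<close> and dividing by
  the squared norm of \<open>w\<close> shows \<open>z\<close> to be a real multiple of
  \<open>w\<close>.\<close>

lemma orient_eq_0_line:
  assumes "a \<noteq> b" "orient a b x = 0"
  obtains u where "x = (1 - u) *\<^sub>R a + u *\<^sub>R b"
proof -
  define w z where "w = b - a" and "z = x - a"
  have w: "w \<noteq> 0" using assms by (simp add: w_def)
  define k where "k = Re (cnj w * z)"
  have "Im (cnj w * z) = 0" using assms by (simp add: orient_def w_def z_def)
  then have "cnj w * z = of_real k" unfolding complex_eq_iff k_def by simp
  then have "w * cnj w * z = of_real k * w" by (simp add: mult_ac)
  then have "of_real ((cmod w)\<^sup>2) * z = of_real k * w" by (simp only: complex_norm_square)
  then have "z = of_real (k / (cmod w)\<^sup>2) * w" using w by (simp add: field_simps)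
  then have "x = a + (k / (cmod w)\<^sup>2) *\<^sub>R (b - a)"
    by (simp add: scaleR_conv_of_real z_def w_def algebra_simps)
  then show thesis by (intro that[of "k / (cmod w)\<^sup>2"]) (simp add: algebra_simps)
qed

lemma collinear_iff_orient: "collinear {a, b, c} \<longleftrightarrow> orient a b c = 0"
proof
  assume "collinear {a, b, c}"
  then consider "a = c" | u where "b = u *\<^sub>R a + (1 - u) *\<^sub>R c"
    by (auto simp: collinear_3_expand)
  then show "orient a b c = 0"
  proof cases
    case 2
    show ?thesis unfolding 2 by (simp add: orient_def' algebra_simps)
  qed simp
next
  assume o: "orient a b c = 0"
  show "collinear {a, b, c}"
  proof (cases "c = a")
    case False
    have "orient c a b = 0" using o by (simp add: orient_def' algebra_simps)
    with False obtain u where "b = (1 - u) *\<^sub>R c + u *\<^sub>R a" by (rule orient_eq_0_line)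
    then show ?thesis by (auto simp: collinear_3_expand intro!: exI[of _ u])
  qed (simp add: insert_commute)
qed

lemma convex_orient_ge: "convex {x. orient a b x \<ge> 0}"
  and convex_orient_le: "convex {x. orient a b x \<le> 0}"
  using convex_halfspace_ge[of "(\<i> * (b - a)) \<bullet> a" "\<i> * (b - a)"]
    convex_halfspace_le[of "\<i> * (b - a)" "(\<i> * (b - a)) \<bullet> a"]
  by (simp_all add: orient_inner)

lemma continuous_on_orient [continuous_intros]: "continuous_on S (orient a b)"
  unfolding orient_inner by (intro continuous_intros)

lemma hull_orient_ge: "(\<And>x. x \<in> S \<Longrightarrow> orient a b x \<ge> 0) \<Longrightarrow> x \<in> convex hull S \<Longrightarrow> orient a b x \<ge> 0"
  using hull_minimal[of S "{x. orient a b x \<ge> 0}" convex] convex_orient_ge by auto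

lemma hull_orient_le: "(\<And>x. x \<in> S \<Longrightarrow> orient a b x \<le> 0) \<Longrightarrow> x \<in> convex hull S \<Longrightarrow> orient a b x \<le> 0"
  using hull_minimal[of S "{x. orient a b x \<le> 0}" convex] convex_orient_le by auto

lemma interior_orient_0: "a \<noteq> b \<Longrightarrow> interior {x. orient a b x = 0} = {}"
  using interior_hyperplane[of "\<i> * (b - a)" "(\<i> * (b - a)) \<bullet> a"] by (simp add: orient_inner)

text \<open>A common point of both sets lies on the separating line, which has empty
  interior.\<close>

lemma disjoint_interior_orient:
  assumes "a \<noteq> b" "\<And>x. x \<in> s \<Longrightarrow> orient a b x \<le> 0" "\<And>x. x \<in> t \<Longrightarrow> orient a b x \<ge> 0"
  shows "interior s \<inter> interior t = {}"
proof -
  have "s \<inter> t \<subseteq> {x. orient a b x = 0}" using assms(2,3) by force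
  then have "interior (s \<inter> t) \<subseteq> {}" using interior_mono interior_orient_0[OF assms(1)] by metis
  then show ?thesis by simp
qed

text \<open>For the harder inclusion, the barycentric coordinates of \<open>x\<close> are the areas
  of the triangles spanned by \<open>x\<close> and one side, divided by the area of the whole
  triangle.\<close>

lemma triangle_hull:
  assumes "orient a b c > 0"
  shows "convex hull {a, b, c} = {x. orient a b x \<ge> 0 \<and> orient b c x \<ge> 0 \<and> orient c a x \<ge> 0}"
proof (intro equalityI subsetI)
  fix x assume x: "x \<in> convex hull {a, b, c}"
  have "orient b c a > 0" "orient c a b > 0" using assms orient_rotate by metis+
  then show "x \<in> {x. orient a b x \<ge> 0 \<and> orient b c x \<ge> 0 \<and> orient c a x \<ge> 0}"
    using assms by (auto intro: hull_orient_ge[OF _ x])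
next
  fix x assume "x \<in> {x. orient a b x \<ge> 0 \<and> orient b c x \<ge> 0 \<and> orient c a x \<ge> 0}"
  then have x: "orient a b x \<ge> 0" "orient b c x \<ge> 0" "orient c a x \<ge> 0" by auto
  define d where "d = orient a b c"
  have s: "orient b c x + orient c a x + orient a b x = d"
    by (simp add: d_def orient_def' algebra_simps)
  have e: "orient b c x *\<^sub>R a + orient c a x *\<^sub>R b + orient a b x *\<^sub>R c = d *\<^sub>R x"
    by (simp add: d_def complex_eq_iff orient_def') algebra
  have d: "d > 0" using assms by (simp add: d_def)
  have "x = (orient b c x / d) *\<^sub>R a + (orient c a x / d) *\<^sub>R b + (orient a b x / d) *\<^sub>R c"
  proof -
    have "x = (1 / d) *\<^sub>R (d *\<^sub>R x)" using d by simp
    then show ?thesis unfolding e[symmetric] by (simp add: scaleR_add_right)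
  qed
  moreover have "orient b c x / d + orient c a x / d + orient a b x / d = 1"
    using s d by (simp flip: add_divide_distrib)
  ultimately show "x \<in> convex hull {a, b, c}"
    unfolding convex_hull_3 using x d by (smt (verit, best) mem_Collect_eq divide_nonneg_pos)
qed

lemma in_interior_triangle:
  assumes "orient a b x > 0" "orient b c x > 0" "orient c a x > 0"
  shows "x \<in> interior (convex hull {a, b, c})"
proof -
  have "orient b c x + orient c a x + orient a b x = orient a b c"
    by (simp add: orient_def' algebra_simps)
  then have "orient a b c > 0" using assms by linarith
  moreover have "open {x. orient a b x > 0 \<and> orient b c x > 0 \<and> orient c a x > 0}"
    by (intro open_Collect_conj open_Collect_less continuous_intros)
  ultimately show ?thesis
    using assms by (intro interiorI[of "{x. orient a b x > 0 \<and> orient b c x > 0 \<and> orient c a x > 0}"])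
      (auto simp: triangle_hull)
qed

lemma interior_triangle_nonempty:
  assumes "orient a b c > 0"
  shows "interior (convex hull {a, b, c}) \<noteq> {}"
proof -
  define x where "x = (1/3) *\<^sub>R a + (1/3) *\<^sub>R b + (1/3) *\<^sub>R c"
  have "orient b c a > 0" "orient c a b > 0" using assms orient_rotate by metis+
  then have "orient a b x > 0" "orient b c x > 0" "orient c a x > 0"
    using assms by (simp_all add: x_def orient_affine_3)
  then show ?thesis using in_interior_triangle by blast
qed

text \<open>A nondegenerate triangle is the closure of its interior. This turns a mere contact of a
  triangle with an open set into an overlap of interiors.\<close>

lemma meets_interior_triangle:
  assumes "orient a b c > 0" "x \<in> convex hull {a, b, c}" "open U" "x \<in> U"
  shows "U \<inter> interior (convex hull {a, b, c}) \<noteq> {}"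
proof -
  have "closure (interior (convex hull {a, b, c})) = closure (convex hull {a, b, c})"
    using interior_triangle_nonempty[OF assms(1)] by (intro convex_closure_interior convex_convex_hull)
  then have "x \<in> closure (interior (convex hull {a, b, c}))" using assms(2) closure_subset by blast
  then show ?thesis using assms(3,4) by (metis closure_iff_nhds_not_empty disjoint_iff Int_commute inf.idem order_refl open_Int_closure_eq_empty)
qed

text \<open>The values of \<open>orient\<close> against the other two sides reveal the position
  \<open>u\<close> on the line: one sign bounds it below by 0, the other above by 1.\<close>

lemma on_triangle_side:
  assumes "orient a m b > 0" "orient a m x = 0"
  obtains u where "x = (1 - u) *\<^sub>R a + u *\<^sub>R m" "orient b a x = u * orient a m b"
    "orient m b x = (1 - u) * orient a m b"
proof -
  have "a \<noteq> m" using assms(1) by auto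
  then obtain u where u: "x = (1 - u) *\<^sub>R a + u *\<^sub>R m" using assms(2) by (rule orient_eq_0_line)
  have "orient b a m = orient a m b" "orient m b a = orient a m b"
    by (simp_all add: orient_def' algebra_simps)
  then have "orient b a x = u * orient a m b" "orient m b x = (1 - u) * orient a m b"
    unfolding u by (simp_all add: orient_affine)
  then show thesis using u that by blast
qed

lemma on_triangle_closed_side:
  assumes "orient a m b > 0" "orient a m x = 0" "orient b a x \<ge> 0" "orient m b x \<ge> 0"
  shows "x \<in> closed_segment a m"
proof -
  obtain u where u: "x = (1 - u) *\<^sub>R a + u *\<^sub>R m" "orient b a x = u * orient a m b"
    "orient m b x = (1 - u) * orient a m b"
    using assms(1,2) by (rule on_triangle_side)
  have "0 \<le> u" "u \<le> 1" using assms u by (simp_all add: zero_le_mult_iff)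
  then show ?thesis unfolding u(1) closed_segment_def by blast
qed

lemma small_perturbation:
  fixes c d :: real
  assumes "c > 0"
  shows "eventually (\<lambda>e. (1 - e) * c + e * d > 0) (at_right 0)"
proof -
  have "((\<lambda>e. (1 - e) * c + e * d) \<longlongrightarrow> (1 - 0) * c + 0 * d) (at_right 0)"
    by (intro tendsto_intros)
  then show ?thesis using assms by (intro order_tendstoD(1)) auto
qed

lemma small_perturbation_2:
  fixes c d c' d' :: real
  assumes "c > 0" "c' > 0"
  obtains e where "0 < e" "e < 1" "(1 - e) * c + e * d > 0" "(1 - e) * c' + e * d' > 0"
proof -
  have "eventually (\<lambda>e. (0 < e \<and> e < 1) \<and> (1 - e) * c + e * d > 0 \<and> (1 - e) * c' + e * d' > 0) (at_right 0)"
    using eventually_at_right_less[of "0 :: real"] eventually_at_right_real[of 0 "1 :: real"]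
    by (intro eventually_conj small_perturbation assms) (auto elim: eventually_mono)
  then have "\<exists>e. (0 < e \<and> e < 1) \<and> (1 - e) * c + e * d > 0 \<and> (1 - e) * c' + e * d' > 0"
    by (rule eventually_happens'[OF trivial_limit_at_right_real])
  then show thesis using that by blast
qed

text \<open>
  In a weakly convex polygon \<open>a, \<dots>, x, \<dots>, m, \<dots>, y, \<dots>, b\<close>, a segment \<open>x y\<close> leaving the part cut off by
  \<open>a m\<close> would enter the triangle \<open>a m b\<close>.
\<close>

lemma crossing_point:
  assumes amb: "orient a m b > 0" and axm: "orient a x m > 0"
    and h: "orient a x b \<ge> 0" "orient a y b \<ge> 0" and "orient a m y \<ge> 0" "orient m y b \<ge> 0"
    and xmy: "orient x m y \<ge> 0" and "y \<noteq> m"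
    and a: "a \<notin> open_segment x y" and m: "m \<notin> open_segment x y"
  shows "\<exists>z\<in>closed_segment x y. z \<in> interior (convex hull {a, m, b})"
proof -
  define gx gy where "gx = orient a x m" and "gy = orient a m y"
  have gx: "gx > 0" "orient a m x = - gx" using axm by (auto simp: gx_def orient_def' algebra_simps)
  have *: "orient x m z = (1 - u) * gx" if "z = (1 - u) *\<^sub>R a + u *\<^sub>R m" for z u
    unfolding that orient_affine by (simp add: gx_def orient_def' algebra_simps)
  \<comment> \<open>Were \<open>y\<close> on the line \<open>a m\<close>, the condition on
    \<open>m\<close>, \<open>y\<close>, \<open>b\<close> would place it at or beyond
    \<open>m\<close>, and the one on \<open>x\<close>, \<open>m\<close>, \<open>y\<close> at or
    before \<open>m\<close>.\<close>
  have gy: "gy > 0"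
  proof (rule ccontr)
    assume "\<not> gy > 0"
    then have "orient a m y = 0" using assms by (simp add: gy_def)
    then obtain u where u: "y = (1 - u) *\<^sub>R a + u *\<^sub>R m" "orient m b y = (1 - u) * orient a m b"
      using on_triangle_side amb by metis
    have "orient m b y = - orient m y b" by (simp add: orient_def' algebra_simps)
    then have "(1 - u) * orient a m b \<le> 0" using assms u(2) by simp
    then have "u \<ge> 1" using amb by (simp add: mult_le_0_iff)
    moreover have "(1 - u) * gx \<ge> 0" using xmy *[OF u(1)] by simp
    then have "u \<le> 1" using gx by (simp add: zero_le_mult_iff)
    ultimately show False using u(1) \<open>y \<noteq> m\<close> by simp
  qed
  \<comment> \<open>The weight at which the values \<open>-gx\<close> and \<open>gy\<close> at the
    ends average to 0, so that \<open>z\<close> is the crossing with the line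
    \<open>a m\<close>.\<close>
  define v where "v = gx / (gx + gy)"
  have v: "0 < v" "v < 1" "1 - v = gy / (gx + gy)" using gx gy by (auto simp: v_def field_simps)
  define z where "z = (1 - v) *\<^sub>R x + v *\<^sub>R y"
  have "x \<noteq> y" using gx gy by (auto simp: gy_def)
  then have z_open: "z \<in> open_segment x y" using v unfolding in_segment z_def by blast
  have "orient a m z = (1 - v) * (- gx) + v * gy"
    unfolding z_def orient_affine gx(2) gy_def ..
  then have "orient a m z = 0" unfolding v(3) by (simp add: v_def)
  then obtain u where u: "z = (1 - u) *\<^sub>R a + u *\<^sub>R m" "orient b a z = u * orient a m b"
    "orient m b z = (1 - u) * orient a m b"
    using on_triangle_side amb by metis
  have "orient b a x = orient a x b" "orient b a y = orient a y b"
    by (simp_all add: orient_def' algebra_simps)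
  then have "orient b a z \<ge> 0"
    using v(1,2) h unfolding z_def orient_affine by simp
  then have "u \<ge> 0" using u(2) amb by (simp add: zero_le_mult_iff)
  moreover have "u \<noteq> 0" using u(1) z_open a by auto
  moreover have "v * orient x m y = (1 - u) * gx"
    using *[OF u(1)] unfolding z_def orient_affine by simp
  then have "(1 - u) * gx \<ge> 0" using mult_nonneg_nonneg[of v "orient x m y"] xmy v(1) by linarith
  then have "u \<le> 1" using gx by (simp add: zero_le_mult_iff)
  moreover have "u \<noteq> 1" using u(1) z_open m by auto
  ultimately have pos: "orient b a z > 0" "orient m b z > 0" using u amb by simp_all
  \<comment> \<open>The point \<open>z\<close> is in the relative interior of the side
    \<open>a m\<close>; a small move towards \<open>y\<close>, which is strictly to its left, enters
    the interior.\<close>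
  obtain e where e: "0 < e" "e < 1" "(1 - e) * orient b a z + e * orient b a y > 0"
    "(1 - e) * orient m b z + e * orient m b y > 0"
    using pos by (rule small_perturbation_2)
  define w where "w = (1 - e) *\<^sub>R z + e *\<^sub>R y"
  have "orient a m w > 0"
    using \<open>orient a m z = 0\<close> e gy unfolding w_def orient_affine by (simp add: gy_def)
  moreover have "orient m b w > 0" "orient b a w > 0" unfolding w_def orient_affine by (fact e)+
  ultimately have "w \<in> interior (convex hull {a, m, b})" by (intro in_interior_triangle)
  moreover have "w \<in> closed_segment x y"
    using e z_open unfolding w_def
    by (intro convexD_alt[OF convex_closed_segment]) (auto simp: open_segment_def)
  ultimately show ?thesis by blast
qed

lemma orient_cnj: "orient (cnj a) (cnj b) (cnj c) = - orient a b c"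
  by (simp add: orient_def' algebra_simps)

lemma in_segment_cnj:
  "cnj z \<in> closed_segment (cnj x) (cnj y) \<longleftrightarrow> z \<in> closed_segment x y"
  "cnj z \<in> open_segment (cnj x) (cnj y) \<longleftrightarrow> z \<in> open_segment x y"
proof -
  have "cnj z = (1 - u) *\<^sub>R cnj x + u *\<^sub>R cnj y \<longleftrightarrow> z = (1 - u) *\<^sub>R x + u *\<^sub>R y" for u
    by (auto simp: complex_eq_iff)
  then show "cnj z \<in> closed_segment (cnj x) (cnj y) \<longleftrightarrow> z \<in> closed_segment x y"
    "cnj z \<in> open_segment (cnj x) (cnj y) \<longleftrightarrow> z \<in> open_segment x y"
    by (simp_all add: in_segment)
qed

text \<open>Complex conjugation reverses orientation, so the mirror image with \<open>a\<close>,
  \<open>b\<close> and \<open>x\<close>, \<open>y\<close> exchanged satisfies the hypotheses of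
  \<open>crossing_point\<close>.\<close>

lemma crossing_point':
  assumes "orient a m b > 0" "orient m y b > 0"
    and "orient a x b \<ge> 0" "orient a y b \<ge> 0" "orient x m b \<ge> 0" "orient a x m \<ge> 0"
    and "orient x m y \<ge> 0" "x \<noteq> m"
    and "b \<notin> open_segment x y" "m \<notin> open_segment x y"
  shows "\<exists>z\<in>closed_segment x y. z \<in> interior (convex hull {a, m, b})"
proof -
  have s: "orient (cnj u) (cnj v) (cnj w) = orient w v u" for u v w
    unfolding orient_cnj by (simp add: orient_def' algebra_simps)
  have "\<exists>z\<in>closed_segment (cnj y) (cnj x). z \<in> interior (convex hull {cnj b, cnj m, cnj a})"
    using assms by (intro crossing_point) (auto simp: s in_segment_cnj open_segment_commute[of _ "cnj x"])
  then obtain z where z: "z \<in> closed_segment (cnj y) (cnj x)" "z \<in> interior (convex hull {cnj b, cnj m, cnj a})"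
    by blast
  have "linear cnj" by (simp add: bounded_linear.linear bounded_linear_cnj)
  have "inj cnj" by (simp add: inj_def)
  have "convex hull {cnj b, cnj m, cnj a} = cnj ` (convex hull {a, m, b})"
    using convex_hull_linear_image[OF \<open>linear cnj\<close>, of "{a, m, b}"] by (simp add: insert_commute)
  then have "interior (convex hull {cnj b, cnj m, cnj a}) = cnj ` interior (convex hull {a, m, b})"
    using interior_injective_linear_image[OF \<open>linear cnj\<close> \<open>inj cnj\<close>] by simp
  then obtain w where "z = cnj w" "w \<in> interior (convex hull {a, m, b})" using z(2) by auto
  then show ?thesis using z(1) by (auto simp: in_segment_cnj closed_segment_commute)
qed

section \<open>Triangulations\<close>

text \<open>Unlike in \<open>triangulations\<close>, the corners are taken counterclockwise, and
  emptiness is asked for all pairs, so that it depends only on the set of corners; equal corners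
  have an empty open segment.\<close>

definition empty_triangle :: "complex set \<Rightarrow> complex set \<Rightarrow> bool" where
  "empty_triangle S t \<longleftrightarrow> (\<exists>a\<in>S. \<exists>b\<in>S. \<exists>c\<in>S. orient a b c > 0 \<and> t = convex hull {a, b, c} \<and>
     (\<forall>x\<in>{a, b, c}. \<forall>y\<in>{a, b, c}. S \<inter> open_segment x y = {}))"

lemma empty_triangleI:
  assumes "a \<in> S" "b \<in> S" "c \<in> S" "orient a b c > 0" "t = convex hull {a, b, c}"
    "\<And>x y. x \<in> {a, b, c} \<Longrightarrow> y \<in> {a, b, c} \<Longrightarrow> S \<inter> open_segment x y = {}"
  shows "empty_triangle S t"
  unfolding empty_triangle_def
  by (rule bexI[OF _ assms(1)], rule bexI[OF _ assms(2)], rule bexI[OF _ assms(3)]) (intro conjI ballI assms)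

lemma empty_triangleE:
  assumes "empty_triangle S t"
  obtains a b c where "a \<in> S" "b \<in> S" "c \<in> S" "orient a b c > 0" "t = convex hull {a, b, c}"
    "\<forall>x\<in>{a, b, c}. \<forall>y\<in>{a, b, c}. S \<inter> open_segment x y = {}"
proof -
  obtain a b c where *: "a \<in> S" "b \<in> S" "c \<in> S" "orient a b c > 0" "t = convex hull {a, b, c}"
    "\<forall>x\<in>{a, b, c}. \<forall>y\<in>{a, b, c}. S \<inter> open_segment x y = {}"
    using assms unfolding empty_triangle_def by (elim bexE conjE)
  then show thesis by (rule that)
qed

lemma empty_triangle_iff:
  "empty_triangle S t \<longleftrightarrow> (\<exists>a\<in>S. \<exists>b\<in>S. \<exists>c\<in>S. \<not> collinear {a, b, c} \<and> t = convex hull {a, b, c} \<and>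
        S \<inter> (open_segment a b \<union> open_segment b c \<union> open_segment c a) = {})" (is "_ \<longleftrightarrow> ?R")
proof
  assume "empty_triangle S t"
  then obtain a b c where *: "a \<in> S" "b \<in> S" "c \<in> S" "orient a b c > 0" "t = convex hull {a, b, c}"
    "\<forall>x\<in>{a, b, c}. \<forall>y\<in>{a, b, c}. S \<inter> open_segment x y = {}"
    by (rule empty_triangleE)
  have "S \<inter> (open_segment a b \<union> open_segment b c \<union> open_segment c a) = {}"
    using *(6) by (simp add: Int_Un_distrib)
  moreover have "\<not> collinear {a, b, c}" using *(4) by (simp add: collinear_iff_orient)
  ultimately show ?R
    using *(5) by (intro bexI[OF _ *(1)] bexI[OF _ *(2)] bexI[OF _ *(3)] conjI)
next
  assume ?R
  then obtain a b c where *: "a \<in> S" "b \<in> S" "c \<in> S" "\<not> collinear {a, b, c}" "t = convex hull {a, b, c}"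
     "S \<inter> (open_segment a b \<union> open_segment b c \<union> open_segment c a) = {}"
    by (elim bexE conjE)
  have e: "S \<inter> open_segment x y = {}" if xy: "x \<in> {a, b, c}" "y \<in> {a, b, c}" for x y
  proof -
    have 1: "S \<inter> open_segment a b = {}" "S \<inter> open_segment b c = {}" "S \<inter> open_segment c a = {}"
      using *(6) by blast+
    then have 2: "S \<inter> open_segment b a = {}" "S \<inter> open_segment c b = {}" "S \<inter> open_segment a c = {}"
      by (metis open_segment_commute)+
    show ?thesis using 1 2 xy by auto
  qed
  show "empty_triangle S t"
  proof (cases "orient a b c > 0")
    case True
    then show ?thesis using * e by (intro empty_triangleI[of a _ b c])
  next
    case False
    then have "orient b a c > 0"
      using *(4) orient_swap[where a = a and b = b and c = c] unfolding collinear_iff_orient by linarith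
    moreover have "t = convex hull {b, a, c}" using *(5) by (simp add: insert_commute)
    moreover have "S \<inter> open_segment x y = {}" if "x \<in> {b, a, c}" "y \<in> {b, a, c}" for x y
      using e that by (simp add: insert_commute)
    ultimately show ?thesis using *(1-3) by (intro empty_triangleI[of b _ a c])
  qed
qed

lemma triangulations_iff:
  "T \<in> triangulations S \<longleftrightarrow> (\<forall>t\<in>T. empty_triangle S t) \<and>
     pairwise (\<lambda>t u. interior t \<inter> interior u = {}) T \<and> \<Union>T = convex hull S"
  unfolding triangulations_def empty_triangle_iff by simp

lemma empty_triangle_props:
  assumes "empty_triangle S t"
  shows "t \<subseteq> convex hull S" "interior t \<noteq> {}" "closed t"
    "open U \<Longrightarrow> x \<in> U \<Longrightarrow> x \<in> t \<Longrightarrow> U \<inter> interior t \<noteq> {}"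
proof -
  obtain a b c where *: "a \<in> S" "b \<in> S" "c \<in> S" "orient a b c > 0" and t: "t = convex hull {a, b, c}"
    using assms by (rule empty_triangleE)
  show "t \<subseteq> convex hull S" unfolding t using * by (intro hull_mono) simp
  show "interior t \<noteq> {}" unfolding t using *(4) by (rule interior_triangle_nonempty)
  show "closed t" unfolding t by (intro compact_imp_closed finite_imp_compact_convex_hull) simp
  show "open U \<Longrightarrow> x \<in> U \<Longrightarrow> x \<in> t \<Longrightarrow> U \<inter> interior t \<noteq> {}"
    unfolding t using *(4) by (rule meets_interior_triangle)
qed

lemma finite_empty_triangles:
  assumes "finite S"
  shows "finite {t. empty_triangle S t}"
proof (rule finite_subset)
  show "{t. empty_triangle S t} \<subseteq> (\<lambda>(a, b, c). convex hull {a, b, c}) ` (S \<times> S \<times> S)"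
  proof
    fix t assume "t \<in> {t. empty_triangle S t}"
    then have "empty_triangle S t" by simp
    then obtain a b c where "a \<in> S" "b \<in> S" "c \<in> S" "t = convex hull {a, b, c}"
      by (rule empty_triangleE)
    then show "t \<in> (\<lambda>(a, b, c). convex hull {a, b, c}) ` (S \<times> S \<times> S)"
      by (intro image_eqI[of _ _ "(a, b, c)"]) simp_all
  qed
qed (use assms in simp)

lemma triangulations_subset: "triangulations S \<subseteq> Pow {t. empty_triangle S t}"
  by (auto simp: triangulations_iff)

lemma finite_triangulations: "finite S \<Longrightarrow> finite (triangulations S)"
  by (rule finite_subset[OF triangulations_subset]) (simp add: finite_empty_triangles)

lemma finite_triangulation: "finite S \<Longrightarrow> T \<in> triangulations S \<Longrightarrow> finite T"
  using triangulations_subset finite_empty_triangles by (metis PowD finite_subset subsetD)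

text \<open>The corners are the extreme points of the triangle. Hence a property of the corners may
  be read off from the hull alone.\<close>

lemma triangle_vertices_unique:
  assumes "orient a b c > 0" "orient a' b' c' > 0" "convex hull {a, b, c} = convex hull {a', b', c'}"
  shows "{a, b, c} = {a', b', c'}"
proof -
  have *: "{x. x extreme_point_of (convex hull {a, b, c})} = {a, b, c}" if "orient a b c > 0" for a b c
  proof -
    have "\<not> affine_dependent {a, b, c}"
      using that by (metis collinear_3_eq_affine_dependent collinear_iff_orient less_irrefl)
    then show ?thesis
      using extreme_point_of_convex_hull_affine_independent[OF \<open>\<not> affine_dependent {a, b, c}\<close>]
      by (intro set_eqI) (simp only: mem_Collect_eq)
  qed
  show ?thesis by (rule trans[OF *[OF assms(1), unfolded assms(3), symmetric] *[OF assms(2)]])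
qed

lemma empty_triangleD:
  assumes "empty_triangle S (convex hull {a, b, c})" "orient a b c > 0"
    "x \<in> {a, b, c}" "y \<in> {a, b, c}"
  shows "S \<inter> open_segment x y = {}"
proof -
  obtain a' b' c' where *: "orient a' b' c' > 0" "convex hull {a, b, c} = convex hull {a', b', c'}"
    "\<forall>x\<in>{a', b', c'}. \<forall>y\<in>{a', b', c'}. S \<inter> open_segment x y = {}"
    using assms(1) by (rule empty_triangleE)
  have "{a, b, c} = {a', b', c'}" using assms(2) *(1,2) by (rule triangle_vertices_unique)
  then have "x \<in> {a', b', c'}" "y \<in> {a', b', c'}" using assms(3,4) by simp_all
  then show ?thesis by (rule bspec[OF bspec[OF *(3)]])
qed

lemma empty_triangle_superset:
  assumes "empty_triangle S' t" "S' \<subseteq> S"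
    "\<And>x y z. x \<in> S' \<Longrightarrow> y \<in> S' \<Longrightarrow> z \<in> S - S' \<Longrightarrow> z \<notin> open_segment x y"
  shows "empty_triangle S t"
proof -
  obtain a b c where *: "a \<in> S'" "b \<in> S'" "c \<in> S'" "orient a b c > 0" "t = convex hull {a, b, c}"
    "\<forall>x\<in>{a, b, c}. \<forall>y\<in>{a, b, c}. S' \<inter> open_segment x y = {}"
    using assms(1) by (rule empty_triangleE)
  have "S \<inter> open_segment x y = {}" if xy: "x \<in> {a, b, c}" "y \<in> {a, b, c}" for x y
  proof -
    have "x \<in> S'" "y \<in> S'" using xy *(1-3) by auto
    then show ?thesis using assms(3)[of x y] bspec[OF bspec[OF *(6) xy(1)] xy(2)] by blast
  qed
  moreover have "a \<in> S" "b \<in> S" "c \<in> S" using *(1-3) assms(2) by auto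
  ultimately show ?thesis using *(4,5) by (intro empty_triangleI[of a _ b c])
qed

lemma no_empty_triangle_on_line:
  assumes "empty_triangle S t" "c \<noteq> d" "\<And>x. x \<in> S \<Longrightarrow> orient c d x = 0"
  shows False
proof -
  have "orient c d x = 0" if "x \<in> t" for x
  proof (rule antisym)
    have "x \<in> convex hull S" using that empty_triangle_props(1)[OF assms(1)] by blast
    then show "orient c d x \<le> 0" "0 \<le> orient c d x"
      using hull_orient_ge[of S c d x] hull_orient_le[of S c d x] assms(3) by auto
  qed
  then have "interior t \<subseteq> interior {x. orient c d x = 0}" by (intro interior_mono) auto
  then show False
    using interior_orient_0[OF assms(2)] empty_triangle_props(2)[OF assms(1)] by simp
qed

text \<open>In barycentric coordinates the value at \<open>x\<close> is a sum of nonnegative terms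
  equal to 0, so corners of positive weight lie on the line. Not all three do, as the triangle is
  not flat, and \<open>x\<close> is no corner; exactly two weights are positive.\<close>

lemma triangle_edge_through:
  assumes o: "orient a b c > 0" and x: "x \<in> convex hull {a, b, c}"
    and h: "orient p q a \<ge> 0" "orient p q b \<ge> 0" "orient p q c \<ge> 0" "orient p q x = 0"
    and nx: "x \<notin> {a, b, c}" and "p \<noteq> q"
  obtains y z w where "{a, b, c} = {y, z, w}" "x \<in> open_segment y z" "orient p q y = 0" "orient p q z = 0"
proof -
  note main = that
  obtain u v w where *: "u \<ge> 0" "v \<ge> 0" "w \<ge> 0" "u + v + w = 1" "x = u *\<^sub>R a + v *\<^sub>R b + w *\<^sub>R c"
    using x unfolding convex_hull_3 by blast
  have "u * orient p q a + v * orient p q b + w * orient p q c = 0"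
    using h(4) orient_affine_3[OF *(4)] unfolding *(5) by simp
  moreover have "u * orient p q a \<ge> 0" "v * orient p q b \<ge> 0" "w * orient p q c \<ge> 0"
    using * h by simp_all
  ultimately have z: "u * orient p q a = 0" "v * orient p q b = 0" "w * orient p q c = 0" by linarith+
  have "u = 0 \<or> v = 0 \<or> w = 0"
  proof (rule ccontr)
    assume "\<not> ?thesis"
    then have "orient p q a = 0" "orient p q b = 0" "orient p q c = 0" using z by simp_all
    then obtain k1 k2 k3 where k: "a = (1 - k1) *\<^sub>R p + k1 *\<^sub>R q" "b = (1 - k2) *\<^sub>R p + k2 *\<^sub>R q" "c = (1 - k3) *\<^sub>R p + k3 *\<^sub>R q"
      using orient_eq_0_line[OF \<open>p \<noteq> q\<close>] by metis
    have "orient a b c = 0" unfolding k by (simp add: orient_def' algebra_simps)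
    then show False using o by simp
  qed
  moreover have seg: thesis
    if "s \<ge> 0" "t \<ge> 0" "s + t = 1" "x = s *\<^sub>R y + t *\<^sub>R z" "{a, b, c} = {y, z, w'}"
      "s * orient p q y = 0" "t * orient p q z = 0" for s t y z w'
  proof -
    have yz: "x \<noteq> y" "x \<noteq> z" using that(5) nx by auto
    have n: "s \<noteq> 0" "t \<noteq> 0" using that(3,4) yz by auto
    have "y \<noteq> z"
    proof
      assume "y = z"
      then have "x = (s + t) *\<^sub>R y" using that(4) by (simp only: scaleR_add_left)
      then show False using yz that(3) by simp
    qed
    have "s = 1 - t" using that by simp
    moreover have "0 < t" "t < 1" using n that(1-3) by linarith+
    ultimately have "x \<in> open_segment y z"
      using that(4) \<open>y \<noteq> z\<close> unfolding in_segment by blast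
    moreover have "orient p q y = 0" "orient p q z = 0" using n that(6,7) by simp_all
    ultimately show thesis using that(5) main by blast
  qed
  ultimately show thesis
  proof (elim disjE)
    assume "u = 0"
    then show thesis using * z by (intro seg[of v w b c a]) (simp_all add: insert_commute)
  next
    assume "v = 0"
    then show thesis using * z by (intro seg[of u w a c b]) (simp_all add: insert_commute)
  next
    assume "w = 0"
    then show thesis using * z by (intro seg[of u v a b c]) simp_all
  qed
qed

text \<open>Every open segment from \<open>w\<close> to a point of \<open>H\<close> stays strictly
  on the side of \<open>w\<close>; its closure adds the end point.\<close>

lemma convex_side_cover:
  assumes H: "convex H" "w \<in> H" "orient c d w < 0" "\<And>x. x \<in> H \<Longrightarrow> orient c d x \<le> 0"
    and K: "closed K" "\<And>x. x \<in> H \<Longrightarrow> orient c d x < 0 \<Longrightarrow> x \<in> K"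
  shows "H \<subseteq> K"
proof
  fix x assume x: "x \<in> H"
  show "x \<in> K"
  proof (cases "x = w")
    case True
    then show ?thesis using H K by blast
  next
    case False
    have "open_segment w x \<subseteq> K"
    proof
      fix y assume "y \<in> open_segment w x"
      then obtain u where u: "0 < u" "u < 1" "y = (1 - u) *\<^sub>R w + u *\<^sub>R x" by (auto simp: in_segment)
      have "y \<in> H" unfolding u using x H u by (intro convexD_alt) auto
      moreover have "orient c d y < 0"
        unfolding u(3) orient_affine using u H(3) H(4)[OF x]
        by (intro add_neg_nonpos) (simp_all add: mult_pos_neg mult_nonneg_nonpos)
      ultimately show "y \<in> K" by (rule K(2))
    qed
    then have "closure (open_segment w x) \<subseteq> K" using K(1) by (rule closure_minimal)
    then show ?thesis using False by (auto simp: closure_open_segment)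
  qed
qed

text \<open>Write \<open>x\<close> as a combination of \<open>s\<close> from the hull of
  \<open>L\<close> and \<open>t\<close> from that of \<open>R\<close>. The segment from
  \<open>x\<close> to \<open>t\<close> meets the line in a point \<open>z\<close>, which
  \<open>line\<close> puts in the hull of \<open>L\<close>, and \<open>x\<close> lies between
  \<open>s\<close> and \<open>z\<close>.\<close>

lemma hull_split:
  assumes L: "L \<noteq> {}" "\<And>x. x \<in> L \<Longrightarrow> orient c d x \<le> 0" and R: "\<And>x. x \<in> R \<Longrightarrow> orient c d x \<ge> 0"
    and line: "\<And>z. z \<in> convex hull (L \<union> R) \<Longrightarrow> orient c d z = 0 \<Longrightarrow> z \<in> convex hull L"
    and x: "x \<in> convex hull (L \<union> R)" "orient c d x < 0"
  shows "x \<in> convex hull L"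
proof (cases "R = {}")
  case True
  then show ?thesis using x by simp
next
  case False
  have "convex hull (L \<union> R) = convex hull (convex hull L \<union> convex hull R)"
    by (metis hull_Un_left hull_Un_right)
  then obtain u v s t where *: "u \<ge> 0" "v \<ge> 0" "u + v = 1" "s \<in> convex hull L" "t \<in> convex hull R"
    "x = u *\<^sub>R s + v *\<^sub>R t"
    using x(1) L(1) False by (auto simp: convex_hull_union_two)
  define w where "w = - orient c d x / (orient c d t - orient c d x)"
  have t: "orient c d t \<ge> 0" using R *(5) by (rule hull_orient_ge)
  then have w: "0 < w" "w \<le> 1" "1 - w = orient c d t / (orient c d t - orient c d x)"
    using x(2) by (auto simp: w_def field_simps)
  define z where "z = (1 - w) *\<^sub>R x + w *\<^sub>R t"
  have "t \<in> convex hull (L \<union> R)" using *(5) hull_mono[of R "L \<union> R"] by blast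
  then have "z \<in> convex hull (L \<union> R)"
    unfolding z_def using w x(1) by (intro convexD_alt[OF convex_convex_hull]) auto
  moreover have "orient c d z = (1 - w) * orient c d x + w * orient c d t"
    unfolding z_def by (rule orient_affine)
  then have "orient c d z = 0" unfolding w(3) by (simp add: w_def field_simps)
  ultimately have "z \<in> convex hull L" by (rule line)
  \<comment> \<open>The normalising constant that appears when \<open>t\<close> is eliminated from
    the equations for \<open>x\<close> and \<open>z\<close>.\<close>
  define D where "D = u * w + v"
  have D: "D > 0" using * w by (cases "u = 0") (auto simp: D_def intro: add_pos_nonneg)
  have "D *\<^sub>R x = (u * w) *\<^sub>R s + v *\<^sub>R z"
  proof -
    have "u = 1 - v" using *(3) by simp
    have "w *\<^sub>R x = (u * w) *\<^sub>R s + v *\<^sub>R (w *\<^sub>R t)"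
      unfolding *(6) by (simp add: scaleR_add_right mult.commute)
    then have "v *\<^sub>R (w *\<^sub>R t) = w *\<^sub>R x - (u * w) *\<^sub>R s" by (simp add: algebra_simps)
    then show ?thesis
      by (simp add: z_def D_def scaleR_add_right \<open>u = 1 - v\<close> algebra_simps)
  qed
  then have "x = (u * w / D) *\<^sub>R s + (v / D) *\<^sub>R z"
    using D by (metis (no_types, opaque_lifting) divide_inverse_commute less_irrefl scaleR_add_right scaleR_left_imp_eq scaleR_one scaleR_scaleR right_inverse)
  moreover have "u * w / D + v / D = 1" using D by (simp add: D_def flip: add_divide_distrib)
  ultimately show ?thesis
    using *(1,2,4) w D \<open>z \<in> convex hull L\<close> by (auto intro!: convexD[OF convex_convex_hull])
qed

section \<open>Removing an ear\<close>

text \<open>Zero orientation is allowed because of the points inside the sides; as it would also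
  allow repeated points, injectivity is demanded separately.\<close>

definition weakly_convex :: "(nat \<Rightarrow> complex) \<Rightarrow> nat \<Rightarrow> nat \<Rightarrow> bool" where
  "weakly_convex p a b \<longleftrightarrow> inj_on p {a..b} \<and>
     (\<forall>i j l. a \<le> i \<longrightarrow> i < j \<longrightarrow> j < l \<longrightarrow> l \<le> b \<longrightarrow> 0 \<le> orient (p i) (p j) (p l))"

lemma weakly_convex_orient:
  assumes "weakly_convex p a b" "a \<le> i" "i \<le> j" "j \<le> l" "l \<le> b"
  shows "0 \<le> orient (p i) (p j) (p l)"
  using assms by (cases "i = j \<or> j = l") (auto simp: weakly_convex_def)

lemma weakly_convex_subset:
  "weakly_convex p a b \<Longrightarrow> a \<le> a' \<Longrightarrow> b' \<le> b \<Longrightarrow> weakly_convex p a' b'"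
  unfolding weakly_convex_def by (auto intro: inj_on_subset)

text \<open>A chain of two points bounds a degenerate polygon, which counts as triangulated by no triangle.\<close>

definition chain_triangulations :: "(nat \<Rightarrow> complex) \<Rightarrow> nat \<Rightarrow> nat \<Rightarrow> complex set set set" where
  "chain_triangulations p a b = (if b = Suc a then {{}} else triangulations (p ` {a..b}))"

lemma chain_triangulationsD:
  assumes "T \<in> chain_triangulations p a b"
  shows "t \<in> T \<Longrightarrow> empty_triangle (p ` {a..b}) t" "pairwise (\<lambda>t u. interior t \<inter> interior u = {}) T"
    "\<Union>T \<subseteq> convex hull (p ` {a..b})" "b \<noteq> Suc a \<Longrightarrow> \<Union>T = convex hull (p ` {a..b})"
  using assms by (auto simp: chain_triangulations_def triangulations_iff split: if_splits)

lemma orient_flip: "orient a c b = - orient a b c"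
  by (simp add: orient_def' algebra_simps)

text \<open>A triangulation forces some \<open>p k\<close> off the line of the base. A chain point
  inside the base would then form, with \<open>p k\<close> and one end of the base, a triple turning
  the wrong way.\<close>

lemma chain_base_empty:
  assumes conv: "weakly_convex p c d" and "c < d" and T: "T \<in> chain_triangulations p c d"
  shows "p ` {c..d} \<inter> open_segment (p c) (p d) = {}"
proof (cases "d = Suc c")
  case True
  have "{c..Suc c} = {c, Suc c}" by auto
  then show ?thesis using True by (auto simp: open_segment_def)
next
  case False
  have "p c \<noteq> p d"
    using conv \<open>c < d\<close> inj_on_eq_iff[of p "{c..d}" c d] by (auto simp: weakly_convex_def)
  have "p c \<in> \<Union>T" using chain_triangulationsD(4)[OF T False] \<open>c < d\<close> by (auto intro: hull_inc)
  then obtain t where t: "empty_triangle (p ` {c..d}) t" using chain_triangulationsD(1)[OF T] by blast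
  obtain k where k: "k \<in> {c..d}" "orient (p c) (p d) (p k) \<noteq> 0"
    using no_empty_triangle_on_line[OF t \<open>p c \<noteq> p d\<close>] by blast
  have "orient (p c) (p d) (p k) = - orient (p c) (p k) (p d)" by (rule orient_flip)
  then have neg: "orient (p c) (p d) (p k) < 0"
    using k weakly_convex_orient[OF conv, of c k d] by auto
  show ?thesis
  proof (rule ccontr)
    assume "\<not> ?thesis"
    then obtain i where i: "i \<in> {c..d}" "p i \<in> open_segment (p c) (p d)" by blast
    then obtain u where u: "0 < u" "u < 1" "p i = (1 - u) *\<^sub>R p c + u *\<^sub>R p d"
      by (auto simp: in_segment)
    have 1: "orient (p c) (p i) (p k) = u * orient (p c) (p d) (p k)"
      and 2: "orient (p k) (p i) (p d) = (1 - u) * orient (p c) (p d) (p k)"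
      and 3: "orient (p c) (p d) (p i) = 0"
      unfolding u(3) by (simp_all add: orient_def' algebra_simps)
    consider "i < k" | "i = k" | "k < i" by linarith
    then show False
    proof cases
      case 1
      then have "0 \<le> u * orient (p c) (p d) (p k)"
        using weakly_convex_orient[OF conv, of c i k] i k \<open>orient (p c) (p i) (p k) = _\<close> by auto
      then show False using u neg by (simp add: zero_le_mult_iff)
    next
      case 2
      then show False using 3 neg by simp
    next
      case 3
      then have "0 \<le> (1 - u) * orient (p c) (p d) (p k)"
        using weakly_convex_orient[OF conv, of k i d] i k \<open>orient (p k) (p i) (p d) = _\<close> by auto
      then show False using u neg by (simp add: zero_le_mult_iff)
    qed
  qed
qed

locale ear =
  fixes p :: "nat \<Rightarrow> complex" and a m b :: nat
  assumes conv: "weakly_convex p a b" and am: "a < m" and mb: "m < b"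
    and pos: "orient (p a) (p m) (p b) > 0"
    and base: "p ` {a..b} \<inter> open_segment (p a) (p b) = {}"
begin

abbreviation "S \<equiv> p ` {a..b}"
abbreviation "L \<equiv> p ` {a..m}"
abbreviation "R \<equiv> p ` {m..b}"
abbreviation "t \<equiv> convex hull {p a, p m, p b}"

lemma S_eq: "S = L \<union> R"
proof -
  have "{a..b} = {a..m} \<union> {m..b}" using am mb by auto
  then show ?thesis by (simp add: image_Un)
qed

lemma pos': "orient (p m) (p b) (p a) > 0" "orient (p b) (p a) (p m) > 0"
  using pos orient_rotate by metis+

lemma p_eq_iff: "i \<in> {a..b} \<Longrightarrow> j \<in> {a..b} \<Longrightarrow> p i = p j \<longleftrightarrow> i = j"
  using conv unfolding weakly_convex_def inj_on_def by blast

lemma L_side: "x \<in> L \<Longrightarrow> orient (p a) (p m) x \<le> 0" "x \<in> L \<Longrightarrow> orient (p m) (p b) x \<ge> 0"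
proof -
  assume "x \<in> L"
  then obtain i where i: "a \<le> i" "i \<le> m" "x = p i" by auto
  show "orient (p a) (p m) x \<le> 0"
    using weakly_convex_orient[OF conv, of a i m] i mb orient_flip[of "p a" "p m" x] by simp
  have "orient (p m) (p b) x = orient x (p m) (p b)" by (simp add: orient_def' algebra_simps)
  then show "orient (p m) (p b) x \<ge> 0"
    using weakly_convex_orient[OF conv, of i m b] i mb by simp
qed

lemma R_side: "x \<in> R \<Longrightarrow> orient (p a) (p m) x \<ge> 0" "x \<in> R \<Longrightarrow> orient (p m) (p b) x \<le> 0"
proof -
  assume "x \<in> R"
  then obtain i where i: "m \<le> i" "i \<le> b" "x = p i" by auto
  show "orient (p a) (p m) x \<ge> 0"
    using weakly_convex_orient[OF conv, of a m i] i am by simp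
  show "orient (p m) (p b) x \<le> 0"
    using weakly_convex_orient[OF conv, of m i b] i am orient_flip[of "p m" "p b" x] by simp
qed

lemma S_side: "x \<in> S \<Longrightarrow> orient (p b) (p a) x \<ge> 0"
proof -
  assume "x \<in> S"
  then obtain i where i: "a \<le> i" "i \<le> b" "x = p i" by auto
  have "orient (p b) (p a) x = orient (p a) x (p b)" by (simp add: orient_def' algebra_simps)
  then show ?thesis using weakly_convex_orient[OF conv, of a i b] i by simp
qed

lemma hull_L_side:
  "x \<in> convex hull L \<Longrightarrow> orient (p a) (p m) x \<le> 0"
  "x \<in> convex hull L \<Longrightarrow> orient (p m) (p b) x \<ge> 0"
  using hull_orient_le[of L "p a" "p m" x] hull_orient_ge[of L "p m" "p b" x] L_side by blast+

lemma hull_R_side: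
  "x \<in> convex hull R \<Longrightarrow> orient (p a) (p m) x \<ge> 0"
  "x \<in> convex hull R \<Longrightarrow> orient (p m) (p b) x \<le> 0"
  using hull_orient_ge[of R "p a" "p m" x] hull_orient_le[of R "p m" "p b" x] R_side by blast+

lemma hull_S_side: "x \<in> convex hull S \<Longrightarrow> orient (p b) (p a) x \<ge> 0"
  using hull_orient_ge[of S "p b" "p a" x] S_side by blast

lemma hull_L_subset: "convex hull L \<subseteq> convex hull S" and hull_R_subset: "convex hull R \<subseteq> convex hull S"
  unfolding S_eq by (simp_all add: hull_mono)

lemma t_subset: "t \<subseteq> convex hull S"
  using am mb by (intro hull_mono) auto

text \<open>For \<open>hull_split\<close>, the line through \<open>p a\<close> and
  \<open>p m\<close> must meet the whole hull only between these points. The base bounds the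
  position from one end, and the supporting line \<open>K\<close> through \<open>p m\<close> and its
  successor from the other.\<close>

lemma left_hull:
  assumes x: "x \<in> convex hull S" "orient (p a) (p m) x < 0"
  shows "x \<in> convex hull L"
proof (rule hull_split[where c = "p a" and d = "p m" and R = R])
  show "orient (p a) (p m) y \<le> 0" if "y \<in> L" for y using that by (rule L_side)
  show "orient (p a) (p m) y \<ge> 0" if "y \<in> R" for y using that by (rule R_side)
  show "orient (p a) (p m) x < 0" by (fact x)
  show "L \<noteq> {}" using am by auto
  show "x \<in> convex hull (L \<union> R)" using x(1) unfolding S_eq .
  fix z assume z: "z \<in> convex hull (L \<union> R)" "orient (p a) (p m) z = 0"
  then obtain u where u: "z = (1 - u) *\<^sub>R p a + u *\<^sub>R p m"
    "orient (p b) (p a) z = u * orient (p a) (p m) (p b)"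
    using on_triangle_side pos by metis
  have "orient (p b) (p a) z \<ge> 0" using z(1) unfolding S_eq[symmetric] by (rule hull_S_side)
  then have "u \<ge> 0" using u(2) pos by (simp add: zero_le_mult_iff)
  define K where "K = orient (p m) (p (Suc m))"
  have KS: "K y \<ge> 0" if y: "y \<in> S" for y
  proof -
    obtain i where i: "a \<le> i" "i \<le> b" "y = p i" using y by auto
    show ?thesis
    proof (cases "i \<le> m")
      case True
      have "K y = orient y (p m) (p (Suc m))" unfolding K_def by (simp add: orient_def' algebra_simps)
      then show ?thesis using True weakly_convex_orient[OF conv, of i m "Suc m"] i mb by simp
    next
      case False
      then show ?thesis using weakly_convex_orient[OF conv, of m "Suc m" i] i am by (simp add: K_def)
    qed
  qed
  have K: "K y \<ge> 0" if "y \<in> convex hull S" for y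
    using KS that unfolding K_def by (rule hull_orient_ge)
  \<comment> \<open>Otherwise \<open>K\<close> would be the line through \<open>p a\<close> and
    \<open>p m\<close> itself, with the successor beyond \<open>p m\<close>, and then the whole hull
    would be on the side opposite to \<open>x\<close>.\<close>
  have "K (p a) \<noteq> 0"
  proof
    assume "K (p a) = 0"
    then have "orient (p a) (p m) (p (Suc m)) = 0"
      unfolding K_def by (simp add: orient_def' algebra_simps)
    then obtain v where v: "p (Suc m) = (1 - v) *\<^sub>R p a + v *\<^sub>R p m"
      "orient (p m) (p b) (p (Suc m)) = (1 - v) * orient (p a) (p m) (p b)"
      using on_triangle_side pos by metis
    have "orient (p m) (p b) (p (Suc m)) \<le> 0" using mb by (intro R_side) auto
    then have "v \<ge> 1" using v(2) pos by (simp add: mult_le_0_iff)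
    moreover have "v \<noteq> 1" using v(1) p_eq_iff[of "Suc m" m] am mb by auto
    ultimately have v1: "v - 1 > 0" by simp
    have *: "K y = (v - 1) * orient (p a) (p m) y" for y
      unfolding K_def v(1) by (simp add: orient_def' algebra_simps)
    have "0 \<le> (v - 1) * orient (p a) (p m) x" using K[OF x(1)] unfolding * .
    then show False using x(2) v1 by (simp add: zero_le_mult_iff)
  qed
  moreover have "K (p a) \<ge> 0" using am mb by (intro KS) auto
  ultimately have "K (p a) > 0" by simp
  have "K z = (1 - u) * K (p a)" unfolding K_def u(1) orient_affine by simp
  moreover have "K z \<ge> 0" using z(1) unfolding S_eq[symmetric] by (rule K)
  ultimately have "u \<le> 1" using \<open>K (p a) > 0\<close> by (simp add: zero_le_mult_iff)
  have "p a \<in> convex hull L" "p m \<in> convex hull L" using am by (auto intro: hull_inc)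
  then show "z \<in> convex hull L"
    unfolding u(1) using \<open>u \<ge> 0\<close> \<open>u \<le> 1\<close> by (intro convexD_alt[OF convex_convex_hull])
qed

text \<open>Mirror image of \<open>left_hull\<close>; the supporting line now passes through
  \<open>p m\<close> and its predecessor.\<close>

lemma right_hull:
  assumes x: "x \<in> convex hull S" "orient (p m) (p b) x < 0"
  shows "x \<in> convex hull R"
proof (rule hull_split[where c = "p m" and d = "p b" and R = L])
  show "orient (p m) (p b) y \<le> 0" if "y \<in> R" for y using that by (rule R_side)
  show "orient (p m) (p b) y \<ge> 0" if "y \<in> L" for y using that by (rule L_side)
  show "orient (p m) (p b) x < 0" by (fact x)
  show "R \<noteq> {}" using mb by auto
  show "x \<in> convex hull (R \<union> L)" using x(1) unfolding S_eq by (simp add: Un_commute)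
  fix z assume z': "z \<in> convex hull (R \<union> L)" "orient (p m) (p b) z = 0"
  then have z: "z \<in> convex hull S" unfolding S_eq by (simp add: Un_commute)
  obtain u where u: "z = (1 - u) *\<^sub>R p m + u *\<^sub>R p b"
    "orient (p b) (p a) z = (1 - u) * orient (p m) (p b) (p a)"
    using on_triangle_side pos'(1) z'(2) by metis
  have "orient (p b) (p a) z \<ge> 0" using z by (rule hull_S_side)
  then have "u \<le> 1" using u(2) pos' by (simp add: zero_le_mult_iff)
  define n where "n = m - 1"
  have n: "Suc n = m" "a \<le> n" using am by (auto simp: n_def)
  define K where "K = orient (p n) (p m)"
  have KS: "K y \<ge> 0" if y: "y \<in> S" for y
  proof -
    obtain i where i: "a \<le> i" "i \<le> b" "y = p i" using y by auto
    show ?thesis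
    proof (cases "i \<le> n")
      case True
      have "K y = orient y (p n) (p m)" unfolding K_def by (simp add: orient_def' algebra_simps)
      then show ?thesis using True weakly_convex_orient[OF conv, of i n m] i n mb by simp
    next
      case False
      then show ?thesis using weakly_convex_orient[OF conv, of n m i] i n by (simp add: K_def)
    qed
  qed
  have K: "K y \<ge> 0" if "y \<in> convex hull S" for y
    using KS that unfolding K_def by (rule hull_orient_ge)
  have "K (p b) \<noteq> 0"
  proof
    assume "K (p b) = 0"
    then have "orient (p m) (p b) (p n) = 0"
      unfolding K_def by (simp add: orient_def' algebra_simps)
    then obtain v where v: "p n = (1 - v) *\<^sub>R p m + v *\<^sub>R p b"
      "orient (p a) (p m) (p n) = v * orient (p m) (p b) (p a)"
      using on_triangle_side pos'(1) by metis
    have "orient (p a) (p m) (p n) \<le> 0" using n by (intro L_side) auto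
    then have "v \<le> 0" using v(2) pos' by (simp add: mult_le_0_iff)
    moreover have "v \<noteq> 0" using v(1) p_eq_iff[of n m] n am mb by auto
    ultimately have v1: "- v > 0" by simp
    have *: "K y = - v * orient (p m) (p b) y" for y
      unfolding K_def v(1) by (simp add: orient_def' algebra_simps)
    have "0 \<le> - v * orient (p m) (p b) x" using K[OF x(1)] unfolding * .
    then show False using x(2) v1 by (simp add: zero_le_mult_iff mult_le_0_iff)
  qed
  moreover have "K (p b) \<ge> 0" using am mb by (intro KS) auto
  ultimately have "K (p b) > 0" by simp
  have "K z = u * K (p b)" unfolding K_def u(1) orient_affine by simp
  moreover have "K z \<ge> 0" using z by (rule K)
  ultimately have "u \<ge> 0" using \<open>K (p b) > 0\<close> by (simp add: zero_le_mult_iff)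
  have "p b \<in> convex hull R" "p m \<in> convex hull R" using mb by (auto intro: hull_inc)
  then show "z \<in> convex hull R"
    unfolding u(1) using \<open>u \<ge> 0\<close> \<open>u \<le> 1\<close> by (intro convexD_alt[OF convex_convex_hull])
qed

lemma hull_decomposition: "convex hull S = t \<union> convex hull L \<union> convex hull R"
proof
  show "convex hull S \<subseteq> t \<union> convex hull L \<union> convex hull R"
  proof
    fix x assume x: "x \<in> convex hull S"
    consider "orient (p a) (p m) x < 0" | "orient (p m) (p b) x < 0"
      | "orient (p a) (p m) x \<ge> 0" "orient (p m) (p b) x \<ge> 0" by linarith
    then show "x \<in> t \<union> convex hull L \<union> convex hull R"
    proof cases
      case 3
      then have "x \<in> t" unfolding triangle_hull[OF pos] using hull_S_side[OF x] by simp
      then show ?thesis by simp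
    qed (use left_hull right_hull x in auto)
  qed
qed (use t_subset hull_L_subset hull_R_subset in auto)

lemma empty_triangle_t_iff:
  "empty_triangle S t \<longleftrightarrow> S \<inter> open_segment (p a) (p m) = {} \<and> S \<inter> open_segment (p m) (p b) = {}"
proof
  assume "empty_triangle S t"
  from empty_triangleD[OF this pos]
  show "S \<inter> open_segment (p a) (p m) = {} \<and> S \<inter> open_segment (p m) (p b) = {}" by simp
next
  assume *: "S \<inter> open_segment (p a) (p m) = {} \<and> S \<inter> open_segment (p m) (p b) = {}"
  show "empty_triangle S t"
    by (rule empty_triangleI[OF _ _ _ pos refl])
       (use am mb * base in \<open>auto simp: open_segment_commute[of "p m" "p a"]
         open_segment_commute[of "p b" "p m"] open_segment_commute[of "p b" "p a"]\<close>)
qed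

lemma apex_in: "p m \<in> S" "p m \<in> L" "p m \<in> R" "p a \<in> L" "p b \<in> R" "p a \<in> S" "p b \<in> S"
  using am mb by auto

lemma corner_distinct: "p a \<noteq> p m" "p m \<noteq> p b"
  using pos by auto

text \<open>Such a triangle would lie on both sides of the line through \<open>p a\<close> and
  \<open>p m\<close>, so its interior would be disjoint from itself.\<close>

lemma L_not_R: "empty_triangle R u \<Longrightarrow> \<not> u \<subseteq> convex hull L"
proof
  assume u: "empty_triangle R u" "u \<subseteq> convex hull L"
  have "interior u \<inter> interior u = {}"
    by (rule disjoint_interior_orient[OF corner_distinct(1)])
       (use u hull_L_side hull_R_side empty_triangle_props(1)[OF u(1)] in blast)+
  then show False using empty_triangle_props(2)[OF u(1)] by simp
qed

lemma R_not_L: "empty_triangle L u \<Longrightarrow> \<not> u \<subseteq> convex hull R"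
proof
  assume u: "empty_triangle L u" "u \<subseteq> convex hull R"
  have "interior u \<inter> interior u = {}"
    by (rule disjoint_interior_orient[OF corner_distinct(2)])
       (use u hull_L_side hull_R_side empty_triangle_props(1)[OF u(1)] in blast)+
  then show False using empty_triangle_props(2)[OF u(1)] by simp
qed

lemma t_not_subset: "\<not> t \<subseteq> convex hull L" "\<not> t \<subseteq> convex hull R"
proof -
  have "p b \<in> t" "p a \<in> t" by (simp_all add: hull_inc)
  moreover have "p b \<notin> convex hull L" using hull_L_side(1)[of "p b"] pos by auto
  moreover have "p a \<notin> convex hull R" using hull_R_side(2)[of "p a"] pos' by auto
  ultimately show "\<not> t \<subseteq> convex hull L" "\<not> t \<subseteq> convex hull R" by blast+
qed

lemma t_side:
  assumes "x \<in> t"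
  shows "orient (p a) (p m) x \<ge> 0" "orient (p m) (p b) x \<ge> 0"
  using assms unfolding triangle_hull[OF pos] by simp_all

text \<open>Suppose \<open>u\<close> has a corner outside \<open>R\<close> and one outside
  \<open>L\<close>. Edges between such corners cannot cross \<open>t\<close>, which forces all
  corners into \<open>t\<close>; then the interior of \<open>u\<close> lies in that of
  \<open>t\<close>, contrary to \<open>disj\<close>.\<close>

lemma empty_triangle_cases:
  assumes u: "empty_triangle S u" and disj: "interior u \<inter> interior t = {}"
  shows "empty_triangle L u \<or> empty_triangle R u"
proof -
  obtain A B C where v: "A \<in> S" "B \<in> S" "C \<in> S" "orient A B C > 0" "u = convex hull {A, B, C}"
    "\<forall>x\<in>{A, B, C}. \<forall>y\<in>{A, B, C}. S \<inter> open_segment x y = {}"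
    using u by (rule empty_triangleE)
  define V where "V = {A, B, C}"
  have V: "V \<subseteq> S" "u = convex hull V" using v by (auto simp: V_def)
  have e: "S \<inter> open_segment x y = {}" if "x \<in> V" "y \<in> V" for x y
    by (rule bspec[OF bspec[OF v(6)]]) (use that V_def in simp_all)
  have sub: "empty_triangle Q u" if Q: "V \<subseteq> Q" "Q \<subseteq> S" for Q
  proof (rule empty_triangleI[OF _ _ _ v(4,5)])
    show "A \<in> Q" "B \<in> Q" "C \<in> Q" using Q by (auto simp: V_def)
    show "Q \<inter> open_segment x y = {}" if "x \<in> {A, B, C}" "y \<in> {A, B, C}" for x y
      using e[of x y] that Q(2) unfolding V_def by blast
  qed
  show ?thesis
  proof (cases "V \<subseteq> L \<or> V \<subseteq> R")
    case True
    then show ?thesis using sub S_eq by blast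
  next
    case False
    have no: "\<not> (\<exists>z\<in>closed_segment x y. z \<in> interior t)" if xy: "x \<in> V" "y \<in> V" for x y
    proof
      assume "\<exists>z\<in>closed_segment x y. z \<in> interior t"
      then obtain z where z: "z \<in> closed_segment x y" "z \<in> interior t" by blast
      have "x \<in> u" "y \<in> u" using xy V(2) hull_inc by metis+
      then have "closed_segment x y \<subseteq> u"
        using V(2) by (intro closed_segment_subset) (simp_all add: convex_convex_hull)
      then have "interior t \<inter> interior u \<noteq> {}"
        using z by (intro empty_triangle_props(4)[OF u open_interior]) auto
      then show False using disj by blast
    qed
    \<comment> \<open>By the crossing lemmas, an edge \<open>x y\<close> that avoids the interior of
      \<open>t\<close> has \<open>x\<close> on the line through \<open>p a\<close>,
      \<open>p m\<close> and \<open>y\<close> on the line through \<open>p m\<close>,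
      \<open>p b\<close>.\<close>
    have side: "orient (p a) (p m) x \<ge> 0 \<and> orient (p m) (p b) y \<ge> 0"
      if xy: "x \<in> V" "x \<notin> R" "y \<in> V" "y \<notin> L" for x y
    proof -
      have "x \<in> L" "y \<in> R" using xy V S_eq by blast+
      then obtain i j where i: "a \<le> i" "i \<le> m" "x = p i" and j: "m \<le> j" "j \<le> b" "y = p j" by auto
      have im: "i < m" "m < j" using xy i j apex_in by (auto simp: order.order_iff_strict)
      have ne: "x \<noteq> p m" "y \<noteq> p m" using xy apex_in by auto
      note C = weakly_convex_orient[OF conv]
      have o: "orient (p a) x (p b) \<ge> 0" "orient (p a) y (p b) \<ge> 0" "orient (p a) (p m) y \<ge> 0"
        "orient (p m) y (p b) \<ge> 0" "orient x (p m) y \<ge> 0" "orient x (p m) (p b) \<ge> 0" "orient (p a) x (p m) \<ge> 0"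
        unfolding i(3) j(3) using C[of a i b] C[of a j b] C[of a m j] C[of m j b] C[of i m j] C[of i m b] C[of a i m]
          i j am mb by simp_all
      have "p a \<notin> open_segment x y" "p m \<notin> open_segment x y" "p b \<notin> open_segment x y"
        using e[OF xy(1,3)] apex_in by blast+
      then have "\<not> orient (p a) x (p m) > 0" "\<not> orient (p m) y (p b) > 0"
        using no[OF xy(1,3)] crossing_point[OF pos, of x y] crossing_point'[OF pos, of y x] o ne by blast+
      then show ?thesis using orient_flip[of "p a" "p m" x] orient_flip[of "p m" "p b" y] by linarith
    qed
    obtain x0 y0 where xy0: "x0 \<in> V" "x0 \<notin> R" "y0 \<in> V" "y0 \<notin> L" using False by blast
    have "orient (p a) (p m) v \<ge> 0" "orient (p m) (p b) v \<ge> 0" "orient (p b) (p a) v \<ge> 0" if v: "v \<in> V" for v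
    proof -
      show "orient (p b) (p a) v \<ge> 0" using v V(1) S_side by blast
      show "orient (p a) (p m) v \<ge> 0"
        using R_side(1)[of v] side[OF v _ xy0(3,4)] by blast
      show "orient (p m) (p b) v \<ge> 0"
        using L_side(2)[of v] side[OF xy0(1,2) v] by blast
    qed
    then have "V \<subseteq> t" unfolding triangle_hull[OF pos] by blast
    then have "u \<subseteq> t" unfolding V(2) by (simp add: hull_minimal convex_convex_hull)
    then have "interior u \<subseteq> interior t" by (rule interior_mono)
    then show ?thesis using disj empty_triangle_props(2)[OF u] by blast
  qed
qed

context
  fixes T
  assumes T: "T \<in> triangulations S" and tT: "t \<in> T"
begin

lemma T_empty_triangle: "u \<in> T \<Longrightarrow> empty_triangle S u"
  using T by (simp add: triangulations_iff)

lemma T_disjoint: "u \<in> T \<Longrightarrow> v \<in> T \<Longrightarrow> u \<noteq> v \<Longrightarrow> interior u \<inter> interior v = {}"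
  using T by (simp add: triangulations_iff pairwise_def)

lemma T_cases: "u \<in> T \<Longrightarrow> u = t \<or> empty_triangle L u \<or> empty_triangle R u"
  using empty_triangle_cases[of u] T_empty_triangle[of u] T_disjoint[OF _ tT, of u] by blast

text \<open>Lying in the hull of a part is a condition on the triangle alone; on members of
  \<open>T\<close> it agrees with having corners in that part, so it can be used to split
  \<open>T\<close>.\<close>

lemma T_L: "u \<in> T \<Longrightarrow> u \<subseteq> convex hull L \<longleftrightarrow> empty_triangle L u"
  using T_cases[of u] L_not_R t_not_subset(1) empty_triangle_props(1) by blast

lemma T_R: "u \<in> T \<Longrightarrow> u \<subseteq> convex hull R \<longleftrightarrow> empty_triangle R u"
  using T_cases[of u] R_not_L t_not_subset(2) empty_triangle_props(1) by blast

lemma T_closed_union: "closed (\<Union>{u \<in> T. P u})"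
proof (rule closed_Union)
  show "finite {u \<in> T. P u}" using finite_triangulation[OF _ T] by simp
qed (use T_empty_triangle empty_triangle_props(3) in blast)

lemma T_union: "\<Union>T = convex hull S"
  using T by (simp add: triangulations_iff)

lemma left_part: "{u \<in> T. u \<subseteq> convex hull L} \<in> chain_triangulations p a m"
proof (cases "m = Suc a")
  case True
  have "{a..m} = {a, m}" using True by auto
  then have "orient (p a) (p m) x = 0" if "x \<in> L" for x using that by auto
  then have "\<not> empty_triangle L u" for u
    using no_empty_triangle_on_line[OF _ corner_distinct(1)] by blast
  then have "{u \<in> T. u \<subseteq> convex hull L} = {}" using T_L by blast
  then show ?thesis using True by (simp add: chain_triangulations_def)
next
  case False
  \<comment> \<open>The second point of the chain works: on the line it would lie inside a side of
    \<open>t\<close>, but sides of triangles of \<open>T\<close> contain no further points of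
    \<open>S\<close>.\<close>
  have "\<exists>w\<in>L. orient (p a) (p m) w < 0"
  proof -
    define w where "w = p (Suc a)"
    have w: "w \<in> L" "w \<in> S" using am mb False by (auto simp: w_def)
    have "w \<noteq> p a" "w \<noteq> p m" using p_eq_iff am mb False by (auto simp: w_def)
    have "orient (p a) (p m) w \<noteq> 0"
    proof
      assume "orient (p a) (p m) w = 0"
      then have "w \<in> closed_segment (p a) (p m)"
        using S_side[OF w(2)] L_side(2)[OF w(1)] by (intro on_triangle_closed_side[OF pos])
      then have "w \<in> S \<inter> open_segment (p a) (p m)" using w \<open>w \<noteq> p a\<close> \<open>w \<noteq> p m\<close> by (simp add: open_segment_def)
      then show False using T_empty_triangle[OF tT] empty_triangle_t_iff by blast
    qed
    then show ?thesis using L_side(1)[OF w(1)] w(1) by force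
  qed
  then obtain w where w: "w \<in> L" "orient (p a) (p m) w < 0" by blast
  \<comment> \<open>Points strictly beyond the line through \<open>p a\<close> and
    \<open>p m\<close> are covered neither by \<open>t\<close> nor by triangles of \<open>R\<close>;
    \<open>convex_side_cover\<close> adds the boundary.\<close>
  have "convex hull L \<subseteq> \<Union>{u \<in> T. u \<subseteq> convex hull L}"
  proof (rule convex_side_cover[OF convex_convex_hull _ w(2) _ T_closed_union])
    show "w \<in> convex hull L" using w(1) by (rule hull_inc)
    show "orient (p a) (p m) x \<le> 0" if "x \<in> convex hull L" for x using that by (rule hull_L_side)
    fix x assume x: "x \<in> convex hull L" "orient (p a) (p m) x < 0"
    then have "x \<in> \<Union>T" unfolding T_union using hull_L_subset by blast
    then obtain u where u: "u \<in> T" "x \<in> u" by blast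
    have "u \<noteq> t" using t_side(1)[of x] u x(2) by auto
    moreover have "\<not> empty_triangle R u"
    proof
      assume "empty_triangle R u"
      then have "x \<in> convex hull R" using empty_triangle_props(1) u(2) by blast
      then show False using hull_R_side(1) x(2) by fastforce
    qed
    ultimately show "x \<in> \<Union>{u \<in> T. u \<subseteq> convex hull L}" using T_cases[OF u(1)] T_L u by blast
  qed
  moreover have "pairwise (\<lambda>t u. interior t \<inter> interior u = {}) {u \<in> T. u \<subseteq> convex hull L}"
    using T_disjoint by (auto simp: pairwise_def)
  moreover have "\<forall>u\<in>{u \<in> T. u \<subseteq> convex hull L}. empty_triangle L u" using T_L by blast
  ultimately have "{u \<in> T. u \<subseteq> convex hull L} \<in> triangulations L"
    unfolding triangulations_iff by blast
  then show ?thesis using False by (simp add: chain_triangulations_def)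
qed

lemma right_part: "{u \<in> T. u \<subseteq> convex hull R} \<in> chain_triangulations p m b"
proof (cases "b = Suc m")
  case True
  have "{m..b} = {m, b}" using True by auto
  then have "orient (p m) (p b) x = 0" if "x \<in> R" for x using that by auto
  then have "\<not> empty_triangle R u" for u
    using no_empty_triangle_on_line[OF _ corner_distinct(2)] by blast
  then have "{u \<in> T. u \<subseteq> convex hull R} = {}" using T_R by blast
  then show ?thesis using True by (simp add: chain_triangulations_def)
next
  case False
  have "\<exists>w\<in>R. orient (p m) (p b) w < 0"
  proof -
    define w where "w = p (Suc m)"
    have w: "w \<in> R" "w \<in> S" using am mb False by (auto simp: w_def)
    have "w \<noteq> p m" "w \<noteq> p b" using p_eq_iff am mb False by (auto simp: w_def)
    have "orient (p m) (p b) w \<noteq> 0"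
    proof
      assume "orient (p m) (p b) w = 0"
      then have "w \<in> closed_segment (p m) (p b)"
        using S_side[OF w(2)] R_side(1)[OF w(1)] by (intro on_triangle_closed_side[OF pos'(1)])
      then have "w \<in> S \<inter> open_segment (p m) (p b)" using w \<open>w \<noteq> p m\<close> \<open>w \<noteq> p b\<close> by (simp add: open_segment_def)
      then show False using T_empty_triangle[OF tT] empty_triangle_t_iff by blast
    qed
    then show ?thesis using R_side(2)[OF w(1)] w(1) by force
  qed
  then obtain w where w: "w \<in> R" "orient (p m) (p b) w < 0" by blast
  have "convex hull R \<subseteq> \<Union>{u \<in> T. u \<subseteq> convex hull R}"
  proof (rule convex_side_cover[OF convex_convex_hull _ w(2) _ T_closed_union])
    show "w \<in> convex hull R" using w(1) by (rule hull_inc)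
    show "orient (p m) (p b) x \<le> 0" if "x \<in> convex hull R" for x using that by (rule hull_R_side)
    fix x assume x: "x \<in> convex hull R" "orient (p m) (p b) x < 0"
    then have "x \<in> \<Union>T" unfolding T_union using hull_R_subset by blast
    then obtain u where u: "u \<in> T" "x \<in> u" by blast
    have "u \<noteq> t" using t_side(2)[of x] u x(2) by auto
    moreover have "\<not> empty_triangle L u"
    proof
      assume "empty_triangle L u"
      then have "x \<in> convex hull L" using empty_triangle_props(1) u(2) by blast
      then show False using hull_L_side(2) x(2) by fastforce
    qed
    ultimately show "x \<in> \<Union>{u \<in> T. u \<subseteq> convex hull R}" using T_cases[OF u(1)] T_R u by blast
  qed
  moreover have "pairwise (\<lambda>t u. interior t \<inter> interior u = {}) {u \<in> T. u \<subseteq> convex hull R}"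
    using T_disjoint by (auto simp: pairwise_def)
  moreover have "\<forall>u\<in>{u \<in> T. u \<subseteq> convex hull R}. empty_triangle R u" using T_R by blast
  ultimately have "{u \<in> T. u \<subseteq> convex hull R} \<in> triangulations R"
    unfolding triangulations_iff by blast
  then show ?thesis using False by (simp add: chain_triangulations_def)
qed

lemma parts_join: "insert t ({u \<in> T. u \<subseteq> convex hull L} \<union> {u \<in> T. u \<subseteq> convex hull R}) = T"
  using T_cases T_L T_R tT by blast

end

text \<open>A point of \<open>R\<close> between two points of \<open>L\<close> would force all three
  onto the segment from \<open>p a\<close> to \<open>p m\<close>, where \<open>R\<close> contains
  only \<open>p m\<close>. Hence edges that are empty with respect to \<open>L\<close> are empty
  with respect to \<open>S\<close>.\<close>

lemma L_convex_position:
  assumes "x \<in> L" "y \<in> L" "z \<in> S - L"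
  shows "z \<notin> open_segment x y"
proof
  assume "z \<in> open_segment x y"
  then obtain u where u: "0 < u" "u < 1" "z = (1 - u) *\<^sub>R x + u *\<^sub>R y" by (auto simp: in_segment)
  have zR: "z \<in> R" using assms(3) S_eq by blast
  have "(1 - u) * orient (p a) (p m) x + u * orient (p a) (p m) y \<ge> 0"
    using R_side(1)[OF zR] unfolding u(3) orient_affine .
  moreover have "(1 - u) * orient (p a) (p m) x \<le> 0" "u * orient (p a) (p m) y \<le> 0"
    using u L_side(1) assms(1,2) by (simp_all add: mult_nonneg_nonpos)
  ultimately have "(1 - u) * orient (p a) (p m) x = 0" "u * orient (p a) (p m) y = 0" by linarith+
  then have "orient (p a) (p m) x = 0" "orient (p a) (p m) y = 0" using u by simp_all
  moreover have "x \<in> S" "y \<in> S" using assms(1,2) S_eq by blast+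
  ultimately have "x \<in> closed_segment (p a) (p m)" "y \<in> closed_segment (p a) (p m)"
    using on_triangle_closed_side[OF pos] S_side L_side(2) assms(1,2) by blast+
  then have "z \<in> closed_segment (p a) (p m)"
    unfolding u(3) using u by (intro convexD_alt[OF convex_closed_segment]) auto
  then obtain v where v: "v \<le> 1" "z = (1 - v) *\<^sub>R p a + v *\<^sub>R p m" by (auto simp: in_segment)
  have "orient (p m) (p b) z = (1 - v) * orient (p m) (p b) (p a)" unfolding v(2) orient_affine by simp
  then have "(1 - v) * orient (p m) (p b) (p a) \<le> 0" using R_side(2)[OF zR] by simp
  then have "v = 1" using v(1) pos' by (simp add: mult_le_0_iff)
  then show False using v(2) assms(3) apex_in by simp
qed

lemma R_convex_position:
  assumes "x \<in> R" "y \<in> R" "z \<in> S - R"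
  shows "z \<notin> open_segment x y"
proof
  assume "z \<in> open_segment x y"
  then obtain u where u: "0 < u" "u < 1" "z = (1 - u) *\<^sub>R x + u *\<^sub>R y" by (auto simp: in_segment)
  have zL: "z \<in> L" using assms(3) S_eq by blast
  have "(1 - u) * orient (p m) (p b) x + u * orient (p m) (p b) y \<ge> 0"
    using L_side(2)[OF zL] unfolding u(3) orient_affine .
  moreover have "(1 - u) * orient (p m) (p b) x \<le> 0" "u * orient (p m) (p b) y \<le> 0"
    using u R_side(2) assms(1,2) by (simp_all add: mult_nonneg_nonpos)
  ultimately have "(1 - u) * orient (p m) (p b) x = 0" "u * orient (p m) (p b) y = 0" by linarith+
  then have "orient (p m) (p b) x = 0" "orient (p m) (p b) y = 0" using u by simp_all
  moreover have "x \<in> S" "y \<in> S" using assms(1,2) S_eq by blast+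
  ultimately have "x \<in> closed_segment (p m) (p b)" "y \<in> closed_segment (p m) (p b)"
    using on_triangle_closed_side[OF pos'(1)] S_side R_side(1) assms(1,2) by blast+
  then have "z \<in> closed_segment (p m) (p b)"
    unfolding u(3) using u by (intro convexD_alt[OF convex_closed_segment]) auto
  then obtain v where v: "v \<ge> 0" "z = (1 - v) *\<^sub>R p m + v *\<^sub>R p b" by (auto simp: in_segment)
  have "orient (p a) (p m) z = v * orient (p a) (p m) (p b)" unfolding v(2) orient_affine by simp
  then have "v * orient (p a) (p m) (p b) \<le> 0" using L_side(1)[OF zL] by simp
  then have "v = 0" using v(1) pos by (simp add: mult_le_0_iff)
  then show False using v(2) assms(3) apex_in by simp
qed

context
  fixes TL TR
  assumes TL: "TL \<in> chain_triangulations p a m" and TR: "TR \<in> chain_triangulations p m b"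
begin

lemma join_triangulation: "insert t (TL \<union> TR) \<in> triangulations S"
  unfolding triangulations_iff
proof (intro conjI ballI)
  have cL: "weakly_convex p a m" and cR: "weakly_convex p m b"
    using weakly_convex_subset[OF conv] am mb by simp_all
  have sL: "L \<subseteq> S" and sR: "R \<subseteq> S" using S_eq by blast+
  have "S \<inter> open_segment (p a) (p m) = {}"
    using chain_base_empty[OF cL am TL] L_convex_position[of "p a" "p m"] apex_in by blast
  moreover have "S \<inter> open_segment (p m) (p b) = {}"
    using chain_base_empty[OF cR mb TR] R_convex_position[of "p m" "p b"] apex_in by blast
  ultimately have t: "empty_triangle S t" by (simp add: empty_triangle_t_iff)
  have eL: "empty_triangle L u" if "u \<in> TL" for u using chain_triangulationsD(1)[OF TL that] .
  have eR: "empty_triangle R u" if "u \<in> TR" for u using chain_triangulationsD(1)[OF TR that] .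
  show "empty_triangle S u" if u: "u \<in> insert t (TL \<union> TR)" for u
  proof -
    consider "u = t" | "u \<in> TL" | "u \<in> TR" using u by blast
    then show ?thesis
    proof cases
      case 1 then show ?thesis using t by simp
    next
      case 2
      show ?thesis using L_convex_position by (rule empty_triangle_superset[OF eL[OF 2] sL])
    next
      case 3
      show ?thesis using R_convex_position by (rule empty_triangle_superset[OF eR[OF 3] sR])
    qed
  qed
  have inL: "u \<subseteq> convex hull L" if "u \<in> TL" for u using empty_triangle_props(1)[OF eL[OF that]] .
  have inR: "u \<subseteq> convex hull R" if "u \<in> TR" for u using empty_triangle_props(1)[OF eR[OF that]] .
  have dLt: "interior u \<inter> interior t = {}" if "u \<in> TL" for u
    using inL[OF that] by (intro disjoint_interior_orient[OF corner_distinct(1)] hull_L_side(1) t_side(1)) auto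
  have dRt: "interior u \<inter> interior t = {}" if "u \<in> TR" for u
    using inR[OF that] by (intro disjoint_interior_orient[OF corner_distinct(2)] hull_R_side(2) t_side(2)) auto
  have dLR: "interior u \<inter> interior v = {}" if "u \<in> TL" "v \<in> TR" for u v
    using inL[OF that(1)] inR[OF that(2)]
    by (intro disjoint_interior_orient[OF corner_distinct(1)] hull_L_side(1) hull_R_side(1)) auto
  show "pairwise (\<lambda>t u. interior t \<inter> interior u = {}) (insert t (TL \<union> TR))"
  proof (rule pairwiseI)
    fix u v assume uv: "u \<in> insert t (TL \<union> TR)" "v \<in> insert t (TL \<union> TR)" "u \<noteq> v"
    have LL: "interior u \<inter> interior v = {}" if "u \<in> TL" "v \<in> TL"
      using pairwiseD[OF chain_triangulationsD(2)[OF TL]] that uv(3) by blast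
    have RR: "interior u \<inter> interior v = {}" if "u \<in> TR" "v \<in> TR"
      using pairwiseD[OF chain_triangulationsD(2)[OF TR]] that uv(3) by blast
    show "interior u \<inter> interior v = {}"
      using uv LL RR dLt[of u] dLt[of v] dRt[of u] dRt[of v] dLR[of u v] dLR[of v u] by (auto simp: Int_commute)
  qed
  have *: "t' \<union> X \<union> Y = t' \<union> A \<union> B"
    if "A \<subseteq> t' \<union> X" "B \<subseteq> t' \<union> Y" "X \<subseteq> A" "Y \<subseteq> B" for A B X Y t' :: "complex set"
    using that by blast
  \<comment> \<open>For \<open>m = Suc a\<close> there is no triangle in \<open>TL\<close>, but the
    hull of \<open>L\<close> is then a side of \<open>t\<close>.\<close>
  have "convex hull L \<subseteq> t \<union> \<Union>TL"
  proof (cases "m = Suc a")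
    case True
    then have "{a..m} = {a, m}" by auto
    then have "convex hull L \<subseteq> t" by (intro hull_mono) auto
    then show ?thesis by blast
  qed (use chain_triangulationsD(4)[OF TL] in auto)
  moreover have "convex hull R \<subseteq> t \<union> \<Union>TR"
  proof (cases "b = Suc m")
    case True
    then have "{m..b} = {m, b}" by auto
    then have "convex hull R \<subseteq> t" by (intro hull_mono) auto
    then show ?thesis by blast
  qed (use chain_triangulationsD(4)[OF TR] in auto)
  moreover have "\<Union>TL \<subseteq> convex hull L" "\<Union>TR \<subseteq> convex hull R"
    using chain_triangulationsD(3)[OF TL] chain_triangulationsD(3)[OF TR] .
  ultimately have "t \<union> \<Union>TL \<union> \<Union>TR = convex hull S"
    unfolding hull_decomposition by (rule *)
  then show "\<Union>(insert t (TL \<union> TR)) = convex hull S" by (simp add: Un_assoc)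
qed

lemma join_left: "{u \<in> insert t (TL \<union> TR). u \<subseteq> convex hull L} = TL"
proof -
  have "u \<subseteq> convex hull L" if "u \<in> TL" for u
    using empty_triangle_props(1)[OF chain_triangulationsD(1)[OF TL that]] .
  moreover have "\<not> u \<subseteq> convex hull L" if "u \<in> TR" for u
    using L_not_R[OF chain_triangulationsD(1)[OF TR that]] .
  ultimately show ?thesis using t_not_subset(1) by blast
qed

lemma join_right: "{u \<in> insert t (TL \<union> TR). u \<subseteq> convex hull R} = TR"
proof -
  have "u \<subseteq> convex hull R" if "u \<in> TR" for u
    using empty_triangle_props(1)[OF chain_triangulationsD(1)[OF TR that]] .
  moreover have "\<not> u \<subseteq> convex hull R" if "u \<in> TL" for u
    using R_not_L[OF chain_triangulationsD(1)[OF TL that]] .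
  ultimately show ?thesis using t_not_subset(2) by blast
qed

end

text \<open>Splitting \<open>T\<close> by containment in the two hulls is inverse to adding
  \<open>t\<close> to a pair of triangulations of the parts.\<close>

lemma card_with_ear:
  "card {T \<in> triangulations S. t \<in> T} =
     card (chain_triangulations p a m) * card (chain_triangulations p m b)"
proof -
  have "bij_betw (\<lambda>T. ({u \<in> T. u \<subseteq> convex hull L}, {u \<in> T. u \<subseteq> convex hull R}))
     {T \<in> triangulations S. t \<in> T} (chain_triangulations p a m \<times> chain_triangulations p m b)"
  proof (rule bij_betw_byWitness[where f' = "\<lambda>(TL, TR). insert t (TL \<union> TR)"])
    show "\<forall>T\<in>{T \<in> triangulations S. t \<in> T}.
       (case ({u \<in> T. u \<subseteq> convex hull L}, {u \<in> T. u \<subseteq> convex hull R}) of (TL, TR) \<Rightarrow> insert t (TL \<union> TR)) = T"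
      using parts_join by simp
    show "\<forall>X\<in>chain_triangulations p a m \<times> chain_triangulations p m b.
       ({u \<in> case X of (TL, TR) \<Rightarrow> insert t (TL \<union> TR). u \<subseteq> convex hull L},
        {u \<in> case X of (TL, TR) \<Rightarrow> insert t (TL \<union> TR). u \<subseteq> convex hull R}) = X"
      using join_left join_right by auto
    show "(\<lambda>T. ({u \<in> T. u \<subseteq> convex hull L}, {u \<in> T. u \<subseteq> convex hull R})) ` {T \<in> triangulations S. t \<in> T}
       \<subseteq> chain_triangulations p a m \<times> chain_triangulations p m b"
      using left_part right_part by auto
    show "(\<lambda>(TL, TR). insert t (TL \<union> TR)) ` (chain_triangulations p a m \<times> chain_triangulations p m b)
       \<subseteq> {T \<in> triangulations S. t \<in> T}"
      using join_triangulation by auto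
  qed
  then show ?thesis by (simp add: bij_betw_same_card card_cartesian_product)
qed

end

section \<open>The triangle resting on the base\<close>

lemma line_segment_param:
  fixes A B :: complex
  assumes "A \<noteq> B" "s < x" "x < s'"
  shows "(1 - x) *\<^sub>R A + x *\<^sub>R B \<in> open_segment ((1 - s) *\<^sub>R A + s *\<^sub>R B) ((1 - s') *\<^sub>R A + s' *\<^sub>R B)"
proof -
  define w where "w = (x - s) / (s' - s)"
  have "w * (s' - s) = x - s" using assms by (simp add: w_def)
  then have "x = (1 - w) * s + w * s'" by (simp add: algebra_simps)
  moreover have "0 < w" "w < 1" using assms by (simp_all add: w_def)
  ultimately have w: "0 < w" "w < 1" "x = (1 - w) * s + w * s'" by blast+
  have "(1 - x) *\<^sub>R A + x *\<^sub>R B = (1 - w) *\<^sub>R ((1 - s) *\<^sub>R A + s *\<^sub>R B) + w *\<^sub>R ((1 - s') *\<^sub>R A + s' *\<^sub>R B)"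
    unfolding w(3) by (simp add: algebra_simps)
  moreover have "(1 - s) *\<^sub>R A + s *\<^sub>R B \<noteq> (1 - s') *\<^sub>R A + s' *\<^sub>R B"
  proof
    assume "(1 - s) *\<^sub>R A + s *\<^sub>R B = (1 - s') *\<^sub>R A + s' *\<^sub>R B"
    then have "(s - s') *\<^sub>R (B - A) = 0" by (simp add: algebra_simps)
    then show False using assms by simp
  qed
  ultimately show ?thesis using w(1,2) unfolding in_segment by blast
qed

text \<open>Two overlapping segments on one line, neither containing an end of the other in its
  interior, coincide; the common inner point has parameter \<open>x\<close>.\<close>

lemma base_endpoints_ordered:
  fixes A B :: complex
  assumes "A \<noteq> B" and y: "y = (1 - s) *\<^sub>R A + s *\<^sub>R B" and z: "z = (1 - s') *\<^sub>R A + s' *\<^sub>R B"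
    and "s < x" "x < s'" "0 < x" "x < 1"
    and "A \<notin> open_segment y z" "B \<notin> open_segment y z" "y \<notin> open_segment A B" "z \<notin> open_segment A B"
  shows "y = A \<and> z = B"
proof -
  note P = line_segment_param[OF \<open>A \<noteq> B\<close>]
  have "\<not> 0 < s" using P[of 0 s 1] assms(4-) by (intro notI) (simp flip: y)
  moreover have "\<not> s' < 1" using P[of 0 s' 1] assms(4-) by (intro notI) (simp flip: z)
  moreover have "\<not> s < 0" using P[of s 0 s'] assms(4-) by (intro notI) (simp flip: y z)
  moreover have "\<not> s' > 1" using P[of s 1 s'] assms(4-) by (intro notI) (simp flip: y z)
  ultimately have "s = 0" "s' = 1" by linarith+
  then show ?thesis by (simp add: y z)
qed

lemma base_endpoints:
  fixes A B :: complex
  assumes "A \<noteq> B" "orient B A y = 0" "orient B A z = 0" and c: "midpoint A B \<in> open_segment y z"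
    and nA: "A \<notin> open_segment y z" and nB: "B \<notin> open_segment y z"
    and ny: "y \<notin> open_segment A B" and nz: "z \<notin> open_segment A B"
  shows "{y, z} = {A, B}"
proof -
  obtain s where "y = (1 - s) *\<^sub>R B + s *\<^sub>R A" using orient_eq_0_line assms by metis
  then have y: "y = (1 - (1 - s)) *\<^sub>R A + (1 - s) *\<^sub>R B" by simp
  obtain s' where "z = (1 - s') *\<^sub>R B + s' *\<^sub>R A" using orient_eq_0_line assms by metis
  then have z: "z = (1 - (1 - s')) *\<^sub>R A + (1 - s') *\<^sub>R B" by simp
  obtain v where v: "0 < v" "v < 1" "midpoint A B = (1 - v) *\<^sub>R y + v *\<^sub>R z" "y \<noteq> z"
    using c by (auto simp: in_segment)
  have mid: "midpoint A B = (1 / 2) *\<^sub>R A + (1 / 2) *\<^sub>R B" by (simp add: midpoint_def scaleR_add_right)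
  define k where "k = (1 - v) * (1 - s) + v * (1 - s')"
  have "(1 / 2) *\<^sub>R A + (1 / 2) *\<^sub>R B = (1 - k) *\<^sub>R A + k *\<^sub>R B"
    using v(3) unfolding y z mid k_def by (simp add: algebra_simps)
  moreover have "(k - 1 / 2) *\<^sub>R (B - A) = ((1 - k) *\<^sub>R A + k *\<^sub>R B) - ((1 / 2) *\<^sub>R A + (1 / 2) *\<^sub>R B)"
    by (simp add: complex_eq_iff field_simps)
  ultimately have "(k - 1 / 2) *\<^sub>R (B - A) = 0" by simp
  then have half: "(1 - v) * (1 - s) + v * (1 - s') = 1 / 2" using \<open>A \<noteq> B\<close> by (simp add: k_def)
  have lem: "p < x \<and> x < q" if "(1 - w) * p + w * q = x" "p < q" "0 < w" "w < 1" for p q w x :: real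
  proof -
    have "x - p = w * (q - p)" "q - x = (1 - w) * (q - p)" using that by (auto simp: algebra_simps)
    moreover have "w * (q - p) > 0" "(1 - w) * (q - p) > 0" using that by simp_all
    ultimately show ?thesis by linarith
  qed
  have "1 - s \<noteq> 1 - s'" using v(4) y z by auto
  then consider "1 - s < 1 - s'" | "1 - s' < 1 - s" by linarith
  then show ?thesis
  proof cases
    case 1
    have "y = A \<and> z = B"
      using lem[OF half 1 v(1,2)] nA nB ny nz
      by (intro base_endpoints_ordered[OF \<open>A \<noteq> B\<close> y z, of "1 / 2"]) auto
    then show ?thesis by simp
  next
    case 2
    have "z = A \<and> y = B"
      using lem[of "1 - v" "1 - s'" "1 - s" "1 / 2"] half 2 v(1,2) nA nB ny nz
      by (intro base_endpoints_ordered[OF \<open>A \<noteq> B\<close> z y, of "1 / 2"])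
        (auto simp: open_segment_commute[of z y] algebra_simps)
    then show ?thesis by auto
  qed
qed

text \<open>Take the triangle that contains the midpoint of the base. The line of the base supports
  the polygon, so the midpoint lies inside an edge on that line; as neither this edge nor the base
  contains further points, the edge is the base, and the third corner is the apex.\<close>

lemma ear_exists:
  assumes conv: "weakly_convex p a b" and "a < b"
    and base: "p ` {a..b} \<inter> open_segment (p a) (p b) = {}"
    and T: "T \<in> triangulations (p ` {a..b})"
  shows "\<exists>m\<in>{a<..<b}. orient (p a) (p m) (p b) > 0 \<and> convex hull {p a, p m, p b} \<in> T"
proof -
  define S where "S = p ` {a..b}"
  define c where "c = midpoint (p a) (p b)"
  have ne: "p a \<noteq> p b"
    using conv \<open>a < b\<close> inj_on_eq_iff[of p "{a..b}" a b] by (auto simp: weakly_convex_def)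
  have ab: "p a \<in> S" "p b \<in> S" using \<open>a < b\<close> by (auto simp: S_def)
  have c_open: "c \<in> open_segment (p a) (p b)" using ne by (simp add: c_def)
  have "c \<in> convex hull {p a, p b}" using c_open by (simp add: open_segment_def segment_convex_hull)
  also have "\<dots> \<subseteq> convex hull S" using ab by (intro hull_mono) simp
  also have "\<dots> = \<Union>T" using T by (simp add: triangulations_iff S_def)
  finally obtain t where t: "t \<in> T" "c \<in> t" by blast
  have "empty_triangle S t" using T t by (simp add: triangulations_iff S_def)
  then obtain A B C where v: "A \<in> S" "B \<in> S" "C \<in> S" "orient A B C > 0" "t = convex hull {A, B, C}"
    "\<forall>x\<in>{A, B, C}. \<forall>y\<in>{A, B, C}. S \<inter> open_segment x y = {}"
    by (rule empty_triangleE)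
  have h: "orient (p b) (p a) x \<ge> 0" if x: "x \<in> S" for x
  proof -
    obtain i where i: "a \<le> i" "i \<le> b" "x = p i" using x unfolding S_def by auto
    have "orient (p b) (p a) x = orient (p a) x (p b)" by (simp add: orient_def' algebra_simps)
    then show ?thesis using weakly_convex_orient[OF conv, of a i b] i by simp
  qed
  have "orient (p b) (p a) c = 0"
  proof -
    have "c = (1 - 1 / 2) *\<^sub>R p a + (1 / 2) *\<^sub>R p b" by (simp add: c_def midpoint_def scaleR_add_right)
    then show ?thesis by (simp only: orient_affine) simp
  qed
  moreover have "c \<notin> {A, B, C}" using v(1-3) c_open base unfolding S_def by blast
  ultimately obtain y z w where yz: "{A, B, C} = {y, z, w}" "c \<in> open_segment y z"
    "orient (p b) (p a) y = 0" "orient (p b) (p a) z = 0"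
    using triangle_edge_through[OF v(4) _ h[OF v(1)] h[OF v(2)] h[OF v(3)]] t(2) v(5) ne by metis
  have yzS: "y \<in> S" "z \<in> S" "w \<in> S" using v(1-3) yz(1) by auto
  have "S \<inter> open_segment y z = {}"
    by (rule bspec[OF bspec[OF v(6)]]) (simp_all add: yz(1))
  then have "{y, z} = {p a, p b}"
    using yz yzS ab base ne unfolding c_def S_def by (intro base_endpoints) blast+
  then have vs: "{A, B, C} = {p a, w, p b}" using yz(1) by (metis insert_commute insert_is_Un Un_insert_left)
  obtain m where m: "m \<in> {a..b}" "w = p m" using yzS(3) unfolding S_def by blast
  have "\<not> collinear {p a, p m, p b}"
    using v(4) collinear_iff_orient[of A B C] vs m(2) by simp
  then have o: "orient (p a) (p m) (p b) \<noteq> 0" by (simp add: collinear_iff_orient)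
  then have "m \<noteq> a" "m \<noteq> b" by auto
  then have "m \<in> {a<..<b}" using m by auto
  moreover have "orient (p a) (p m) (p b) > 0"
    using o weakly_convex_orient[OF conv, of a m b] m by auto
  moreover have "convex hull {p a, p m, p b} \<in> T" using t(1) unfolding v(5) vs m(2) .
  ultimately show ?thesis by blast
qed

text \<open>Two triangles on the same side of \<open>A B\<close> overlap near the midpoint
  \<open>c\<close>: a small step from \<open>c\<close> towards \<open>M\<close> is interior to
  both.\<close>

lemma ear_unique:
  assumes T: "T \<in> triangulations S"
    and o: "orient A M B > 0" "orient A N B > 0"
    and tT: "convex hull {A, M, B} \<in> T" "convex hull {A, N, B} \<in> T"
  shows "M = N"
proof (rule ccontr)
  assume "M \<noteq> N"
  have "M \<noteq> A" "M \<noteq> B" using o(1) by auto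
  then have "{A, M, B} \<noteq> {A, N, B}" using \<open>M \<noteq> N\<close> by blast
  then have "convex hull {A, M, B} \<noteq> convex hull {A, N, B}"
    using triangle_vertices_unique[OF o] by blast
  then have d: "interior (convex hull {A, M, B}) \<inter> interior (convex hull {A, N, B}) = {}"
    using T tT by (simp add: triangulations_iff pairwise_def)
  define c where "c = (1 - 1 / 2) *\<^sub>R A + (1 / 2) *\<^sub>R B"
  have r: "orient N B A = orient A N B" "orient M B A = orient A M B" "orient B A M = orient A M B"
    by (simp_all add: orient_def' algebra_simps)
  have c: "orient A N c = orient A N B / 2" "orient N B c = orient A N B / 2"
     "orient A M c = orient A M B / 2" "orient M B c = orient A M B / 2" "orient B A c = 0"
    unfolding c_def orient_affine using r by simp_all
  have "orient A N c > 0" "orient N B c > 0" using c o by simp_all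
  then obtain e where e: "0 < e" "e < 1" "(1 - e) * orient A N c + e * orient A N M > 0"
    "(1 - e) * orient N B c + e * orient N B M > 0"
    by (rule small_perturbation_2)
  define w where "w = (1 - e) *\<^sub>R c + e *\<^sub>R M"
  have "orient B A w > 0" "orient A M w > 0" "orient M B w > 0"
    unfolding w_def orient_affine c r using e o by simp_all
  moreover have "orient A N w > 0" "orient N B w > 0"
    unfolding w_def orient_affine by (fact e)+
  ultimately have "w \<in> interior (convex hull {A, M, B})" "w \<in> interior (convex hull {A, N, B})"
    by (auto intro: in_interior_triangle)
  then show False using d by blast
qed

lemma card_triangulations_chain:
  assumes conv: "weakly_convex p a b" and "a < b"
    and base: "p ` {a..b} \<inter> open_segment (p a) (p b) = {}"
  shows "card (triangulations (p ` {a..b})) = (\<Sum>m\<in>{m \<in> {a<..<b}. orient (p a) (p m) (p b) > 0}.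
     card (chain_triangulations p a m) * card (chain_triangulations p m b))"
proof -
  define V where "V = {m \<in> {a<..<b}. orient (p a) (p m) (p b) > 0}"
  define E where "E m = {T \<in> triangulations (p ` {a..b}). convex hull {p a, p m, p b} \<in> T}" for m
  have "triangulations (p ` {a..b}) = (\<Union>m\<in>V. E m)"
    using ear_exists[OF assms] unfolding V_def E_def by blast
  also have "card \<dots> = (\<Sum>m\<in>V. card (E m))"
  proof (rule card_UN_disjoint)
    show "finite V" by (simp add: V_def)
    show "\<forall>m\<in>V. finite (E m)" by (simp add: E_def finite_triangulations)
    show "\<forall>m\<in>V. \<forall>n\<in>V. m \<noteq> n \<longrightarrow> E m \<inter> E n = {}"
    proof (intro ballI impI)
      fix m n assume mn: "m \<in> V" "n \<in> V" "m \<noteq> n"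
      then have "p m \<noteq> p n"
        using conv inj_on_eq_iff[of p "{a..b}" m n] by (auto simp: weakly_convex_def V_def)
      then show "E m \<inter> E n = {}" using ear_unique mn unfolding E_def V_def by blast
    qed
  qed
  also have "\<dots> = (\<Sum>m\<in>V. card (chain_triangulations p a m) * card (chain_triangulations p m b))"
  proof (rule sum.cong[OF refl])
    fix m assume "m \<in> V"
    then have "ear p a m b" using conv base by unfold_locales (auto simp: V_def)
    then show "card (E m) = card (chain_triangulations p a m) * card (chain_triangulations p m b)"
      unfolding E_def by (rule ear.card_with_ear)
  qed
  finally show ?thesis unfolding V_def .
qed

text \<open>Induction on the length. A chain on one side has no triangulation; otherwise every inner
  point is a proper apex, and both pieces inherit the collinearity hypothesis.\<close>

lemma card_chain_triangulations:
  assumes "weakly_convex p a b" "a < b"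
    and "\<And>i j l. a \<le> i \<Longrightarrow> i < j \<Longrightarrow> j < l \<Longrightarrow> l \<le> b \<Longrightarrow> orient (p i) (p j) (p l) = 0 \<longleftrightarrow> same_side r i l"
  shows "card (chain_triangulations p a b) = chain_count r a b"
  using assms
proof (induction "b - a" arbitrary: a b rule: less_induct)
  case less
  note conv = less.prems(1)
  show ?case
  proof (cases "b = Suc a")
    case True
    then show ?thesis by (simp add: chain_triangulations_def)
  next
    case False
    have ne: "p a \<noteq> p b"
      using conv \<open>a < b\<close> inj_on_eq_iff[of p "{a..b}" a b] by (auto simp: weakly_convex_def)
    show ?thesis
    proof (cases "same_side r a b")
      case True
      have line: "orient (p a) (p b) x = 0" if x: "x \<in> p ` {a..b}" for x
      proof -
        obtain k where k: "k \<in> {a..b}" "x = p k" using x by blast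
        have "orient (p a) (p k) (p b) = 0" if "a < k" "k < b"
          using less.prems(3)[of a k b] that True by simp
        then have "orient (p a) (p k) (p b) = 0" using k(1) by (cases "k = a \<or> k = b") auto
        then show ?thesis using orient_flip[of "p a" "p b" x] k(2) by simp
      qed
      have "triangulations (p ` {a..b}) = {}"
      proof (rule ccontr)
        assume "triangulations (p ` {a..b}) \<noteq> {}"
        then obtain T where T: "T \<in> triangulations (p ` {a..b})" by blast
        have "p a \<in> \<Union>T" using T \<open>a < b\<close> by (auto simp: triangulations_iff intro: hull_inc)
        then obtain t where "empty_triangle (p ` {a..b}) t" using T unfolding triangulations_iff by blast
        then show False using ne line by (rule no_empty_triangle_on_line)
      qed
      then show ?thesis using False True by (simp add: chain_triangulations_def chain_count_same_side)
    next
      case nss: False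
      have pos: "orient (p a) (p m) (p b) > 0" if m: "m \<in> {a<..<b}" for m
        using less.prems(3)[of a m b] m nss weakly_convex_orient[OF conv, of a m b] by auto
      have "p ` {a..b} \<inter> open_segment (p a) (p b) = {}"
      proof (rule ccontr)
        assume "\<not> ?thesis"
        then obtain i where i: "i \<in> {a..b}" "p i \<in> open_segment (p a) (p b)" by blast
        then have "i \<noteq> a" "i \<noteq> b" by (auto simp: open_segment_def)
        then have "orient (p a) (p i) (p b) > 0" using pos i(1) by simp
        moreover obtain u where "p i = (1 - u) *\<^sub>R p a + u *\<^sub>R p b" using i(2) by (auto simp: in_segment)
        then have "orient (p a) (p b) (p i) = 0" by (simp only: orient_affine) simp
        ultimately show False using orient_flip[of "p a" "p b" "p i"] by simp
      qed
      then have "card (triangulations (p ` {a..b})) = (\<Sum>m\<in>{m \<in> {a<..<b}. orient (p a) (p m) (p b) > 0}.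
         card (chain_triangulations p a m) * card (chain_triangulations p m b))"
        by (rule card_triangulations_chain[OF conv less.prems(2)])
      also have "{m \<in> {a<..<b}. orient (p a) (p m) (p b) > 0} = {a<..<b}" using pos by blast
      also have "(\<Sum>m\<in>{a<..<b}. card (chain_triangulations p a m) * card (chain_triangulations p m b)) =
         (\<Sum>m\<in>{a<..<b}. chain_count r a m * chain_count r m b)"
      proof (rule sum.cong[OF refl])
        fix m assume m: "m \<in> {a<..<b}"
        have "card (chain_triangulations p a m) = chain_count r a m"
          using m less.prems(3) by (intro less.hyps weakly_convex_subset[OF conv]) auto
        moreover have "card (chain_triangulations p m b) = chain_count r m b"
          using m less.prems(3) by (intro less.hyps weakly_convex_subset[OF conv]) auto
        ultimately show "card (chain_triangulations p a m) * card (chain_triangulations p m b) =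
          chain_count r a m * chain_count r m b" by simp
      qed
      finally show ?thesis
        using False nss \<open>a < b\<close> by (subst chain_count.simps) (simp add: chain_triangulations_def)
    qed
  qed
qed

section \<open>Subdivided convex polygons\<close>

text \<open>By the three-term Grassmann-Pluecker relation, points strictly to the left of the line
  from \<open>o'\<close> to \<open>u\<close> are ordered transitively by their angle around
  \<open>o'\<close>.\<close>

lemma orient_transitive:
  assumes "orient o' u a > 0" "orient o' u b > 0" "orient o' u c > 0" "orient o' a b > 0" "orient o' b c > 0"
  shows "orient o' a c > 0"
proof -
  have "orient o' u b * orient o' a c = orient o' u a * orient o' b c + orient o' u c * orient o' a b"
    by (simp add: orient_def' algebra_simps)
  also have "\<dots> > 0" using assms by (intro add_pos_pos mult_pos_pos)
  finally show ?thesis using assms(2) by (simp add: zero_less_mult_iff)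
qed

locale polygon =
  fixes k :: nat and v :: "nat \<Rightarrow> complex"
  assumes polygon: "convex_polygon k v"
begin

definition vertex :: "nat \<Rightarrow> complex" where "vertex i = v (i mod k)"

definition side_point :: "nat \<Rightarrow> real \<Rightarrow> complex" where
  "side_point i s = (1 - s) *\<^sub>R vertex i + s *\<^sub>R vertex (Suc i)"

lemma k3: "3 \<le> k"
  using polygon by (simp add: convex_polygon_def)

lemma side_orient: "i < k \<Longrightarrow> j < k \<Longrightarrow> j \<noteq> i \<Longrightarrow> j \<noteq> Suc i mod k \<Longrightarrow> orient (vertex i) (vertex (Suc i)) (vertex j) > 0"
  using polygon by (simp add: convex_polygon_def vertex_def)

text \<open>Convexity only speaks of triples containing a side. Induction moves the third corner on,
  and \<open>orient_transitive\<close> compares directions as seen from vertex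
  \<open>i\<close>.\<close>

lemma vertices_orient_less:
  assumes "i < j" "j < l" "l < k"
  shows "orient (vertex i) (vertex j) (vertex l) > 0"
proof -
  have "Suc j \<le> l" using assms by simp
  then show ?thesis using assms(3)
  proof (induction l rule: dec_induct)
    case base
    then have "orient (vertex j) (vertex (Suc j)) (vertex i) > 0"
      using assms(1) by (intro side_orient) auto
    then show ?case using orient_rotate by metis
  next
    case (step l)
    then have IH: "orient (vertex i) (vertex j) (vertex l) > 0" by simp
    have e: "orient (vertex i) (vertex (Suc i)) (vertex x) > 0" if "Suc i < x" "x < k" for x
      using that by (intro side_orient) auto
    have "orient (vertex l) (vertex (Suc l)) (vertex i) > 0"
      using assms(1) step by (intro side_orient) auto
    then have 2: "orient (vertex i) (vertex l) (vertex (Suc l)) > 0" using orient_rotate by metis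
    show ?case
    proof (cases "j = Suc i")
      case True
      then show ?thesis using step by (auto intro: e)
    next
      case False
      then show ?thesis
        using assms(1) step by (intro orient_transitive[OF e e e IH 2]) auto
    qed
  qed
qed

text \<open>Index \<open>k\<close> stands for vertex 0 at the end of the tour, so
  \<open>i = 0\<close>, \<open>l = k\<close> is the one case in which two corners coincide.\<close>

lemma vertices_orient_pos:
  assumes "i < j" "j < l" "l \<le> k" "\<not> (i = 0 \<and> l = k)"
  shows "orient (vertex i) (vertex j) (vertex l) > 0"
proof (cases "l = k")
  case True
  then have "orient (vertex 0) (vertex i) (vertex j) > 0"
    using assms by (intro vertices_orient_less) auto
  moreover have "vertex k = vertex 0" by (simp add: vertex_def)
  ultimately show ?thesis using True orient_rotate by metis
qed (use assms vertices_orient_less in auto)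

lemma vertices_orient_nonneg:
  assumes "i \<le> j" "j \<le> l" "l \<le> k"
  shows "orient (vertex i) (vertex j) (vertex l) \<ge> 0"
proof (cases "i < j \<and> j < l \<and> \<not> (i = 0 \<and> l = k)")
  case True
  then show ?thesis using vertices_orient_pos[of i j l] assms by simp
next
  case False
  moreover have "vertex k = vertex 0" by (simp add: vertex_def)
  ultimately have "vertex i = vertex j \<or> vertex j = vertex l \<or> vertex i = vertex l" using assms by force
  then show ?thesis by auto
qed

lemma side_point_0 [simp]: "side_point i 0 = vertex i"
  by (simp add: side_point_def)

lemma orient_side_point:
  "orient a b (side_point i s) = (1 - s) * orient a b (vertex i) + s * orient a b (vertex (Suc i))"
  "orient a (side_point i s) b = (1 - s) * orient a (vertex i) b + s * orient a (vertex (Suc i)) b"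
  "orient (side_point i s) a b = (1 - s) * orient (vertex i) a b + s * orient (vertex (Suc i)) a b"
  by (simp_all add: side_point_def orient_def' algebra_simps)

lemma convex_comb_nonneg: "0 \<le> (s :: real) \<Longrightarrow> s < 1 \<Longrightarrow> 0 \<le> x \<Longrightarrow> 0 \<le> y \<Longrightarrow> 0 \<le> (1 - s) * x + s * y"
  by simp

lemma convex_comb_pos: "0 \<le> (s :: real) \<Longrightarrow> s < 1 \<Longrightarrow> 0 < x \<Longrightarrow> 0 \<le> y \<Longrightarrow> 0 < (1 - s) * x + s * y"
  by (intro add_pos_nonneg mult_pos_pos mult_nonneg_nonneg) simp_all

text \<open>Expanding each point over the ends of its side gives nonnegative terms; the one with the
  three start vertices is positive because all parameters are below 1.\<close>

lemma orient_three_sides: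
  assumes "s1 < s2" "s2 < s3" "s3 < k" and t: "0 \<le> t1" "t1 < 1" "0 \<le> t2" "t2 < 1" "0 \<le> t3" "t3 < 1"
  shows "orient (side_point s1 t1) (side_point s2 t2) (side_point s3 t3) > 0"
proof -
  have 1: "orient (vertex i) (vertex j) (side_point s3 t3) \<ge> 0" if "i \<le> j" "j \<le> s3" for i j
    unfolding orient_side_point using that assms by (intro convex_comb_nonneg vertices_orient_nonneg) auto
  have 2: "orient (vertex i) (side_point s2 t2) (side_point s3 t3) \<ge> 0" if "i \<le> s2" for i
    unfolding orient_side_point(2) using that assms by (intro convex_comb_nonneg 1) auto
  have 3: "orient (vertex i) (vertex j) (side_point s3 t3) > 0" if "i < j" "j < s3" for i j
    unfolding orient_side_point using that assms
    by (intro convex_comb_pos vertices_orient_nonneg vertices_orient_pos) auto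
  have 4: "orient (vertex i) (side_point s2 t2) (side_point s3 t3) > 0" if "i < s2" for i
    unfolding orient_side_point(2) using that assms by (intro convex_comb_pos 1 3) auto
  show ?thesis
    unfolding orient_side_point(3)[of s1] using assms by (intro convex_comb_pos 2 4) auto
qed

lemma orient_same_side_1:
  "orient (side_point s t1) (side_point s t2) x = (t2 - t1) * orient (vertex s) (vertex (Suc s)) x"
  by (simp add: side_point_def orient_def' algebra_simps)

lemma orient_same_side_2:
  "orient x (side_point s t1) (side_point s t2) = (t2 - t1) * orient (vertex s) (vertex (Suc s)) x"
  by (simp add: side_point_def orient_def' algebra_simps)

lemma orient_side_later:
  assumes "s < s3" "s3 < k" "0 \<le> t" "t < 1"
  shows "orient (vertex s) (vertex (Suc s)) (side_point s3 t) \<ge> 0"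
    "orient (vertex s) (vertex (Suc s)) (side_point s3 t) = 0 \<longleftrightarrow> s3 = Suc s \<and> t = 0"
proof -
  show "orient (vertex s) (vertex (Suc s)) (side_point s3 t) \<ge> 0"
    unfolding orient_side_point using assms by (intro convex_comb_nonneg vertices_orient_nonneg) auto
  show "orient (vertex s) (vertex (Suc s)) (side_point s3 t) = 0 \<longleftrightarrow> s3 = Suc s \<and> t = 0"
  proof (cases "s3 = Suc s")
    case True
    have "orient (vertex s) (vertex (Suc s)) (vertex (Suc s3)) > 0"
      using assms True k3 by (intro vertices_orient_pos) auto
    then show ?thesis unfolding orient_side_point True by simp
  next
    case False
    have "orient (vertex s) (vertex (Suc s)) (side_point s3 t) > 0"
      unfolding orient_side_point using assms False
      by (intro convex_comb_pos vertices_orient_nonneg vertices_orient_pos) auto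
    then show ?thesis using False by simp
  qed
qed

text \<open>The exception comes from closing up: the last side ends at vertex 0, where side 0
  begins.\<close>

lemma orient_side_earlier:
  assumes "s1 < s" "s < k" "0 \<le> t" "t < 1"
  shows "orient (vertex s) (vertex (Suc s)) (side_point s1 t) \<ge> 0"
    "orient (vertex s) (vertex (Suc s)) (side_point s1 t) = 0 \<longleftrightarrow> s1 = 0 \<and> Suc s = k \<and> t = 0"
proof -
  have e: "orient (vertex s) (vertex (Suc s)) (side_point s1 t) =
    (1 - t) * orient (vertex s1) (vertex s) (vertex (Suc s)) + t * orient (vertex (Suc s1)) (vertex s) (vertex (Suc s))"
    unfolding orient_side_point using orient_rotate by metis
  show "orient (vertex s) (vertex (Suc s)) (side_point s1 t) \<ge> 0"
    unfolding e using assms by (intro convex_comb_nonneg vertices_orient_nonneg) auto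
  show "orient (vertex s) (vertex (Suc s)) (side_point s1 t) = 0 \<longleftrightarrow> s1 = 0 \<and> Suc s = k \<and> t = 0"
  proof (cases "s1 = 0 \<and> Suc s = k")
    case True
    have "orient (vertex (Suc s1)) (vertex s) (vertex (Suc s)) > 0"
      using assms True k3 by (intro vertices_orient_pos) auto
    moreover have "vertex (Suc s) = vertex s1" using True by (simp add: vertex_def)
    ultimately show ?thesis using True unfolding e by simp
  next
    case False
    have "orient (vertex s) (vertex (Suc s)) (side_point s1 t) > 0"
      unfolding e using assms False
      by (intro convex_comb_pos vertices_orient_nonneg vertices_orient_pos) auto
    then show ?thesis using False by auto
  qed
qed

lemma vertex_distinct:
  assumes "i < k"
  shows "vertex i \<noteq> vertex (Suc i)"
proof -
  \<comment> \<open>Some vertex that is not an end of side \<open>i\<close>.\<close>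
  define j where "j = (if i = 0 then 2 else if Suc i = k then 1 else 0 :: nat)"
  have "orient (vertex i) (vertex (Suc i)) (vertex j) > 0"
    using assms k3 by (intro side_orient) (auto simp: j_def mod_Suc)
  then show ?thesis by auto
qed

text \<open>Sorting the parameters of the inner points numbers them from 1 to \<open>r - 1\<close>
  in the order in which they occur along the side.\<close>

lemma side_parameters:
  assumes "finite S" "A \<noteq> B" "card (S \<inter> open_segment A B) = r - 1"
  shows "\<exists>\<tau> :: nat \<Rightarrow> real. (\<forall>s\<in>{1..<r}. 0 < \<tau> s \<and> \<tau> s < 1) \<and> (\<forall>s\<in>{1..<r}. \<forall>s'\<in>{1..<r}. s < s' \<longrightarrow> \<tau> s < \<tau> s') \<and>
    (\<lambda>s. (1 - \<tau> s) *\<^sub>R A + \<tau> s *\<^sub>R B) ` {1..<r} = S \<inter> open_segment A B"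
proof -
  define f where "f = (\<lambda>x :: real. (1 - x) *\<^sub>R A + x *\<^sub>R B)"
  define X where "X = {x \<in> {0<..<1}. f x \<in> S}"
  have "inj f"
  proof (rule injI)
    fix x y assume "f x = f y"
    then have "(x - y) *\<^sub>R (B - A) = 0" by (simp add: f_def algebra_simps)
    then show "x = y" using assms(2) by simp
  qed
  have fX: "f ` X = S \<inter> open_segment A B"
    using assms(2) by (auto simp: X_def f_def in_segment)
  have "card X = r - 1" using assms(3) fX card_image[of f X] \<open>inj f\<close> by (metis inj_on_subset subset_UNIV)
  have "finite X" using fX assms(1) \<open>inj f\<close> by (metis finite_Int finite_imageD inj_on_subset subset_UNIV)
  define xs where "xs = sorted_list_of_set X"
  have xs: "set xs = X" "length xs = r - 1" "sorted_wrt (<) xs"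
    using \<open>finite X\<close> \<open>card X = r - 1\<close> by (simp_all add: xs_def)
  define \<tau> where "\<tau> s = xs ! (s - 1)" for s
  have "\<tau> ` {1..<r} = X"
  proof -
    have "\<tau> ` {1..<r} = (!) xs ` {..<length xs}"
    proof -
      have "(\<lambda>s. s - 1) ` {1..<r} = {..<r - 1}"
        by (force simp: image_iff intro: bexI[of _ "Suc _"])
      then show ?thesis unfolding \<tau>_def xs(2) by (metis image_image)
    qed
    then show ?thesis using xs(1) by (auto simp: set_conv_nth image_iff)
  qed
  moreover have "\<tau> s < \<tau> s'" if "s \<in> {1..<r}" "s' \<in> {1..<r}" "s < s'" for s s'
    using sorted_wrt_nth_less[OF xs(3), of "s - 1" "s' - 1"] that xs(2) by (auto simp: \<tau>_def)
  moreover have "(\<lambda>s. (1 - \<tau> s) *\<^sub>R A + \<tau> s *\<^sub>R B) ` {1..<r} = f ` \<tau> ` {1..<r}"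
    by (simp add: f_def image_image)
  ultimately show ?thesis using fX by (intro exI[of _ \<tau>]) (auto simp: X_def)
qed

end

locale subdivided = polygon +
  fixes r :: nat and S :: "complex set" and \<tau> :: "nat \<Rightarrow> nat \<Rightarrow> real"
  assumes r: "1 \<le> r"
    and vertices_S: "v ` {..<k} \<subseteq> S"
    and S_sides: "S \<subseteq> (\<Union>i<k. closed_segment (v i) (v (Suc i mod k)))"
    and \<tau>_bounds: "\<And>i s. i < k \<Longrightarrow> s \<in> {1..<r} \<Longrightarrow> 0 < \<tau> i s \<and> \<tau> i s < 1"
    and \<tau>_mono: "\<And>i s s'. i < k \<Longrightarrow> s \<in> {1..<r} \<Longrightarrow> s' \<in> {1..<r} \<Longrightarrow> s < s' \<Longrightarrow> \<tau> i s < \<tau> i s'"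
    and \<tau>_image: "\<And>i. i < k \<Longrightarrow> (\<lambda>s. side_point i (\<tau> i s)) ` {1..<r} = S \<inter> open_segment (vertex i) (vertex (Suc i))"
begin

definition param :: "nat \<Rightarrow> real" where
  "param x = (if x mod r = 0 then 0 else \<tau> (x div r) (x mod r))"

text \<open>Number \<open>i * r\<close> names vertex \<open>i\<close>, and \<open>i * r + s\<close>
  with \<open>0 < s < r\<close> the \<open>s\<close>-th inner point of side \<open>i\<close>. At
  \<open>r * k\<close> the numbering returns to vertex 0.\<close>

definition point :: "nat \<Rightarrow> complex" where
  "point x = side_point (x div r) (param x)"

lemma param_bounds:
  assumes "x < r * k"
  shows "0 \<le> param x" "param x < 1" "param x = 0 \<longleftrightarrow> x mod r = 0"
proof -
  have "x div r < k" using assms by (simp add: less_mult_imp_div_less mult.commute)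
  then have "x mod r \<noteq> 0 \<Longrightarrow> 0 < \<tau> (x div r) (x mod r) \<and> \<tau> (x div r) (x mod r) < 1"
    using r by (intro \<tau>_bounds) auto
  then show "0 \<le> param x" "param x < 1" "param x = 0 \<longleftrightarrow> x mod r = 0" by (auto simp: param_def)
qed

lemma param_mono:
  assumes "x < y" "y < r * k" "x div r = y div r"
  shows "param x < param y"
proof -
  have m: "x mod r < y mod r" 
    using assms(1) div_mult_mod_eq[of x r] div_mult_mod_eq[of y r] unfolding assms(3) by linarith
  have "y div r < k" using assms by (simp add: less_mult_imp_div_less mult.commute)
  then show ?thesis
    using m r assms(3) \<tau>_mono[of "y div r" "x mod r" "y mod r"] param_bounds[OF assms(2)]
    by (auto simp: param_def)
qed

lemma point_n: "point (r * k) = point 0"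
  using r by (simp add: point_def param_def vertex_def)

text \<open>The cases are the ways of distributing the points over the sides. Besides a common side,
  flatness arises when \<open>j\<close> and \<open>l\<close> are on the last side, since point 0 is
  the end of that side.\<close>

lemma point_orient:
  assumes "i < j" "j < l" "l < r * k"
  shows "orient (point i) (point j) (point l) \<ge> 0"
    "orient (point i) (point j) (point l) = 0 \<longleftrightarrow> same_side r i l \<or> i = 0 \<and> (k - 1) * r \<le> j"
proof -
  define s1 s2 s3 where "s1 = i div r" and "s2 = j div r" and "s3 = l div r"
  have s: "s1 \<le> s2" "s2 \<le> s3" "s3 < k"
    using assms by (auto simp: s1_def s2_def s3_def div_le_mono less_mult_imp_div_less mult.commute)
  have il: "i < r * k" "j < r * k" "l < r * k" using assms by auto
  note b = param_bounds[OF il(1)] param_bounds[OF il(2)] param_bounds[OF il(3)]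
  have div_le: "x div r < c \<longleftrightarrow> x < c * r" for x c using r by (simp add: div_less_iff_less_mult)
  have same: "same_side r i l \<longleftrightarrow> s3 = s1 \<or> s3 = Suc s1 \<and> l mod r = 0"
  proof -
    have "l \<le> Suc s1 * r \<longleftrightarrow> l < Suc s1 * r \<or> l = Suc s1 * r" by auto
    also have "l < Suc s1 * r \<longleftrightarrow> s3 \<le> s1" using div_le[of l "Suc s1"] by (auto simp: s3_def)
    also have "l = Suc s1 * r \<longleftrightarrow> s3 = Suc s1 \<and> l mod r = 0"
      using r div_mult_mod_eq[of l r] by (auto simp: s3_def)
    finally show ?thesis using s unfolding same_side_def s1_def[symmetric] by auto
  qed
  have last: "(k - 1) * r \<le> j \<longleftrightarrow> k - 1 \<le> s2" using div_le[of j "k - 1"] by (auto simp: s2_def not_less)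
  have i0: "i = 0 \<longleftrightarrow> s1 = 0 \<and> i mod r = 0" unfolding s1_def by (metis div_mult_mod_eq add_0 mult_0 div_0 mod_0)
  have eq: "orient (point i) (point j) (point l) =
    orient (side_point s1 (param i)) (side_point s2 (param j)) (side_point s3 (param l))"
    by (simp add: point_def s1_def s2_def s3_def)
  consider "s1 < s2" "s2 < s3" | "s1 = s2" "s2 < s3" | "s1 < s2" "s2 = s3" | "s1 = s2" "s2 = s3"
    using s by linarith
  then have "orient (point i) (point j) (point l) \<ge> 0 \<and>
    (orient (point i) (point j) (point l) = 0 \<longleftrightarrow> same_side r i l \<or> i = 0 \<and> (k - 1) * r \<le> j)"
  proof cases
    case 1
    have "orient (point i) (point j) (point l) > 0"
      unfolding eq using 1 s b by (intro orient_three_sides) auto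
    moreover have "\<not> same_side r i l" "\<not> (k - 1) * r \<le> j" using 1 s unfolding same last by auto
    ultimately show ?thesis by simp
  next
    case 2
    have m: "param j - param i > 0" using param_mono[of i j] assms 2(1) by (simp add: s1_def s2_def)
    have "\<not> k - 1 \<le> s2" using 2 s by auto
    then show ?thesis
      unfolding eq 2(1) orient_same_side_1 same last
      using m orient_side_later[of s2 s3 "param l"] 2 s b by (auto simp: zero_le_mult_iff)
  next
    case 3
    have m: "param l - param j > 0" using param_mono[of j l] assms 3(2) by (simp add: s3_def s2_def)
    have "\<not> (s3 = Suc s1 \<and> l mod r = 0)"
    proof
      assume *: "s3 = Suc s1 \<and> l mod r = 0"
      then have "l = s3 * r" using div_mult_mod_eq[of l r] by (simp add: s3_def)
      moreover have "s2 * r \<le> j" by (simp add: s2_def)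
      ultimately show False using 3 assms(2) by simp
    qed
    then show ?thesis
      unfolding eq 3(2) orient_same_side_2 same last i0
      using m orient_side_earlier[of s1 s3 "param i"] 3 s b k3 by (auto simp: zero_le_mult_iff)
  next
    case 4
    have "orient (point i) (point j) (point l) = 0"
      unfolding eq 4 orient_same_side_1 by (simp add: side_point_def orient_def' algebra_simps)
    then show ?thesis using 4 same by simp
  qed
  then show "orient (point i) (point j) (point l) \<ge> 0"
    "orient (point i) (point j) (point l) = 0 \<longleftrightarrow> same_side r i l \<or> i = 0 \<and> (k - 1) * r \<le> j" by auto
qed

lemma same_side_last: "i < r * k \<Longrightarrow> same_side r i (r * k) \<longleftrightarrow> (k - 1) * r \<le> i"
proof -
  have "same_side r i (r * k) \<longleftrightarrow> k * r \<le> Suc (i div r) * r" by (simp add: same_side_def mult.commute)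
  also have "\<dots> \<longleftrightarrow> k \<le> Suc (i div r)" using r by (subst mult_le_cancel2) auto
  also have "\<dots> \<longleftrightarrow> k - 1 \<le> i div r" by auto
  also have "\<dots> \<longleftrightarrow> (k - 1) * r \<le> i" using r by (simp add: less_eq_div_iff_mult_less_eq)
  finally show ?thesis .
qed

lemma same_side_0: "same_side r 0 j \<longleftrightarrow> j \<le> r"
  by (simp add: same_side_def)

text \<open>Rotating point \<open>r * k\<close> to the front as point 0 reduces this to
  \<open>point_orient\<close>. The alternative \<open>j \<le> r\<close>, all three on the first
  side, is the one that \<open>same_side\<close> misses.\<close>

lemma point_orient_last:
  assumes "0 < i" "i < j" "j < r * k"
  shows "orient (point i) (point j) (point (r * k)) \<ge> 0"
    "orient (point i) (point j) (point (r * k)) = 0 \<longleftrightarrow> j \<le> r \<or> same_side r i (r * k)"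
proof -
  have "orient (point i) (point j) (point (r * k)) = orient (point 0) (point i) (point j)"
    unfolding point_n using orient_rotate by metis
  then show "orient (point i) (point j) (point (r * k)) \<ge> 0"
    "orient (point i) (point j) (point (r * k)) = 0 \<longleftrightarrow> j \<le> r \<or> same_side r i (r * k)"
    using point_orient[of 0 i j] assms same_side_last[of i] same_side_0[of j] by simp_all
qed

lemma point_weakly_convex: "weakly_convex point 1 (r * k)"
proof -
  have o: "orient (point i) (point j) (point l) \<ge> 0" if "1 \<le> i" "i < j" "j < l" "l \<le> r * k" for i j l
    using that point_orient(1)[of i j l] point_orient_last(1)[of i j] by (cases "l = r * k") auto
  have ne: "point i \<noteq> point j" if ij: "0 \<le> i" "i < j" "j < r * k" for i j
  proof (cases "i div r = j div r")
    case True
    have "j div r < k" using ij by (simp add: less_mult_imp_div_less mult.commute)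
    then have "vertex (j div r) \<noteq> vertex (Suc (j div r))" by (rule vertex_distinct)
    moreover have "param i < param j" using ij True by (intro param_mono) auto
    moreover have "point j - point i = (param j - param i) *\<^sub>R (vertex (Suc (j div r)) - vertex (j div r))"
      by (simp add: point_def True side_point_def algebra_simps)
    ultimately show ?thesis by auto
  next
    case False
    define q where "q = i div r"
    have q: "q < j div r" using False ij div_le_mono[of i j r] by (simp add: q_def)
    have jk: "j div r < k" using ij by (simp add: less_mult_imp_div_less mult.commute)
    have b: "0 \<le> param i" "param i < 1" "0 \<le> param j" "param j < 1" using ij param_bounds by auto
    show ?thesis
    proof
      \<comment> \<open>A point shared with a later side could only be the end vertex of side
        \<open>q\<close>, but the parameter of \<open>point i\<close> is below 1.\<close>
      assume eq: "point i = point j"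
      have "orient (vertex q) (vertex (Suc q)) (point i) = 0"
        unfolding point_def q_def orient_side_point by simp
      then have "orient (vertex q) (vertex (Suc q)) (side_point (j div r) (param j)) = 0"
        unfolding eq unfolding point_def .
      then have 1: "j div r = Suc q" "param j = 0"
        using orient_side_later(2)[OF q jk b(3,4)] by simp_all
      then have "point i = vertex (Suc q)" using eq by (simp add: point_def)
      moreover have "point i - vertex (Suc q) = (1 - param i) *\<^sub>R (vertex q - vertex (Suc q))"
        by (simp add: point_def side_point_def q_def algebra_simps)
      ultimately show False using vertex_distinct[of q] q jk b by simp
    qed
  qed
  have "inj_on point {1..r * k}"
  proof (rule linorder_inj_onI)
    fix i j assume ij: "i < j" "i \<in> {1..r * k}" "j \<in> {1..r * k}"
    show "point i \<noteq> point j"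
    proof (cases "j = r * k")
      case True
      then show ?thesis using ne[of 0 i] ij point_n by auto
    next
      case False
      then show ?thesis using ne[of i j] ij by auto
    qed
  qed auto
  then show ?thesis unfolding weakly_convex_def using o by blast
qed

lemma points_S: "point ` {1..r * k} = S"
proof
  have vS: "vertex i \<in> S" for i
    using vertices_S k3 by (auto simp: vertex_def)
  show "point ` {1..r * k} \<subseteq> S"
  proof
    fix z assume "z \<in> point ` {1..r * k}"
    then obtain x where x: "x \<in> {1..r * k}" "z = point x" by blast
    show "z \<in> S"
    proof (cases "x mod r = 0")
      case True
      then show ?thesis using x vS by (simp add: point_def param_def)
    next
      case False
      have "x < r * k" using x False by (cases "x = r * k") auto
      then have "x div r < k" by (simp add: less_mult_imp_div_less mult.commute)
      moreover have "x mod r \<in> {1..<r}" using False r by auto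
      ultimately have "side_point (x div r) (\<tau> (x div r) (x mod r)) \<in> S" using \<tau>_image by blast
      then show ?thesis using x False by (simp add: point_def param_def)
    qed
  qed
  show "S \<subseteq> point ` {1..r * k}"
  proof
    fix z assume z: "z \<in> S"
    have vertex_point: "vertex i \<in> point ` {1..r * k}" if "i \<le> k" for i
    proof (cases "i = 0")
      case True
      then have "vertex i = point (r * k)" using point_n r by (simp add: point_def param_def)
      moreover have "r * k \<in> {1..r * k}" using r k3 by simp
      ultimately show ?thesis by blast
    next
      case False
      have "vertex i = point (i * r)" using r by (simp add: point_def param_def)
      moreover have "i * r \<in> {1..r * k}" using r that False by (simp add: mult.commute)
      ultimately show ?thesis by blast
    qed
    obtain i where i: "i < k" "z \<in> closed_segment (v i) (v (Suc i mod k))" using z S_sides by blast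
    then have "z \<in> closed_segment (vertex i) (vertex (Suc i))" by (simp add: vertex_def)
    then consider "z = vertex i" | "z = vertex (Suc i)" | "z \<in> open_segment (vertex i) (vertex (Suc i))"
      by (auto simp: open_segment_def)
    then show "z \<in> point ` {1..r * k}"
    proof cases
      case 3
      then have "z \<in> (\<lambda>s. side_point i (\<tau> i s)) ` {1..<r}" using \<tau>_image[OF i(1)] z by blast
      then obtain s where s: "s \<in> {1..<r}" "z = side_point i (\<tau> i s)" by blast
      have d: "(i * r + s) div r = i" "(i * r + s) mod r = s" using s(1) by simp_all
      have "z = point (i * r + s)" using s unfolding point_def param_def d by simp
      moreover have "i * r + s \<le> Suc i * r" using s(1) by simp
      moreover have "Suc i * r \<le> k * r" using i(1) by (intro mult_le_mono1) simp
      ultimately show ?thesis using s(1) by (intro image_eqI[of _ _ "i * r + s"]) (auto simp: mult.commute)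
    qed (use vertex_point i(1) in auto)
  qed
qed

text \<open>The chain from 1 to \<open>r * k\<close> itself violates the hypothesis of
  \<open>card_chain_triangulations\<close>, since apexes up to \<open>r\<close> are collinear with
  the base. So the first triangle is removed by hand; it has an apex \<open>m > r\<close>, after
  which both pieces satisfy the hypothesis.\<close>

lemma card_triangulations:
  "card (triangulations S) = (\<Sum>m\<in>{r<..<r * k}. chain_count r 1 m * chain_count r m (r * k))"
proof -
  have k: "r * 3 \<le> r * k" using k3 by simp
  have n: "1 < r * k" "r < r * k" using k r by linarith+
  have ns: "\<not> same_side r 1 (r * k)"
  proof -
    have "(1 div r + 1) * r \<le> 2 * r" by (intro mult_le_mono1) (auto simp: div_le_dividend)
    then show ?thesis using k r unfolding same_side_def by linarith
  qed
  note conv = point_weakly_convex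
  have zero: "orient (point 1) (point m) (point (r * k)) = 0 \<longleftrightarrow> m \<le> r" if "m \<in> {1<..<r * k}" for m
    using point_orient_last(2)[of 1 m] that ns by simp
  \<comment> \<open>Going from vertex 0 along the first side, point 1 comes before the points 2 to
    \<open>r\<close>, so none of these is inside the base; later points are off its line.\<close>
  have base: "point ` {1..r * k} \<inter> open_segment (point 1) (point (r * k)) = {}"
  proof (rule ccontr)
    assume "\<not> ?thesis"
    then obtain i where i: "i \<in> {1..r * k}" "point i \<in> open_segment (point 1) (point (r * k))" by blast
    have "i \<noteq> 1" "i \<noteq> r * k" using i(2) by (auto simp: open_segment_def)
    then have i': "i \<in> {1<..<r * k}" using i(1) by auto
    obtain u where u: "0 < u" "u < 1" "point i = (1 - u) *\<^sub>R point 1 + u *\<^sub>R point (r * k)"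
      using i(2) by (auto simp: in_segment)
    have "orient (point 1) (point (r * k)) (point i) = 0" unfolding u(3) orient_affine by simp
    then have "i \<le> r" using zero[OF i'] orient_flip[of "point 1" "point (r * k)" "point i"] by simp
    then have r2: "1 < r" using i' by auto
    define A B where "A = vertex 0" and "B = vertex 1"
    have AB: "A \<noteq> B" using vertex_distinct[of 0] k3 by (simp add: A_def B_def)
    have p0: "point (r * k) = A" unfolding point_n by (simp add: point_def param_def A_def)
    have p1: "point 1 = (1 - param 1) *\<^sub>R A + param 1 *\<^sub>R B"
      using r2 by (simp add: point_def side_point_def A_def B_def)
    obtain s where s: "point i = (1 - s) *\<^sub>R A + s *\<^sub>R B" "param 1 < s"
    proof (cases "i = r")
      case True
      have "point i = (1 - 1) *\<^sub>R A + 1 *\<^sub>R B" using True r by (simp add: point_def param_def B_def)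
      then show thesis using that param_bounds(2)[of 1] n by blast
    next
      case False
      then have d: "i div r = 0" using \<open>i \<le> r\<close> by simp
      have "point i = (1 - param i) *\<^sub>R A + param i *\<^sub>R B"
        by (simp add: point_def side_point_def A_def B_def d)
      moreover have "param 1 < param i" using i' d r2 by (intro param_mono) auto
      ultimately show thesis using that by blast
    qed
    have "(s - (1 - u) * param 1) *\<^sub>R (B - A) = 0"
      using u(3) unfolding p0 p1 s(1) by (simp add: algebra_simps)
    then have "s = (1 - u) * param 1" using AB by simp
    also have "\<dots> \<le> 1 * param 1" using u param_bounds(1)[of 1] n by (intro mult_right_mono) auto
    finally show False using s(2) by simp
  qed
  have "card (triangulations (point ` {1..r * k})) =
    (\<Sum>m\<in>{m \<in> {1<..<r * k}. orient (point 1) (point m) (point (r * k)) > 0}.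
     card (chain_triangulations point 1 m) * card (chain_triangulations point m (r * k)))"
    using conv n(1) base by (rule card_triangulations_chain)
  also have "{m \<in> {1<..<r * k}. orient (point 1) (point m) (point (r * k)) > 0} = {r<..<r * k}"
  proof (intro set_eqI iffI)
    fix m assume "m \<in> {m \<in> {1<..<r * k}. orient (point 1) (point m) (point (r * k)) > 0}"
    then show "m \<in> {r<..<r * k}" using zero[of m] by auto
  next
    fix m assume "m \<in> {r<..<r * k}"
    then have m: "m \<in> {1<..<r * k}" "\<not> m \<le> r" using r by auto
    then show "m \<in> {m \<in> {1<..<r * k}. orient (point 1) (point m) (point (r * k)) > 0}"
      using zero[OF m(1)] point_orient_last(1)[of 1 m] by auto
  qed
  also have "(\<Sum>m\<in>{r<..<r * k}. card (chain_triangulations point 1 m) * card (chain_triangulations point m (r * k))) =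
    (\<Sum>m\<in>{r<..<r * k}. chain_count r 1 m * chain_count r m (r * k))"
  proof (rule sum.cong[OF refl])
    fix m assume m: "m \<in> {r<..<r * k}"
    have "card (chain_triangulations point 1 m) = chain_count r 1 m"
    proof (rule card_chain_triangulations)
      show "weakly_convex point 1 m" using conv m by (auto intro: weakly_convex_subset)
      show "orient (point i) (point j) (point l) = 0 \<longleftrightarrow> same_side r i l"
        if "1 \<le> i" "i < j" "j < l" "l \<le> m" for i j l
        using point_orient(2)[of i j l] that m by auto
    qed (use m r in auto)
    moreover have "card (chain_triangulations point m (r * k)) = chain_count r m (r * k)"
    proof (rule card_chain_triangulations)
      show "weakly_convex point m (r * k)" using conv m by (auto intro: weakly_convex_subset)
      \<comment> \<open>Here \<open>j\<close> exceeds \<open>m\<close> and hence \<open>r\<close>,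
        so the exceptional case of \<open>point_orient_last\<close> cannot occur.\<close>
      show "orient (point i) (point j) (point l) = 0 \<longleftrightarrow> same_side r i l"
        if "m \<le> i" "i < j" "j < l" "l \<le> r * k" for i j l
        using point_orient(2)[of i j l] point_orient_last(2)[of i j] that m by (cases "l = r * k") auto
    qed (use m in auto)
    ultimately show "card (chain_triangulations point 1 m) * card (chain_triangulations point m (r * k)) =
      chain_count r 1 m * chain_count r m (r * k)" by simp
  qed
  finally show ?thesis unfolding points_S .
qed

end

lemma card_triangulations_subdivided:
  assumes S: "subdivided_convex_polygon k r S" and r: "1 \<le> r"
  shows "card (triangulations S) = (\<Sum>m\<in>{r<..<r * k}. chain_count r 1 m * chain_count r m (r * k))"
proof -
  obtain v where v: "finite S" "convex_polygon k v" "v ` {..<k} \<subseteq> S"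
    "S \<subseteq> (\<Union>i<k. closed_segment (v i) (v (Suc i mod k)))"
    "\<And>i. i < k \<Longrightarrow> card (S \<inter> open_segment (v i) (v (Suc i mod k))) = r - 1"
    using S unfolding subdivided_convex_polygon_def by blast
  interpret polygon k v by unfold_locales (rule v(2))
  have "\<forall>i\<in>{..<k}. \<exists>\<tau> :: nat \<Rightarrow> real. (\<forall>s\<in>{1..<r}. 0 < \<tau> s \<and> \<tau> s < 1) \<and>
    (\<forall>s\<in>{1..<r}. \<forall>s'\<in>{1..<r}. s < s' \<longrightarrow> \<tau> s < \<tau> s') \<and>
    (\<lambda>s. side_point i (\<tau> s)) ` {1..<r} = S \<inter> open_segment (vertex i) (vertex (Suc i))"
    unfolding side_point_def
    using v(5) by (intro ballI side_parameters[OF v(1)] vertex_distinct) (simp_all add: vertex_def)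
  then obtain \<tau> :: "nat \<Rightarrow> nat \<Rightarrow> real" where \<tau>: "\<forall>i\<in>{..<k}. (\<forall>s\<in>{1..<r}. 0 < \<tau> i s \<and> \<tau> i s < 1) \<and>
    (\<forall>s\<in>{1..<r}. \<forall>s'\<in>{1..<r}. s < s' \<longrightarrow> \<tau> i s < \<tau> i s') \<and>
    (\<lambda>s. side_point i (\<tau> i s)) ` {1..<r} = S \<inter> open_segment (vertex i) (vertex (Suc i))"
    unfolding bchoice_iff by blast
  interpret subdivided k v r S \<tau>
    by unfold_locales (use r v(3,4) \<tau> in auto)
  show ?thesis by (rule card_triangulations)
qed

theorem theorem2p4:
  fixes k r :: nat and S :: "complex set"
  assumes "1 \<le> k" and "1 \<le> r" and "3 \<le> r * k"
    and "3 \<le> k \<longrightarrow> subdivided_convex_polygon k r S"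
  shows "tr k r S =
      (\<Sum>j\<in>{0..int k}. \<Sum>l\<in>{0..int r * int k - (int r + 1) * j - 2}.
         (-1) powi j * 2 powi l * ibinom (int k) j * ibinom (int k - 2 + l) l *
         ibinom ((int r - 1) * int k - l - 3) (int r * int k - (int r + 1) * j - l - 2))
    \<and> tr k r S =
      (\<Sum>j\<in>{0..int k}. \<Sum>l\<in>{0..int r * int k - (int r + 1) * j - 1}.
         (-1) powi (j + 1) * 2 powi (l - 1) * ibinom (int k) j * ibinom (int k - 3 + l) l *
         ibinom ((int r - 1) * int k - l - 2) (int r * int k - (int r + 1) * j - l - 1))"
proof -
  have pos: "1 \<le> k" "1 \<le> r" "3 \<le> r * k" by (fact assms)+
  have "tr k r S = - (1 / 2) * fls_residue (counting_series k r)"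
  proof (cases "3 \<le> k")
    case True
    have "tr k r S = of_nat (\<Sum>m\<in>{r<..<r * k}. chain_count r 1 m * chain_count r m (r * k))"
      using True assms(4) pos(2) by (simp add: tr_def card_triangulations_subdivided)
    also have "\<dots> = of_nat (chain_count r 1 (r * k)) - (if r = 1 then 0 else of_nat (chain_count r 2 (r * k)))"
      using chain_count_polygon[OF True pos(2)] by simp
    also have "\<dots> = - (1 / 2) * fls_residue (counting_series k r)"
      unfolding counting_series_residue(2)[OF pos] by (simp add: field_simps)
    finally show ?thesis .
  next
    case False
    then show ?thesis by (intro tr_eq_residue) simp
  qed
  then show ?thesis
    unfolding first_sum_eq_residue[OF pos] second_sum_eq_residue[OF pos] by blast
qed

end
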